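(* Let $M$ be a closed, orientable, $n$-dimensional $C^\infty$ manifold, let $\mathcal{M}$ be the Fréchet manifold of all $C^\infty$ Riemannian metrics on $M$, and let $d$ be the distance function on $\mathcal{M}$ induced from the $L^2$ metric $(\cdot,\cdot)$. Then $(\mathcal{M}, d)$ is a metric space.
   Context: Let $\mathcal{S}$ be the Fréchet space of $C^\infty$ sections of the bundle $S^2T^*M$ of symmetric $(0,2)$-tensors on $M$ (with the $C^\infty$ topology). $\mathcal{M}$ is the open subset of $\mathcal{S}$ consisting of the positive definite sections; it is a Fréchet manifold with $T_g\mathcal{M}\cong\mathcal{S}$ for each $g\in\mathcal{M}$. The $L^2$ metric is the (weak) Riemannian metric on $\mathcal{M}$ given by $$(h,k)_g := \int_M \operatorname{tr}_g(hk)\, d\mu_g,\qquad g\in\mathcal{M},\ h,k\in\mathcal{S}\cong T_g\mathcal{M},$$ where in local coordinates $\operatorname{tr}_g(hk)=\operatorname{tr}(g^{-1}hg^{-1}k)=g^{ij}h_{il}g^{lm}k_{jm}$ and $\mu_g$ is the volume form induced by $g$. Write $\|h\|_g=\sqrt{(h,h)_g}$. The length of a (piecewise smooth) path $g_t$, $t\in[0,1]$, in $\mathcal{M}$ is $L(g_t)=\int_0^1\|g_t'\|_{g_t}\,dt$, and $d(g_0,g_1)$ is the infimum of the lengths of paths in $\mathcal{M}$ from $g_0$ to $g_1$. *)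

theory Defs
  imports "HOL-Analysis.Analysis"
begin

section \<open>Smooth maps on open subsets of a Euclidean space\<close>

text \<open>
  On an open set the following says that all iterated directional derivatives up to order
  \<open>k\<close> exist and are continuous.
\<close>

primrec Ck_on :: "nat \<Rightarrow> 'v set \<Rightarrow> ('v::real_normed_vector \<Rightarrow> 'w::real_normed_vector) \<Rightarrow> bool" where
  "Ck_on 0 S f \<longleftrightarrow> continuous_on S f"
| "Ck_on (Suc k) S f \<longleftrightarrow>
     (\<forall>x\<in>S. f differentiable (at x)) \<and> (\<forall>v. Ck_on k S (\<lambda>x. frechet_derivative f (at x) v))"

definition smooth_on :: "'v set \<Rightarrow> ('v::real_normed_vector \<Rightarrow> 'w::real_normed_vector) \<Rightarrow> bool" where
  "smooth_on S f \<longleftrightarrow> (\<forall>k. Ck_on k S f)"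

primrec iter_deriv :: "'v list \<Rightarrow> ('v::real_normed_vector \<Rightarrow> 'w::real_normed_vector) \<Rightarrow> 'v \<Rightarrow> 'w" where
  "iter_deriv [] f = f"
| "iter_deriv (v # vs) f = iter_deriv vs (\<lambda>x. frechet_derivative f (at x) v)"


section \<open>Smooth manifolds\<close>

text \<open>A chart is a pair of its domain and its coordinate map (irrelevant off the domain).\<close>

type_synonym ('a, 'n) chart = "'a set \<times> ('a \<Rightarrow> real ^ 'n)"

definition is_chart :: "'a topology \<Rightarrow> ('a, 'n::finite) chart \<Rightarrow> bool" where
  "is_chart X c \<longleftrightarrow>
     openin X (fst c) \<and> open (snd c ` fst c) \<and>
     homeomorphic_map (subtopology X (fst c)) (top_of_set (snd c ` fst c)) (snd c)"

definition transition :: "('a, 'n::finite) chart \<Rightarrow> ('a, 'n) chart \<Rightarrow> real ^ 'n \<Rightarrow> real ^ 'n" where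
  "transition c d = snd d \<circ> inv_into (fst c) (snd c)"

definition transition_jacobian ::
    "('a, 'n::finite) chart \<Rightarrow> ('a, 'n) chart \<Rightarrow> 'a \<Rightarrow> real ^ 'n ^ 'n" where
  "transition_jacobian c d p = jacobian (transition c d) (at (snd c p))"

text \<open>The atlas need not be maximal.\<close>

definition smooth_atlas :: "'a topology \<Rightarrow> ('a, 'n::finite) chart set \<Rightarrow> bool" where
  "smooth_atlas X A \<longleftrightarrow>
     (\<forall>c\<in>A. is_chart X c) \<and> (\<Union>c\<in>A. fst c) = topspace X \<and>
     (\<forall>c\<in>A. \<forall>d\<in>A. smooth_on (snd c ` (fst c \<inter> fst d)) (transition c d))"

definition smooth_manifold :: "'a topology \<Rightarrow> ('a, 'n::finite) chart set \<Rightarrow> bool" where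
  "smooth_manifold X A \<longleftrightarrow> Hausdorff_space X \<and> second_countable X \<and> smooth_atlas X A"

definition closed_manifold :: "'a topology \<Rightarrow> ('a, 'n::finite) chart set \<Rightarrow> bool" where
  "closed_manifold X A \<longleftrightarrow> smooth_manifold X A \<and> compact_space X"

definition orientable_manifold :: "'a topology \<Rightarrow> ('a, 'n::finite) chart set \<Rightarrow> bool" where
  "orientable_manifold X A \<longleftrightarrow>
     (\<exists>B. smooth_atlas X B \<and> smooth_atlas X (A \<union> B) \<and>
       (\<forall>c\<in>B. \<forall>d\<in>B. \<forall>p\<in>fst c \<inter> fst d. det (transition_jacobian c d p) > 0))"


section \<open>Symmetric (0,2)-tensor fields and their Frechet topology\<close>

text \<open>
  A section of the bundle of symmetric (0,2)-tensors is given by its component matrices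
  \<open>h c p = (h\<^sub>i\<^sub>j(p))\<close> in the charts \<open>c\<close> of the atlas, which have to obey the transformation law
  of covariant 2-tensors; that is, the bundle is glued from its transition functions.
  Off the domains of the charts the components are set to \<open>0\<close>, so that equality of
  sections is equality of functions.
\<close>

type_synonym ('a, 'n) tensor_field = "('a, 'n) chart \<Rightarrow> 'a \<Rightarrow> real ^ 'n ^ 'n"

definition local_rep ::
    "('a, 'n::finite) tensor_field \<Rightarrow> ('a, 'n) chart \<Rightarrow> real ^ 'n \<Rightarrow> real ^ 'n ^ 'n" where
  "local_rep h c = h c \<circ> inv_into (fst c) (snd c)"

definition sym_tensors :: "('a, 'n::finite) chart set \<Rightarrow> ('a, 'n) tensor_field set" where
  "sym_tensors A = {h.
     (\<forall>c p. \<not> (c \<in> A \<and> p \<in> fst c) \<longrightarrow> h c p = 0) \<and>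
     (\<forall>c\<in>A. \<forall>p\<in>fst c. transpose (h c p) = h c p) \<and>
     (\<forall>c\<in>A. \<forall>d\<in>A. \<forall>p\<in>fst c \<inter> fst d.
        h c p = transpose (transition_jacobian c d p) ** h d p ** transition_jacobian c d p) \<and>
     (\<forall>c\<in>A. smooth_on (snd c ` fst c) (local_rep h c))}"

definition riem_metrics :: "('a, 'n::finite) chart set \<Rightarrow> ('a, 'n) tensor_field set" where
  "riem_metrics A =
     {g \<in> sym_tensors A. \<forall>c\<in>A. \<forall>p\<in>fst c. \<forall>v. v \<noteq> 0 \<longrightarrow> v \<bullet> (g c p *v v) > 0}"

text \<open>
  The \<open>C\<^sup>\<infinity>\<close> topology: uniform convergence of all iterated derivatives of the components on
  compact subsets of charts. The sets below form a subbase; the whole space is added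
  because the atlas of the empty manifold may be empty.
\<close>

definition smooth_nbhd ::
    "('a, 'n::finite) chart set \<Rightarrow> ('a, 'n) tensor_field \<Rightarrow> ('a, 'n) chart \<Rightarrow> (real ^ 'n) set \<Rightarrow>
     (real ^ 'n) list \<Rightarrow> real \<Rightarrow> ('a, 'n) tensor_field set" where
  "smooth_nbhd A h c K vs e = {k \<in> sym_tensors A.
     \<exists>e'<e. \<forall>x\<in>K. norm (iter_deriv vs (local_rep k c) x - iter_deriv vs (local_rep h c) x) \<le> e'}"

definition smooth_topology :: "('a, 'n::finite) chart set \<Rightarrow> ('a, 'n) tensor_field topology" where
  "smooth_topology A = topology_generated_by
     (insert (sym_tensors A)
       {smooth_nbhd A h c K vs e | h c K vs e.
          h \<in> sym_tensors A \<and> c \<in> A \<and> compact K \<and> K \<subseteq> snd c ` fst c \<and> e > 0})"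


section \<open>The \<open>L\<^sup>2\<close> metric\<close>

definition volume_measure ::
    "'a topology \<Rightarrow> ('a, 'n::finite) chart set \<Rightarrow> ('a, 'n) tensor_field \<Rightarrow> 'a measure" where
  "volume_measure X A g = (THE \<mu>.
     sets \<mu> = sets (sigma (topspace X) {U. openin X U}) \<and>
     (\<forall>c\<in>A. \<forall>B\<in>sets \<mu>. B \<subseteq> fst c \<longrightarrow>
        emeasure \<mu> B =
          (\<integral>\<^sup>+ x\<in>snd c ` B. ennreal (sqrt (det (local_rep g c x))) \<partial>lborel)))"

text \<open>The value does not depend on the chart chosen around \<open>p\<close>.\<close>

definition tr_prod ::
    "('a, 'n::finite) chart set \<Rightarrow> ('a, 'n) tensor_field \<Rightarrow> ('a, 'n) tensor_field \<Rightarrow>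
     ('a, 'n) tensor_field \<Rightarrow> 'a \<Rightarrow> real" where
  "tr_prod A g h k p =
     (let c = (SOME c. c \<in> A \<and> p \<in> fst c)
      in trace (matrix_inv (g c p) ** h c p ** matrix_inv (g c p) ** k c p))"

definition L2_inner ::
    "'a topology \<Rightarrow> ('a, 'n::finite) chart set \<Rightarrow> ('a, 'n) tensor_field \<Rightarrow>
     ('a, 'n) tensor_field \<Rightarrow> ('a, 'n) tensor_field \<Rightarrow> real" where
  "L2_inner X A g h k = (LINT p|volume_measure X A g. tr_prod A g h k p)"

definition L2_norm ::
    "'a topology \<Rightarrow> ('a, 'n::finite) chart set \<Rightarrow> ('a, 'n) tensor_field \<Rightarrow>
     ('a, 'n) tensor_field \<Rightarrow> real" where
  "L2_norm X A g h = sqrt (L2_inner X A g h h)"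


section \<open>Paths of metrics and the induced distance\<close>

definition has_velocity ::
    "('a, 'n::finite) chart set \<Rightarrow> (real \<Rightarrow> ('a, 'n) tensor_field) \<Rightarrow>
     ('a, 'n) tensor_field \<Rightarrow> real \<Rightarrow> real set \<Rightarrow> bool" where
  "has_velocity A \<gamma> h t T \<longleftrightarrow>
     limitin (smooth_topology A) (\<lambda>s c p. (\<gamma> s c p - \<gamma> t c p) /\<^sub>R (s - t)) h (at t within T)"

text \<open>\<open>D k\<close> is the \<open>k\<close>-th derivative of the curve, one-sided at the end points.\<close>

definition smooth_curve_on ::
    "('a, 'n::finite) chart set \<Rightarrow> real set \<Rightarrow> (real \<Rightarrow> ('a, 'n) tensor_field) \<Rightarrow> bool" where
  "smooth_curve_on A T \<gamma> \<longleftrightarrow>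
     (\<exists>D :: nat \<Rightarrow> real \<Rightarrow> ('a, 'n) tensor_field.
        (\<forall>t\<in>T. D 0 t = \<gamma> t) \<and> (\<forall>k. \<forall>t\<in>T. has_velocity A (D k) (D (Suc k) t) t T))"

definition metric_path ::
    "('a, 'n::finite) chart set \<Rightarrow> (real \<Rightarrow> ('a, 'n) tensor_field) \<Rightarrow> bool" where
  "metric_path A \<gamma> \<longleftrightarrow>
     (\<forall>t\<in>{0..1}. \<gamma> t \<in> riem_metrics A) \<and>
     (\<exists>(m::nat) \<tau> :: nat \<Rightarrow> real. \<tau> 0 = 0 \<and> \<tau> m = 1 \<and>
        (\<forall>i<m. \<tau> i < \<tau> (Suc i) \<and> smooth_curve_on A {\<tau> i..\<tau> (Suc i)} \<gamma>))"

text \<open>Unspecified at the finitely many break points of a piecewise smooth path.\<close>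

definition velocity ::
    "('a, 'n::finite) chart set \<Rightarrow> (real \<Rightarrow> ('a, 'n) tensor_field) \<Rightarrow> real \<Rightarrow> ('a, 'n) tensor_field" where
  "velocity A \<gamma> t = (THE h. has_velocity A \<gamma> h t {0..1})"

definition path_len ::
    "'a topology \<Rightarrow> ('a, 'n::finite) chart set \<Rightarrow> (real \<Rightarrow> ('a, 'n) tensor_field) \<Rightarrow> real" where
  "path_len X A \<gamma> = integral {0..1} (\<lambda>t. L2_norm X A (\<gamma> t) (velocity A \<gamma> t))"

text \<open>
  The locale for metric spaces requires symmetry and non-negativity also outside the carrier,
  hence the value \<open>0\<close> there.
\<close>

definition L2_dist ::
    "'a topology \<Rightarrow> ('a, 'n::finite) chart set \<Rightarrow> ('a, 'n) tensor_field \<Rightarrow>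
     ('a, 'n) tensor_field \<Rightarrow> real" where
  "L2_dist X A g\<^sub>0 g\<^sub>1 =
     (if g\<^sub>0 \<in> riem_metrics A \<and> g\<^sub>1 \<in> riem_metrics A
      then Inf {path_len X A \<gamma> | \<gamma>. metric_path A \<gamma> \<and> \<gamma> 0 = g\<^sub>0 \<and> \<gamma> 1 = g\<^sub>1}
      else 0)"

end

theory Submission
  imports Defs
begin

text \<open>
  The main point is positivity. In a chart the \<open>L\<^sup>2\<close> metric is the integral over points of
  the Riemannian metric \<open>tr(G\<^sup>-\<^sup>1 H G\<^sup>-\<^sup>1 H) sqrt(det G)\<close> on positive definite matrices. If
  \<open>g\<^sub>0 \<noteq> g\<^sub>1\<close>, take a chart point \<open>x\<^sub>0\<close> where they differ, a \<open>C\<^sup>1\<close> bump function \<open>f\<close> of matrices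
  supported near \<open>g\<^sub>0(x\<^sub>0)\<close>, and a small box \<open>K\<close> around \<open>x\<^sub>0\<close>. On the support of \<open>f\<close> the
  fibre metric dominates the Euclidean norm, so Cauchy--Schwarz on \<open>K\<close> bounds the derivative of
  \<open>\<integral>\<^sub>K f(g\<^sub>t(x)) dx\<close> along any path by a constant times \<open>\<parallel>g\<^sub>t'\<parallel>\<close>; this integral is positive
  at \<open>g\<^sub>0\<close> and vanishes at \<open>g\<^sub>1\<close>, which bounds all path lengths from below.

  The volume measure is assembled from finitely many Borel pieces of charts by the change of
  variables formula; speeds of smooth paths have to be shown integrable because the length is
  defined by an integral that is \<open>0\<close> otherwise.
\<close>

section \<open>Positive definite matrices\<close>

definition spd :: "real ^ 'n ^ 'n \<Rightarrow> bool" where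
  "spd G \<longleftrightarrow> transpose G = G \<and> (\<forall>v. v \<noteq> 0 \<longrightarrow> v \<bullet> (G *v v) > 0)"

lemma spd_symmetric_form:
  assumes "transpose G = G"
  shows "v \<bullet> (G *v w) = w \<bullet> (G *v (v :: real ^ 'n))"
  by (metis assms dot_lmul_matrix inner_commute transpose_matrix_vector)

lemma spd_orthonormal_family:
  fixes G :: "real ^ 'n ^ 'n"
  assumes "spd G" "finite I"
  shows "\<exists>b. \<forall>i\<in>I. \<forall>j\<in>(I::'n set). b i \<bullet> (G *v b j) = (if i = j then 1 else 0)"
  using assms(2)
proof (induction I rule: finite_induct)
  case empty
  then show ?case by simp
next
  case (insert k I)
  then obtain b where b: "\<And>i j. i \<in> I \<Longrightarrow> j \<in> I \<Longrightarrow> b i \<bullet> (G *v b j) = (if i = j then 1 else 0)"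
    by blast
  have sym: "v \<bullet> (G *v w) = w \<bullet> (G *v v)" for v w
    using assms(1) spd_symmetric_form spd_def by blast
  have "dim (span (b ` I)) \<le> card I"
    by (metis dim_span dim_le_card' insert.hyps(1) card_image_le finite_imageI le_trans)
  also have "card I < CARD('n)"
    using insert.hyps by (metis UNIV_I card_mono card_insert_disjoint finite less_eq_Suc_le subset_UNIV)
  finally have "span (b ` I) \<noteq> UNIV"
    by (metis dim_UNIV DIM_cart DIM_real mult.right_neutral less_irrefl)
  then obtain v where v: "v \<notin> span (b ` I)" by blast
  define w where "w = v - (\<Sum>i\<in>I. (b i \<bullet> (G *v v)) *\<^sub>R b i)"
  have "w \<noteq> 0"
  proof
    assume "w = 0"
    then have "v = (\<Sum>i\<in>I. (b i \<bullet> (G *v v)) *\<^sub>R b i)"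
      by (simp add: w_def)
    moreover have "\<dots> \<in> span (b ` I)"
      by (intro span_sum span_scale span_base) auto
    ultimately show False using v by simp
  qed
  then have pos: "w \<bullet> (G *v w) > 0"
    using assms(1) by (simp add: spd_def)
  have orth: "b j \<bullet> (G *v w) = 0" if "j \<in> I" for j
  proof -
    have "b j \<bullet> (G *v w) = b j \<bullet> (G *v v) - (\<Sum>i\<in>I. (b i \<bullet> (G *v v)) * (b j \<bullet> (G *v b i)))"
      by (simp add: w_def matrix_vector_mult_diff_distrib linear_sum[OF matrix_vector_mul_linear]
          inner_diff_right inner_sum_right matrix_vector_mult_scaleR)
    also have "(\<Sum>i\<in>I. (b i \<bullet> (G *v v)) * (b j \<bullet> (G *v b i))) =
        (\<Sum>i\<in>I. if j = i then b i \<bullet> (G *v v) else 0)"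
      using b that by (intro sum.cong) auto
    also have "\<dots> = b j \<bullet> (G *v v)"
      using that insert.hyps by simp
    finally show ?thesis by simp
  qed
  define u where "u = w /\<^sub>R sqrt (w \<bullet> (G *v w))"
  have uu: "u \<bullet> (G *v u) = 1"
    using pos by (simp add: u_def matrix_vector_mult_scaleR field_simps)
  have ub: "b j \<bullet> (G *v u) = 0" "u \<bullet> (G *v b j) = 0" if "j \<in> I" for j
    using orth[OF that] sym[of u "b j"] by (simp_all add: u_def matrix_vector_mult_scaleR)
  have "\<forall>i\<in>insert k I. \<forall>j\<in>insert k I. (b(k := u)) i \<bullet> (G *v (b(k := u)) j) = (if i = j then 1 else 0)"
    using insert.hyps b uu ub by auto
  then show ?case by blast
qed

lemma spd_frame:
  fixes G :: "real ^ 'n ^ 'n"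
  assumes "spd G"
  obtains B :: "real ^ 'n ^ 'n" where "transpose B ** G ** B = mat 1"
proof -
  obtain b :: "'n \<Rightarrow> _" where b: "\<And>i j. b i \<bullet> (G *v b j) = (if i = j then 1 else 0)"
    using spd_orthonormal_family[OF assms, of UNIV] by auto
  define B :: "real ^ 'n ^ 'n" where "B = (\<chi> i j. b j $ i)"
  have "(transpose B ** G ** B) $ i $ j = b i \<bullet> (G *v b j)" for i j
    by (simp add: B_def transpose_def matrix_matrix_mult_def matrix_vector_mult_def inner_vec_def
        sum_distrib_left sum_distrib_right mult_ac) (rule sum.swap)
  then have "transpose B ** G ** B = mat 1"
    by (simp add: vec_eq_iff b mat_def)
  then show ?thesis by (rule that)
qed

lemma spd_det_pos:
  assumes "spd (G :: real ^ 'n ^ 'n)"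
  shows "det G > 0"
proof -
  obtain B :: "real ^ 'n ^ 'n" where "transpose B ** G ** B = mat 1"
    using spd_frame assms by blast
  then have "det B * det G * det B = 1"
    by (metis det_I det_mul det_transpose)
  then have "(det B)\<^sup>2 * det G = 1" by (simp add: power2_eq_square mult_ac)
  then show ?thesis
    by (metis linorder_neqE_linordered_idom mult_zero_right not_one_less_zero
        one_neq_zero zero_le_power2 mult_nonneg_nonpos not_less order_less_imp_le zero_less_one)
qed

lemma matrix_inv_inverse:
  assumes "det (G :: real ^ 'n ^ 'n) \<noteq> 0"
  shows "G ** matrix_inv G = mat 1" "matrix_inv G ** G = mat 1"
proof -
  have "\<exists>B. G ** B = mat 1 \<and> B ** G = mat 1"
    using assms by (metis invertible_def invertible_det_nz)
  then have "G ** matrix_inv G = mat 1 \<and> matrix_inv G ** G = mat 1"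
    unfolding matrix_inv_def by (rule someI_ex)
  then show "G ** matrix_inv G = mat 1" "matrix_inv G ** G = mat 1" by auto
qed

lemma matrix_inv_eqI:
  assumes "G ** B = mat 1"
  shows "matrix_inv (G :: real ^ 'n ^ 'n) = B"
proof -
  have "det G \<noteq> 0"
    by (metis assms det_I det_mul mult_zero_left one_neq_zero)
  from matrix_inv_inverse(2)[OF this] show ?thesis
    by (metis assms matrix_mul_assoc matrix_mul_lid matrix_mul_rid)
qed

lemma trace_transpose_mult:
  "trace (transpose M ** M) = (norm (M :: real ^ 'n ^ 'n))\<^sup>2"
proof -
  have "trace (transpose M ** M) = (\<Sum>i\<in>UNIV. \<Sum>k\<in>UNIV. (M $ k $ i)\<^sup>2)"
    by (simp add: trace_def transpose_def matrix_matrix_mult_def power2_eq_square)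
  also have "\<dots> = (\<Sum>k\<in>UNIV. \<Sum>i\<in>UNIV. (M $ k $ i)\<^sup>2)"
    by (rule sum.swap)
  also have "\<dots> = (norm M)\<^sup>2"
    unfolding power2_norm_eq_inner by (simp add: inner_vec_def power2_eq_square)
  finally show ?thesis .
qed

text \<open>Passing to a \<open>G\<close>-orthonormal frame turns the trace into a squared Frobenius norm.\<close>

lemma spd_trace_pos:
  fixes G H :: "real ^ 'n ^ 'n"
  assumes "spd G" "transpose H = H"
  shows "trace (matrix_inv G ** H ** matrix_inv G ** H) \<ge> 0"
    and "H \<noteq> 0 \<Longrightarrow> trace (matrix_inv G ** H ** matrix_inv G ** H) > 0"
proof -
  obtain B :: "real ^ 'n ^ 'n" where B: "transpose B ** G ** B = mat 1"
    using spd_frame assms by blast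
  have B2: "G ** B ** transpose B = mat 1"
    using B matrix_left_right_inverse[of "transpose B" "G ** B"] by (simp add: matrix_mul_assoc)
  then have B3: "B ** transpose B ** G = mat 1"
    by (metis matrix_left_right_inverse matrix_mul_assoc)
  have inv: "matrix_inv G = B ** transpose B"
    using B2 by (intro matrix_inv_eqI) (simp add: matrix_mul_assoc)
  define M where "M = transpose B ** H ** B"
  have symM: "transpose M = M"
    by (simp add: M_def matrix_transpose_mul assms(2) matrix_mul_assoc)
  have "trace (matrix_inv G ** H ** matrix_inv G ** H) = trace (B ** (transpose B ** H ** B ** transpose B ** H))"
    by (simp add: inv matrix_mul_assoc)
  also have "\<dots> = trace (M ** M)"
    by (subst trace_mul_sym) (simp add: M_def matrix_mul_assoc)
  also have "\<dots> = (norm M)\<^sup>2"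
    using trace_transpose_mult[of M] symM by simp
  finally have *: "trace (matrix_inv G ** H ** matrix_inv G ** H) = (norm M)\<^sup>2" .
  show "trace (matrix_inv G ** H ** matrix_inv G ** H) \<ge> 0"
    by (simp add: *)
  show "trace (matrix_inv G ** H ** matrix_inv G ** H) > 0" if "H \<noteq> 0"
  proof -
    have "M \<noteq> 0"
    proof
      assume "M = 0"
      then have "(G ** B) ** M ** (transpose B ** G) = 0" by simp
      moreover have "(G ** B) ** M ** (transpose B ** G) = (G ** B ** transpose B) ** H ** (B ** transpose B ** G)"
        by (simp add: M_def matrix_mul_assoc)
      ultimately show False using B2 B3 that by simp
    qed
    then show ?thesis by (simp add: *)
  qed
qed

lemma matrix_inv_cramer:
  assumes "det (G :: real ^ 'n ^ 'n) \<noteq> 0"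
  shows "matrix_inv G = (\<chi> k j. det (\<chi> i l. if l = k then (if i = j then 1 else 0) else G $ i $ l) / det G)"
proof -
  have "matrix_inv G *v axis j 1 = (\<chi> k. det (\<chi> i l. if l = k then axis j 1 $ i else G $ i $ l) / det G)" for j
    by (subst cramer[OF assms, symmetric])
       (simp add: matrix_vector_mul_assoc matrix_inv_inverse[OF assms])
  then have "column j (matrix_inv G) = (\<chi> k. det (\<chi> i l. if l = k then axis j 1 $ i else G $ i $ l) / det G)" for j
    by (simp add: matrix_vector_mult_basis)
  then show ?thesis
    by (simp only: vec_eq_iff column_def axis_def vec_lambda_beta) simp
qed

lemma continuous_on_det [continuous_intros]:
  fixes f :: "'b::topological_space \<Rightarrow> real ^ 'n ^ 'n"
  assumes "continuous_on S f"
  shows "continuous_on S (\<lambda>x. det (f x))"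
  unfolding det_def by (intro continuous_intros assms)

lemma continuous_on_trace [continuous_intros]:
  fixes f :: "'b::topological_space \<Rightarrow> real ^ 'n ^ 'n"
  assumes "continuous_on S f"
  shows "continuous_on S (\<lambda>x. trace (f x))"
  unfolding trace_def by (intro continuous_intros assms)

lemma continuous_on_matrix_mult [continuous_intros]:
  fixes f g :: "'b::topological_space \<Rightarrow> real ^ 'n ^ 'n"
  assumes "continuous_on S f" "continuous_on S g"
  shows "continuous_on S (\<lambda>x. f x ** g x)"
  unfolding matrix_matrix_mult_def
  by (intro continuous_on_vec_lambda continuous_intros assms)

lemma continuous_on_matrix_inv [continuous_intros]:
  fixes f :: "'b::topological_space \<Rightarrow> real ^ 'n ^ 'n"
  assumes "continuous_on S f" "\<And>x. x \<in> S \<Longrightarrow> det (f x) \<noteq> 0"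
  shows "continuous_on S (\<lambda>x. matrix_inv (f x))"
proof -
  have *: "continuous_on S (\<lambda>x. if l = k then a else f x $ i $ l)" for k l i :: 'n and a :: real
    by (cases "l = k") (auto intro!: continuous_intros assms)
  have "continuous_on S (\<lambda>x. \<chi> k j. det (\<chi> i l. if l = k then (if i = j then 1 else 0) else f x $ i $ l) / det (f x))"
    by (intro continuous_intros continuous_on_vec_lambda assms *) (use assms in auto)
  then show ?thesis
    using assms by (simp add: matrix_inv_cramer cong: continuous_on_cong_simp)
qed

definition energy :: "real ^ 'n ^ 'n \<Rightarrow> real ^ 'n ^ 'n \<Rightarrow> real" where
  "energy G H = trace (matrix_inv G ** H ** matrix_inv G ** H) * sqrt (det G)"

lemma energy_nonneg: "spd G \<Longrightarrow> transpose H = H \<Longrightarrow> energy G H \<ge> 0"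
  unfolding energy_def by (intro mult_nonneg_nonneg spd_trace_pos) (auto intro: less_imp_le spd_det_pos)

lemma energy_pos: "spd G \<Longrightarrow> transpose H = H \<Longrightarrow> H \<noteq> 0 \<Longrightarrow> energy G H > 0"
  unfolding energy_def by (intro mult_pos_pos spd_trace_pos) (auto intro: spd_det_pos)

lemma matrix_mult_scaleR_left: "(a *\<^sub>R M) ** N = a *\<^sub>R (M ** (N :: real ^ 'n ^ 'n))"
  by (simp add: matrix_matrix_mult_def vec_eq_iff sum_distrib_left mult_ac)

lemma matrix_mult_scaleR_right: "M ** (a *\<^sub>R N) = a *\<^sub>R (M ** (N :: real ^ 'n ^ 'n))"
  by (simp add: matrix_matrix_mult_def vec_eq_iff sum_distrib_left mult_ac)

lemma trace_scaleR: "trace (a *\<^sub>R M) = a * trace (M :: real ^ 'n ^ 'n)"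
  by (simp add: trace_def sum_distrib_left)

lemma energy_scaleR: "energy G (a *\<^sub>R H) = a\<^sup>2 * energy G H"
  by (simp add: energy_def matrix_mult_scaleR_left matrix_mult_scaleR_right trace_scaleR power2_eq_square)

lemma continuous_on_energy [continuous_intros]:
  fixes f g :: "'b::topological_space \<Rightarrow> real ^ 'n ^ 'n"
  assumes "continuous_on S f" "continuous_on S g" "\<And>x. x \<in> S \<Longrightarrow> spd (f x)"
  shows "continuous_on S (\<lambda>x. energy (f x) (g x))"
proof -
  have "det (f x) \<noteq> 0" if "x \<in> S" for x
    using spd_det_pos[OF assms(3)[OF that]] by simp
  then show ?thesis
    unfolding energy_def by (intro continuous_intros assms)
qed

lemma norm_matrix_vector_mult_le: "norm (M *v v) \<le> norm (M :: real ^ 'n ^ 'm) * norm v"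
proof -
  have "norm (M *v v) = L2_set (\<lambda>i. \<bar>M $ i \<bullet> v\<bar>) UNIV"
    by (simp add: norm_vec_def matrix_vector_mult_def inner_vec_def)
  also have "\<dots> \<le> L2_set (\<lambda>i. norm (M $ i) * norm v) UNIV"
    by (intro L2_set_mono) (auto simp: Cauchy_Schwarz_ineq2)
  also have "\<dots> = norm M * norm v"
    by (subst norm_vec_def[of M]) (simp add: L2_set_left_distrib)
  finally show ?thesis .
qed

lemma spd_nhd:
  fixes G0 :: "real ^ 'n ^ 'n"
  assumes "spd G0"
  obtains r where "r > 0" "\<And>G. transpose G = G \<Longrightarrow> norm (G - G0) \<le> r \<Longrightarrow> spd G"
proof -
  have ne: "sphere (0 :: real ^ 'n) 1 \<noteq> {}"
    by (auto intro!: exI[of _ "axis undefined 1"])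
  have "continuous_on (sphere 0 1) (\<lambda>v. v \<bullet> (G0 *v v))"
    by (intro continuous_intros)
  then obtain v0 where v0: "v0 \<in> sphere 0 1" "\<And>v. v \<in> sphere 0 1 \<Longrightarrow> v0 \<bullet> (G0 *v v0) \<le> v \<bullet> (G0 *v v)"
    using continuous_attains_inf[OF compact_sphere ne] by blast
  define m where "m = v0 \<bullet> (G0 *v v0)"
  have "v0 \<noteq> 0" using v0(1) by auto
  then have m: "m > 0" using assms by (simp add: m_def spd_def)
  show ?thesis
  proof
    show "m / 2 > 0" using m by simp
  next
    fix G assume G: "transpose G = G" "norm (G - G0) \<le> m / 2"
    have "v \<bullet> (G *v v) > 0" if "v \<noteq> 0" for v
    proof -
      define u where "u = v /\<^sub>R norm v"
      have u: "norm u = 1" using that by (simp add: u_def)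
      have "u \<bullet> (G *v u) = u \<bullet> (G0 *v u) + u \<bullet> ((G - G0) *v u)"
        by (simp add: matrix_vector_mult_diff_rdistrib inner_diff_right)
      moreover have "\<bar>u \<bullet> ((G - G0) *v u)\<bar> \<le> m / 2"
        using Cauchy_Schwarz_ineq2[of u "(G - G0) *v u"] norm_matrix_vector_mult_le[of "G - G0" u] u G(2)
        by simp
      moreover have "u \<bullet> (G0 *v u) \<ge> m"
        using v0(2)[of u] u by (simp add: m_def)
      ultimately have "u \<bullet> (G *v u) > 0" using m by linarith
      moreover have "u \<bullet> (G *v u) = (v \<bullet> (G *v v)) / (norm v)\<^sup>2"
        by (simp add: u_def matrix_vector_mult_scaleR power2_eq_square divide_inverse)
      ultimately show ?thesis
        using that by (simp add: zero_less_divide_iff)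
    qed
    then show "spd G" using G by (simp add: spd_def)
  qed
qed

lemma energy_lower_bound:
  fixes G0 :: "real ^ 'n ^ 'n"
  assumes "spd G0" "r0 > 0"
  obtains r C where "r > 0" "r \<le> r0" "C > 0"
    "\<And>G H. transpose G = G \<Longrightarrow> norm (G - G0) \<le> r \<Longrightarrow> transpose H = H \<Longrightarrow> norm H \<le> C * sqrt (energy G H)"
proof -
  obtain r1 where r1: "r1 > 0" "\<And>G. transpose G = G \<Longrightarrow> norm (G - G0) \<le> r1 \<Longrightarrow> spd G"
    using spd_nhd[OF assms(1)] by blast
  define r where "r = min r0 r1"
  define Sy where "Sy = {M :: real ^ 'n ^ 'n. transpose M = M}"
  have clSy: "closed Sy"
    unfolding Sy_def transpose_def
    by (intro closed_Collect_eq continuous_on_vec_lambda continuous_intros)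
  define K where "K = (cball G0 r \<inter> Sy) \<times> (sphere 0 1 \<inter> Sy)"
  have cK: "compact K"
    unfolding K_def by (intro compact_Times compact_Int_closed clSy) auto
  have spdK: "spd (fst z)" "transpose (snd z) = snd z" "snd z \<noteq> 0" if "z \<in> K" for z
    using that r1(2)[of "fst z"] by (auto simp: K_def r_def Sy_def dist_norm norm_minus_commute)
  have "mat 1 /\<^sub>R norm (mat 1 :: real ^ 'n ^ 'n) \<in> sphere 0 1 \<inter> Sy"
  proof -
    have "(mat 1 :: real ^ 'n ^ 'n) \<noteq> 0"
      by (simp add: vec_eq_iff mat_def) 
    moreover have "transpose (a *\<^sub>R (mat 1 :: real ^ 'n ^ 'n)) = a *\<^sub>R mat 1" for a
      by (auto simp: vec_eq_iff transpose_def mat_def)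
    ultimately show ?thesis by (auto simp: Sy_def)
  qed
  moreover have "G0 \<in> cball G0 r \<inter> Sy"
    using assms r1 by (auto simp: Sy_def spd_def r_def)
  ultimately have "K \<noteq> {}" unfolding K_def by blast
  moreover have "continuous_on K (\<lambda>z. energy (fst z) (snd z))"
    by (intro continuous_intros spdK)
  ultimately obtain z where z: "z \<in> K" "\<And>y. y \<in> K \<Longrightarrow> energy (fst z) (snd z) \<le> energy (fst y) (snd y)"
    using continuous_attains_inf[OF cK] by blast
  define m where "m = energy (fst z) (snd z)"
  have m: "m > 0" unfolding m_def using z(1) by (intro energy_pos spdK)
  show ?thesis
  proof
    show "r > 0" "r \<le> r0" using assms r1 by (auto simp: r_def)
    show "1 / sqrt m > 0" using m by simp
    fix G H :: "real ^ 'n ^ 'n"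
    assume GH: "transpose G = G" "norm (G - G0) \<le> r" "transpose H = H"
    show "norm H \<le> 1 / sqrt m * sqrt (energy G H)"
    proof (cases "H = 0")
      case True
      have "spd G" using GH r1(2)[of G] by (simp add: r_def)
      then show ?thesis using True energy_nonneg[OF _ GH(3)] m by simp
    next
      case False
      define U where "U = H /\<^sub>R norm H"
      have H: "H = norm H *\<^sub>R U" using False by (simp add: U_def)
      have "transpose U = U" 
        using GH(3) by (simp add: U_def transpose_def vec_eq_iff)
      then have "(G, U) \<in> K"
        using GH False by (simp add: K_def Sy_def dist_norm norm_minus_commute U_def)
      then have "m \<le> energy G U" using z(2)[of "(G, U)"] by (simp add: m_def)
      moreover have "energy G H = (norm H)\<^sup>2 * energy G U"
        by (subst H) (simp only: energy_scaleR)
      ultimately have "(norm H)\<^sup>2 * m \<le> energy G H"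
        by (simp add: mult_left_mono)
      then have "sqrt ((norm H)\<^sup>2 * m) \<le> sqrt (energy G H)" by (rule real_sqrt_le_mono)
      then have "norm H * sqrt m \<le> sqrt (energy G H)" by (simp add: real_sqrt_mult)
      then show ?thesis using m by (simp add: field_simps)
    qed
  qed
qed

section \<open>Change of variables without an order on the index type\<close>

text \<open>
  The library states change of variables only for \<open>real ^ 'n\<close> with \<open>'n\<close> well-ordered. Every finite
  type has a well-ordered copy, and reindexing preserves Lebesgue measure and determinants.
\<close>

typedef 'n wo = "UNIV :: 'n set" by simp

definition wo_rank :: "'n::finite wo \<Rightarrow> nat" where
  "wo_rank = (\<lambda>i. (SOME f :: 'n \<Rightarrow> nat. inj f) (Rep_wo i))"

lemma inj_wo_rank: "inj (wo_rank :: 'n::finite wo \<Rightarrow> nat)"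
proof -
  have "\<exists>f :: 'n \<Rightarrow> nat. inj f"
    using finite_imp_inj_to_nat_seg[of "UNIV :: 'n set"] by auto
  then have *: "inj (SOME f :: 'n \<Rightarrow> nat. inj f)" by (rule someI_ex)
  show ?thesis
    by (rule injI) (use injD[OF *] in \<open>simp only: wo_rank_def Rep_wo_inject[symmetric]\<close>)
qed

lemma bij_Rep_wo: "bij (Rep_wo :: 'n wo \<Rightarrow> 'n)"
  by (rule o_bij[of Abs_wo]) (auto simp: fun_eq_iff Rep_wo_inverse Abs_wo_inverse)

instance wo :: (finite) finite
proof
  show "finite (UNIV :: 'a wo set)"
    using bij_betw_finite[OF bij_Rep_wo[where 'n = 'a]] by simp
qed

instantiation wo :: (finite) wellorder
begin

definition less_eq_wo :: "'a wo \<Rightarrow> 'a wo \<Rightarrow> bool" where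
  "less_eq_wo i j \<longleftrightarrow> wo_rank i \<le> wo_rank j"

definition less_wo :: "'a wo \<Rightarrow> 'a wo \<Rightarrow> bool" where
  "less_wo i j \<longleftrightarrow> wo_rank i < wo_rank j"

instance
proof
  fix P :: "'a wo \<Rightarrow> bool" and a
  assume *: "\<And>x. (\<And>y. y < x \<Longrightarrow> P y) \<Longrightarrow> P x"
  show "P a"
  proof (induction a rule: measure_induct_rule[of wo_rank])
    case (less x)
    show ?case by (rule *) (auto simp: less_wo_def intro: less)
  qed
next
  fix x y :: "'a wo"
  assume "x \<le> y" "y \<le> x"
  then have "wo_rank x = wo_rank y" by (simp add: less_eq_wo_def)
  then show "x = y" by (rule injD[OF inj_wo_rank])
qed (auto simp: less_eq_wo_def less_wo_def)

end

definition to_wo :: "real ^ 'n \<Rightarrow> real ^ 'n wo" where "to_wo x = (\<chi> i. x $ Rep_wo i)"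
definition of_wo :: "real ^ 'n wo \<Rightarrow> real ^ 'n" where "of_wo x = (\<chi> i. x $ Abs_wo i)"

lemma of_to_wo [simp]: "of_wo (to_wo x) = x" and to_of_wo [simp]: "to_wo (of_wo y) = y"
  by (auto simp: of_wo_def to_wo_def vec_eq_iff Abs_wo_inverse Rep_wo_inverse)

lemma linear_to_wo: "linear (to_wo :: real ^ 'n::finite \<Rightarrow> _)"
  by (rule linearI) (auto simp: to_wo_def vec_eq_iff)

lemma linear_of_wo: "linear (of_wo :: _ \<Rightarrow> real ^ 'n::finite)"
  by (rule linearI) (auto simp: of_wo_def vec_eq_iff)

lemma bounded_linear_to_wo: "bounded_linear (to_wo :: real ^ 'n::finite \<Rightarrow> _)"
  and bounded_linear_of_wo: "bounded_linear (of_wo :: _ \<Rightarrow> real ^ 'n::finite)"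
  by (simp_all add: linear_conv_bounded_linear[symmetric] linear_to_wo linear_of_wo)

lemma measurable_of_wo [measurable]: "(of_wo :: _ \<Rightarrow> real ^ 'n::finite) \<in> borel_measurable borel"
  by (intro borel_measurable_continuous_onI linear_continuous_on bounded_linear_of_wo)

lemma lborel_distr_of_wo: "distr lborel borel (of_wo :: _ \<Rightarrow> real ^ 'n::finite) = lborel"
proof (rule lborel_eqI[symmetric])
  fix l u :: "real ^ 'n"
  assume le: "\<And>b. b \<in> Basis \<Longrightarrow> l \<bullet> b \<le> u \<bullet> b"
  have le': "l $ i \<le> u $ i" for i
    using le[of "axis i 1"] by (simp add: inner_axis axis_in_Basis_iff)
  have "of_wo -` box l u = box (to_wo l) (to_wo u)"
  proof (rule set_eqI)
    fix x :: "real ^ 'n wo"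
    have "(\<forall>i. P (Abs_wo i :: 'n wo) i) \<longleftrightarrow> (\<forall>j. P j (Rep_wo j))" for P
      by (metis Abs_wo_inverse Rep_wo_inverse UNIV_I)
    from this[of "\<lambda>j i. l $ i < x $ j \<and> x $ j < u $ i"]
    show "x \<in> of_wo -` box l u \<longleftrightarrow> x \<in> box (to_wo l) (to_wo u)"
      by (simp add: mem_box_cart of_wo_def to_wo_def)
  qed
  then have "emeasure (distr lborel borel of_wo) (box l u) = emeasure lborel (box (to_wo l) (to_wo u))"
    by (simp add: emeasure_distr)
  also have "\<dots> = (\<Prod>b\<in>Basis. (to_wo u - to_wo l) \<bullet> b)"
    by (rule emeasure_lborel_box)
       (auto simp: Basis_vec_def inner_axis to_wo_def le')
  also have "(\<Prod>b\<in>Basis. (to_wo u - to_wo l) \<bullet> b) = (\<Prod>i\<in>UNIV. (to_wo u - to_wo l) $ i)"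
    by (simp add: Basis_vec_def UNION_singleton_eq_range prod.reindex inj_def axis_eq_axis inner_axis)
  also have "\<dots> = (\<Prod>i\<in>UNIV. (u - l) $ i)"
    using prod.reindex_bij_betw[OF bij_Rep_wo, of "\<lambda>i. (u - l) $ i"] by (simp add: to_wo_def)
  also have "\<dots> = (\<Prod>b\<in>Basis. (u - l) \<bullet> b)"
    by (simp add: Basis_vec_def UNION_singleton_eq_range prod.reindex inj_def axis_eq_axis inner_axis)
  finally show "emeasure (distr lborel borel of_wo) (box l u) = (\<Prod>b\<in>Basis. (u - l) \<bullet> b)" .
qed simp

lemma det_reindex_wo:
  fixes M :: "real ^ 'n::finite ^ 'n"
  shows "det (\<chi> i j. M $ Rep_wo i $ Rep_wo j :: real ^ 'n wo ^ 'n wo) = det M"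
proof -
  let ?r = "Rep_wo :: 'n wo \<Rightarrow> 'n" and ?a = "Abs_wo :: 'n \<Rightarrow> 'n wo"
  have inv: "inv_into UNIV ?r = ?a"
    by (rule ext) (metis Abs_wo_inverse Rep_wo_inverse UNIV_I bij_Rep_wo bij_inv_eq_iff)
  have mp: "map_permutation UNIV ?r p = ?r \<circ> p \<circ> ?a" for p
    by (auto simp: map_permutation_def fun_eq_iff inv restrict_id_def bij_is_surj[OF bij_Rep_wo])
  let ?P = "{p. p permutes (UNIV :: 'n wo set)}" and ?Q = "{p. p permutes (UNIV :: 'n set)}"
  have bija: "bij ?a"
    by (metis bij_Rep_wo bij_imp_bij_inv inv)
  have inv': "inv_into UNIV ?a = ?r"
    by (metis bij_Rep_wo inv inv_inv_eq)
  have mp': "map_permutation UNIV ?a q = ?a \<circ> q \<circ> ?r" for q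
    by (auto simp: map_permutation_def fun_eq_iff inv' restrict_id_def bij_is_surj[OF bija])
  have "map_permutation UNIV ?r ` ?P \<subseteq> ?Q" "map_permutation UNIV ?a ` ?Q \<subseteq> ?P"
    using map_permutation_permutes[OF bij_Rep_wo] map_permutation_permutes[OF bija] by blast+
  then have bij: "bij_betw (map_permutation UNIV ?r) ?P ?Q"
    by (intro bij_betw_byWitness[where f' = "map_permutation UNIV ?a"])
       (auto simp: mp mp' fun_eq_iff Rep_wo_inverse Abs_wo_inverse)
  have "det (\<chi> i j. M $ ?r i $ ?r j :: real ^ 'n wo ^ 'n wo) =
      (\<Sum>p\<in>?P. of_int (sign p) * (\<Prod>i\<in>UNIV. M $ ?r i $ ?r (p i)))"
    by (simp add: det_def)
  also have "\<dots> = (\<Sum>p\<in>?P. of_int (sign (map_permutation UNIV ?r p)) * (\<Prod>i\<in>UNIV. M $ i $ map_permutation UNIV ?r p i))"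
  proof (intro sum.cong refl arg_cong2[where f = "(*)"])
    fix p assume "p \<in> ?P"
    then show "of_int (sign p) = (of_int (sign (map_permutation UNIV ?r p)) :: real)"
      by (simp add: sign_map_permutation[OF bij_is_inj[OF bij_Rep_wo]])
    show "(\<Prod>i\<in>UNIV. M $ ?r i $ ?r (p i)) = (\<Prod>i\<in>UNIV. M $ i $ map_permutation UNIV ?r p i)"
      by (subst prod.reindex_bij_betw[OF bij_Rep_wo, symmetric]) (simp add: mp Rep_wo_inverse)
  qed
  also have "\<dots> = (\<Sum>p\<in>?Q. of_int (sign p) * (\<Prod>i\<in>UNIV. M $ i $ p i))"
    by (rule sum.reindex_bij_betw[OF bij])
  also have "\<dots> = det M" by (simp add: det_def)
  finally show ?thesis .
qed

lemma nn_integral_change_of_variables_wo: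
  fixes T :: "real ^ 'm::{finite,wellorder} \<Rightarrow> real ^ 'm::_" and u v :: "real ^ 'm::_ \<Rightarrow> real"
  assumes S: "S \<in> sets borel" "T ` S \<in> sets borel"
    and der: "\<And>x. x \<in> S \<Longrightarrow> (T has_derivative T' x) (at x within S)"
    and inj: "inj_on T S"
    and uv: "\<And>x. x \<in> S \<Longrightarrow> u x = \<bar>det (matrix (T' x))\<bar> * v (T x)"
    and v: "\<And>y. 0 \<le> v y"
    and meas: "(\<lambda>x. indicator S x * u x) \<in> borel_measurable borel"
      "(\<lambda>y. indicator (T ` S) y * v y) \<in> borel_measurable borel"
  shows "(\<integral>\<^sup>+x\<in>S. ennreal (u x) \<partial>lborel) = (\<integral>\<^sup>+y\<in>T ` S. ennreal (v y) \<partial>lborel)"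
proof -
  have char: "(\<integral>\<^sup>+x\<in>E. ennreal (w x) \<partial>lborel) = ennreal b \<longleftrightarrow>
      (\<lambda>x. vec (w x) :: real ^ 1) absolutely_integrable_on E \<and> integral E (\<lambda>x. vec (w x) :: real ^ 1) = vec b"
    if w: "\<And>x. x \<in> E \<Longrightarrow> 0 \<le> w x" and m: "(\<lambda>x. indicator E x * w x) \<in> borel_measurable borel"
      and b: "0 \<le> b" for E :: "(real ^ 'm::_) set" and w b
  proof -
    have "(\<integral>\<^sup>+x\<in>E. ennreal (w x) \<partial>lborel) = (\<integral>\<^sup>+x. ennreal (indicator E x * w x) \<partial>lborel)"
      by (intro nn_integral_cong) (auto simp: indicator_def)
    also have "\<dots> = (\<integral>\<^sup>+x. ennreal (indicator E x * w x) \<partial>lebesgue)"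
      by (simp add: nn_integral_completion)
    finally have "(\<integral>\<^sup>+x\<in>E. ennreal (w x) \<partial>lborel) = ennreal b \<longleftrightarrow>
        ((\<lambda>x. indicator E x * w x) has_integral b) UNIV"
      using w m b by (subst has_integral_iff_nn_integral_lebesgue) (auto simp: indicator_def measurable_completion)
    also have "\<dots> \<longleftrightarrow> (w has_integral b) E"
    proof -
      have "(\<lambda>x. indicator E x * w x) = (\<lambda>x. if x \<in> E then w x else 0)"
        by (auto simp: indicator_def)
      then show ?thesis by (simp add: has_integral_restrict_UNIV)
    qed
    also have "\<dots> \<longleftrightarrow> ((\<lambda>x. vec (w x) :: real ^ 1) has_integral (vec b :: real ^ 1)) E"
      by (subst has_integral_componentwise_iff) (auto simp: Basis_vec_def inner_axis)
    also have "\<dots> \<longleftrightarrow> (\<lambda>x. vec (w x) :: real ^ 1) integrable_on E \<and> integral E (\<lambda>x. vec (w x) :: real ^ 1) = vec b"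
      by (auto simp: has_integral_iff)
    also have "(\<lambda>x. vec (w x) :: real ^ 1) integrable_on E \<longleftrightarrow> (\<lambda>x. vec (w x) :: real ^ 1) absolutely_integrable_on E"
    proof
      assume "(\<lambda>x. vec (w x) :: real ^ 1) integrable_on E"
      then show "(\<lambda>x. vec (w x) :: real ^ 1) absolutely_integrable_on E"
        by (rule nonnegative_absolutely_integrable) (use w in \<open>auto simp: Basis_vec_def inner_axis\<close>)
    qed (rule set_lebesgue_integral_eq_integral)
    finally show ?thesis .
  qed
  have u: "0 \<le> u x" if "x \<in> S" for x using uv[OF that] v by simp
  have iff: "(\<integral>\<^sup>+x\<in>S. ennreal (u x) \<partial>lborel) = ennreal b \<longleftrightarrow> (\<integral>\<^sup>+y\<in>T ` S. ennreal (v y) \<partial>lborel) = ennreal b"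
    if b: "0 \<le> b" for b
  proof -
    have "(\<lambda>x. vec (u x) :: real ^ 1) absolutely_integrable_on S \<longleftrightarrow>
        (\<lambda>x. \<bar>det (matrix (T' x))\<bar> *\<^sub>R (vec (v (T x)) :: real ^ 1)) absolutely_integrable_on S"
      by (intro set_integrable_cong refl) (auto simp: uv vec_eq_iff)
    moreover have "integral S (\<lambda>x. vec (u x) :: real ^ 1) =
        integral S (\<lambda>x. \<bar>det (matrix (T' x))\<bar> *\<^sub>R (vec (v (T x)) :: real ^ 1))"
      by (rule integral_cong) (auto simp: uv vec_eq_iff)
    moreover have "S \<in> sets lebesgue" using S by auto
    ultimately show ?thesis
      using has_absolute_integral_change_of_variables[of S T T' "\<lambda>y. vec (v y) :: real ^ 1" "vec b", OF _ der inj]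
        char[of S u b, OF u meas(1) b] char[of "T ` S" v b, OF v meas(2) b]
      by simp
  qed
  show ?thesis
  proof (cases "(\<integral>\<^sup>+x\<in>S. ennreal (u x) \<partial>lborel)")
    case (real b)
    then show ?thesis using iff[of b] by simp
  next
    case top
    show ?thesis
    proof (cases "(\<integral>\<^sup>+y\<in>T ` S. ennreal (v y) \<partial>lborel)")
      case (real b)
      then show ?thesis using iff[of b] by simp
    next
      case top': top
      show ?thesis by (simp only: top top')
    qed
  qed
qed

lemma nn_integral_of_wo:
  fixes f :: "real ^ 'n::finite \<Rightarrow> ennreal"
  assumes "f \<in> borel_measurable borel"
  shows "(\<integral>\<^sup>+x. f x \<partial>lborel) = (\<integral>\<^sup>+x. f (of_wo x) \<partial>lborel)"
  using assms by (subst lborel_distr_of_wo[symmetric]) (simp add: nn_integral_distr)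

lemma nn_integral_change_of_variables:
  fixes T :: "real ^ 'n::finite \<Rightarrow> real ^ 'n" and u v :: "real ^ 'n \<Rightarrow> real"
  assumes S: "S \<in> sets borel" "T ` S \<in> sets borel"
    and der: "\<And>x. x \<in> S \<Longrightarrow> (T has_derivative (*v) (J x)) (at x)"
    and inj: "inj_on T S"
    and uv: "\<And>x. x \<in> S \<Longrightarrow> u x = \<bar>det (J x)\<bar> * v (T x)"
    and v: "\<And>y. 0 \<le> v y"
    and meas: "(\<lambda>x. indicator S x * u x) \<in> borel_measurable borel"
      "(\<lambda>y. indicator (T ` S) y * v y) \<in> borel_measurable borel"
  shows "(\<integral>\<^sup>+x\<in>S. ennreal (u x) \<partial>lborel) = (\<integral>\<^sup>+y\<in>T ` S. ennreal (v y) \<partial>lborel)"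
proof -
  have ind: "indicator E (of_wo x) = (indicator (to_wo ` E) x :: 'c :: zero_neq_one)" for E :: "(real ^ 'n) set" and x
    by (auto simp: indicator_def image_iff intro: to_of_wo[symmetric])
  have im: "to_wo ` E = of_wo -` E \<inter> space borel" for E :: "(real ^ 'n) set"
    by (auto simp: image_iff) (metis to_of_wo)
  have imb: "to_wo ` E \<in> sets borel" if "E \<in> sets borel" for E :: "(real ^ 'n) set"
    unfolding im by (rule measurable_sets[OF measurable_of_wo that])
  have transfer: "(\<integral>\<^sup>+x\<in>E. ennreal (w x) \<partial>lborel) = (\<integral>\<^sup>+x\<in>to_wo ` E. ennreal (w (of_wo x)) \<partial>lborel)"
    if "(\<lambda>x. indicator E x * w x) \<in> borel_measurable borel" for E :: "(real ^ 'n) set" and w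
  proof -
    have "(\<lambda>x. ennreal (indicator E x * w x)) \<in> borel_measurable borel" using that by measurable
    moreover have "(\<lambda>x. ennreal (indicator E x * w x)) = (\<lambda>x. ennreal (w x) * indicator E x)"
      by (auto simp: indicator_def)
    ultimately show ?thesis
      by (subst nn_integral_of_wo) (simp_all add: ind)
  qed
  define T2 where "T2 = to_wo \<circ> T \<circ> of_wo"
  define J2 where "J2 = (\<lambda>x. to_wo \<circ> (*v) (J (of_wo x)) \<circ> of_wo)"
  have T2im: "T2 ` to_wo ` S = to_wo ` T ` S"
    by (simp add: T2_def image_image)
  have mat: "matrix (J2 x) = (\<chi> i j. J (of_wo x) $ Rep_wo i $ Rep_wo j)" for x
  proof -
    have ax: "of_wo (axis j 1) = axis (Rep_wo j) (1::real)" for j :: "'n wo"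
      by (auto simp: of_wo_def axis_def vec_eq_iff Rep_wo_inverse Abs_wo_inverse)
    show ?thesis
      by (simp add: matrix_def J2_def vec_eq_iff to_wo_def matrix_vector_mult_basis column_def ax)
  qed
  have "(\<integral>\<^sup>+x\<in>to_wo ` S. ennreal (u (of_wo x)) \<partial>lborel) = (\<integral>\<^sup>+y\<in>T2 ` to_wo ` S. ennreal (v (of_wo y)) \<partial>lborel)"
  proof (rule nn_integral_change_of_variables_wo[where T' = J2])
    show "to_wo ` S \<in> sets borel" "T2 ` to_wo ` S \<in> sets borel"
      unfolding T2im by (auto intro: imb S)
    show "inj_on T2 (to_wo ` S)"
    proof (rule inj_onI)
      fix x y assume "x \<in> to_wo ` S" "y \<in> to_wo ` S" "T2 x = T2 y"
      then show "x = y"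
        using inj by (auto simp: T2_def inj_on_def) (metis of_to_wo)
    qed
    fix x assume "x \<in> to_wo ` S"
    then have x: "of_wo x \<in> S" by auto
    have "(T2 has_derivative J2 x) (at x)"
      unfolding T2_def J2_def
      by (intro diff_chain_at bounded_linear_imp_has_derivative bounded_linear_to_wo bounded_linear_of_wo)
         (simp add: der x)
    then show "(T2 has_derivative J2 x) (at x within to_wo ` S)"
      by (rule has_derivative_at_withinI)
    show "u (of_wo x) = \<bar>det (matrix (J2 x))\<bar> * v (of_wo (T2 x))"
      by (simp add: mat det_reindex_wo uv[OF x] T2_def)
  next
    have "(\<lambda>x. indicator S (of_wo x) * u (of_wo x)) \<in> borel_measurable borel"
      by (rule measurable_compose[OF measurable_of_wo meas(1)])
    then show "(\<lambda>x. indicator (to_wo ` S) x * u (of_wo x)) \<in> borel_measurable borel"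
      by (simp add: ind)
    have "(\<lambda>x. indicator (T ` S) (of_wo x) * v (of_wo x)) \<in> borel_measurable borel"
      by (rule measurable_compose[OF measurable_of_wo meas(2)])
    then show "(\<lambda>x. indicator (T2 ` to_wo ` S) x * v (of_wo x)) \<in> borel_measurable borel"
      by (simp add: ind T2im)
  qed (simp add: v)
  then show ?thesis
    using transfer[OF meas(1)] transfer[OF meas(2)] T2im by simp
qed

section \<open>The smooth topology on tensor fields\<close>

lemma has_derivative_cong_open:
  assumes "open S" "\<And>x. x \<in> S \<Longrightarrow> f x = g x" "x \<in> S"
  shows "(f has_derivative f') (at x) \<longleftrightarrow> (g has_derivative f') (at x)"
proof
  assume "(f has_derivative f') (at x)"
  then show "(g has_derivative f') (at x)"
    by (rule has_derivative_transform_within_open[OF _ assms(1,3)]) (rule assms(2))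
next
  assume "(g has_derivative f') (at x)"
  then show "(f has_derivative f') (at x)"
    by (rule has_derivative_transform_within_open[OF _ assms(1,3)]) (rule assms(2)[symmetric])
qed

lemma Ck_on_cong:
  assumes "open S" "\<And>x. x \<in> S \<Longrightarrow> f x = g x"
  shows "Ck_on k S f \<longleftrightarrow> Ck_on k S g"
  using assms(2)
proof (induction k arbitrary: f g)
  case 0
  then show ?case by (auto intro: continuous_on_cong)
next
  case (Suc k)
  have hd: "(f has_derivative f') (at x) \<longleftrightarrow> (g has_derivative f') (at x)" if "x \<in> S" for x f'
    using has_derivative_cong_open[OF assms(1) Suc.prems that] .
  have d: "f differentiable at x \<longleftrightarrow> g differentiable at x" if "x \<in> S" for x
    using hd[OF that] by (simp add: differentiable_def)
  have fd: "frechet_derivative f (at x) = frechet_derivative g (at x)" if "x \<in> S" for x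
    using hd[OF that] by (simp add: frechet_derivative_def)
  have "Ck_on k S (\<lambda>x. frechet_derivative f (at x) v) \<longleftrightarrow> Ck_on k S (\<lambda>x. frechet_derivative g (at x) v)" for v
    by (rule Suc.IH) (simp only: fd)
  then show ?case by (simp add: d cong: ball_cong)
qed

lemma frechet_derivative_scaleR_at:
  "f differentiable at x \<Longrightarrow>
    frechet_derivative (\<lambda>x. a *\<^sub>R f x) (at x) = (\<lambda>v. a *\<^sub>R frechet_derivative f (at x) v)"
  unfolding frechet_derivative_works
  by (rule frechet_derivative_at[symmetric]) (rule has_derivative_scaleR_right)

lemma frechet_derivative_add_at:
  "f differentiable at x \<Longrightarrow> g differentiable at x \<Longrightarrow>
    frechet_derivative (\<lambda>x. f x + g x) (at x) =
      (\<lambda>v. frechet_derivative f (at x) v + frechet_derivative g (at x) v)"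
  unfolding frechet_derivative_works
  by (rule frechet_derivative_at[symmetric]) (rule has_derivative_add)

lemma Ck_on_scaleR:
  assumes "open S"
  shows "Ck_on k S f \<Longrightarrow> Ck_on k S (\<lambda>x. a *\<^sub>R f x)"
proof (induction k arbitrary: f)
  case (Suc k)
  have "Ck_on k S (\<lambda>x. frechet_derivative (\<lambda>x. a *\<^sub>R f x) (at x) v)" for v
    using Suc by (subst Ck_on_cong[OF assms, where g = "\<lambda>x. a *\<^sub>R frechet_derivative f (at x) v"])
      (auto simp: frechet_derivative_scaleR_at)
  then show ?case using Suc.prems by auto
qed (simp add: continuous_on_scaleR)

lemma Ck_on_add:
  assumes "open S"
  shows "Ck_on k S f \<Longrightarrow> Ck_on k S g \<Longrightarrow> Ck_on k S (\<lambda>x. f x + g x)"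
proof (induction k arbitrary: f g)
  case (Suc k)
  have "Ck_on k S (\<lambda>x. frechet_derivative (\<lambda>x. f x + g x) (at x) v)" for v
    using Suc by (subst Ck_on_cong[OF assms,
        where g = "\<lambda>x. frechet_derivative f (at x) v + frechet_derivative g (at x) v"])
      (auto simp: frechet_derivative_add_at)
  then show ?case using Suc.prems by auto
qed (simp add: continuous_on_add)

lemma iter_deriv_cong:
  assumes "open S" "\<And>x. x \<in> S \<Longrightarrow> f x = g x" "x \<in> S"
  shows "iter_deriv vs f x = iter_deriv vs g x"
  using assms(2)
proof (induction vs arbitrary: f g)
  case (Cons v vs)
  have "frechet_derivative f (at x) = frechet_derivative g (at x)" if "x \<in> S" for x
    using has_derivative_cong_open[OF assms(1) Cons.prems that] by (simp add: frechet_derivative_def)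
  then show ?case
    unfolding iter_deriv.simps by (intro Cons.IH) simp
next
  case Nil
  show ?case using Nil[OF assms(3)] by simp
qed

lemma iter_deriv_scaleR:
  assumes "open S" "x \<in> S"
  shows "smooth_on S f \<Longrightarrow> iter_deriv vs (\<lambda>x. a *\<^sub>R f x) x = a *\<^sub>R iter_deriv vs f x"
proof (induction vs arbitrary: f)
  case (Cons v vs)
  have suc: "Ck_on (Suc k) S f" for k
    using Cons.prems by (simp only: smooth_on_def)
  have d: "f differentiable at y" if "y \<in> S" for y
    using suc[of 0] that by simp
  have sm: "smooth_on S (\<lambda>x. frechet_derivative f (at x) v)"
    using suc by (simp add: smooth_on_def)
  have "iter_deriv (v # vs) (\<lambda>x. a *\<^sub>R f x) x = iter_deriv vs (\<lambda>x. a *\<^sub>R frechet_derivative f (at x) v) x"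
    unfolding iter_deriv.simps
    by (rule iter_deriv_cong[OF assms(1) _ assms(2)]) (simp add: frechet_derivative_scaleR_at d)
  also have "\<dots> = a *\<^sub>R iter_deriv vs (\<lambda>x. frechet_derivative f (at x) v) x"
    by (rule Cons.IH[OF sm])
  finally show ?case by simp
qed simp

lemma limitin_topology_generated_by:
  "limitin (topology_generated_by B) f l F \<longleftrightarrow>
    l \<in> \<Union>B \<and> (\<forall>b\<in>B. l \<in> b \<longrightarrow> eventually (\<lambda>s. f s \<in> b) F)"
proof
  assume "limitin (topology_generated_by B) f l F"
  then show "l \<in> \<Union>B \<and> (\<forall>b\<in>B. l \<in> b \<longrightarrow> eventually (\<lambda>s. f s \<in> b) F)"
    by (auto simp: limitin_def topology_generated_by_Basis)
next
  assume *: "l \<in> \<Union>B \<and> (\<forall>b\<in>B. l \<in> b \<longrightarrow> eventually (\<lambda>s. f s \<in> b) F)"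
  have "l \<in> U \<longrightarrow> eventually (\<lambda>s. f s \<in> U) F" if "generate_topology_on B U" for U
    using that
  proof (induction rule: generate_topology_on.induct)
    case (Int a b)
    then show ?case by (auto intro: eventually_conj)
  next
    case (UN K)
    show ?case
    proof
      assume "l \<in> \<Union>K"
      then obtain k where k: "k \<in> K" "l \<in> k" by blast
      with UN have "\<forall>\<^sub>F s in F. f s \<in> k" by blast
      then show "\<forall>\<^sub>F s in F. f s \<in> \<Union>K"
        by eventually_elim (use k in blast)
    qed
  qed (use * in auto)
  then show "limitin (topology_generated_by B) f l F"
    using * by (auto simp: limitin_def openin_topology_generated_by_iff)
qed

lemma limitin_smooth_topology:
  "limitin (smooth_topology A) f l F \<longleftrightarrow>
    l \<in> sym_tensors A \<and> eventually (\<lambda>s. f s \<in> sym_tensors A) F \<and>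
    (\<forall>h c K vs e. h \<in> sym_tensors A \<longrightarrow> c \<in> A \<longrightarrow> compact K \<longrightarrow> K \<subseteq> snd c ` fst c \<longrightarrow> e > 0 \<longrightarrow>
      l \<in> smooth_nbhd A h c K vs e \<longrightarrow> eventually (\<lambda>s. f s \<in> smooth_nbhd A h c K vs e) F)"
  (is "?L \<longleftrightarrow> ?R")
proof -
  let ?N = "{smooth_nbhd A h c K vs e | h c K vs e.
    h \<in> sym_tensors A \<and> c \<in> A \<and> compact K \<and> K \<subseteq> snd c ` fst c \<and> e > 0}"
  have sub: "\<Union>(insert (sym_tensors A) ?N) = sym_tensors A"
    by (auto simp: smooth_nbhd_def)
  have "?L \<longleftrightarrow> l \<in> sym_tensors A \<and>
      (\<forall>b\<in>insert (sym_tensors A) ?N. l \<in> b \<longrightarrow> eventually (\<lambda>s. f s \<in> b) F)"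
    unfolding smooth_topology_def limitin_topology_generated_by sub ..
  also have "\<dots> \<longleftrightarrow> l \<in> sym_tensors A \<and> eventually (\<lambda>s. f s \<in> sym_tensors A) F \<and>
      (\<forall>b\<in>?N. l \<in> b \<longrightarrow> eventually (\<lambda>s. f s \<in> b) F)"
    by auto
  also have "(\<forall>b\<in>?N. l \<in> b \<longrightarrow> eventually (\<lambda>s. f s \<in> b) F) \<longleftrightarrow>
    (\<forall>h c K vs e. h \<in> sym_tensors A \<longrightarrow> c \<in> A \<longrightarrow> compact K \<longrightarrow> K \<subseteq> snd c ` fst c \<longrightarrow> e > 0 \<longrightarrow>
      l \<in> smooth_nbhd A h c K vs e \<longrightarrow> eventually (\<lambda>s. f s \<in> smooth_nbhd A h c K vs e) F)"
    unfolding Ball_def mem_Collect_eq by metis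
  finally show ?thesis .
qed

lemma limitin_smooth_uniform:
  assumes "limitin (smooth_topology A) f l F" "c \<in> A" "compact K" "K \<subseteq> snd c ` fst c"
  shows "uniform_limit K (\<lambda>s. local_rep (f s) c) (local_rep l c) F"
proof (rule uniform_limitI)
  fix e :: real assume e: "e > 0"
  have l: "l \<in> sym_tensors A" using assms(1) by (simp add: limitin_smooth_topology)
  then have "l \<in> smooth_nbhd A l c K [] e"
    using e by (auto simp: smooth_nbhd_def intro!: exI[of _ 0])
  then have "eventually (\<lambda>s. f s \<in> smooth_nbhd A l c K [] e) F"
    using assms l e unfolding limitin_smooth_topology by blast
  then show "\<forall>\<^sub>F s in F. \<forall>x\<in>K. dist (local_rep (f s) c x) (local_rep l c x) < e"
    by eventually_elim (auto simp: smooth_nbhd_def dist_norm intro: le_less_trans)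
qed

lemma local_rep_inv:
  assumes "is_chart X c" "p \<in> fst c"
  shows "inv_into (fst c) (snd c) (snd c p) = p" "local_rep h c (snd c p) = h c p"
proof -
  have "topspace (subtopology X (fst c)) = fst c"
    using assms(1) openin_subset[of X "fst c"] by (auto simp: is_chart_def)
  then have "inj_on (snd c) (fst c)"
    using assms(1) homeomorphic_imp_injective_map by (metis is_chart_def)
  then show "inv_into (fst c) (snd c) (snd c p) = p" "local_rep h c (snd c p) = h c p"
    using assms by (auto simp: local_rep_def)
qed

lemma sym_tensorsD:
  assumes "h \<in> sym_tensors A"
  shows "\<not> (c \<in> A \<and> p \<in> fst c) \<Longrightarrow> h c p = 0"
    and "c \<in> A \<Longrightarrow> p \<in> fst c \<Longrightarrow> transpose (h c p) = h c p"
    and "c \<in> A \<Longrightarrow> d \<in> A \<Longrightarrow> p \<in> fst c \<Longrightarrow> p \<in> fst d \<Longrightarrow>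
      h c p = transpose (transition_jacobian c d p) ** h d p ** transition_jacobian c d p"
    and "c \<in> A \<Longrightarrow> smooth_on (snd c ` fst c) (local_rep h c)"
  using assms unfolding sym_tensors_def by blast+

lemma sym_tensorsI:
  assumes "\<And>c p. \<not> (c \<in> A \<and> p \<in> fst c) \<Longrightarrow> h c p = 0"
    and "\<And>c p. c \<in> A \<Longrightarrow> p \<in> fst c \<Longrightarrow> transpose (h c p) = h c p"
    and "\<And>c d p. c \<in> A \<Longrightarrow> d \<in> A \<Longrightarrow> p \<in> fst c \<Longrightarrow> p \<in> fst d \<Longrightarrow>
      h c p = transpose (transition_jacobian c d p) ** h d p ** transition_jacobian c d p"
    and "\<And>c. c \<in> A \<Longrightarrow> smooth_on (snd c ` fst c) (local_rep h c)"
  shows "h \<in> sym_tensors A"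
  using assms unfolding sym_tensors_def by blast

lemma sym_tensors_eqI:
  assumes "smooth_atlas X A" "h \<in> sym_tensors A" "k \<in> sym_tensors A"
    "\<And>c x. c \<in> A \<Longrightarrow> x \<in> snd c ` fst c \<Longrightarrow> local_rep h c x = local_rep k c x"
  shows "h = k"
proof (intro ext)
  fix c p
  show "h c p = k c p"
  proof (cases "c \<in> A \<and> p \<in> fst c")
    case True
    then have "is_chart X c" using assms(1) by (auto simp: smooth_atlas_def)
    then show ?thesis using True assms(4)[of c "snd c p"] local_rep_inv(2)[of X c p] by auto
  next
    case False
    then show ?thesis using sym_tensorsD(1)[OF assms(2)] sym_tensorsD(1)[OF assms(3)] by metis
  qed
qed

lemma limitin_smooth_unique:
  assumes "smooth_atlas X A" "limitin (smooth_topology A) f l F" "limitin (smooth_topology A) f l' F"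
    "F \<noteq> bot"
  shows "l = l'"
proof (rule sym_tensors_eqI[OF assms(1)])
  fix c x assume c: "c \<in> A" "x \<in> snd c ` fst c"
  have "((\<lambda>s. local_rep (f s) c x) \<longlongrightarrow> local_rep m c x) F" if "limitin (smooth_topology A) f m F" for m
    using limitin_smooth_uniform[OF that c(1), of "{x}"] c(2)
    by (intro tendsto_uniform_limitI[where S = "{x}"]) auto
  then show "local_rep l c x = local_rep l' c x"
    using assms by (metis tendsto_unique)
qed (use assms in \<open>auto simp: limitin_smooth_topology\<close>)

lemma matrix_mult_add_right: "(H + K) ** Q = H ** Q + (K :: real ^ 'n ^ 'n) ** (Q :: real ^ 'n ^ 'n)"
  by (simp add: matrix_matrix_mult_def vec_eq_iff sum.distrib distrib_right)

lemma matrix_lincomb_sandwich: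
  fixes P H K Q :: "real ^ 'n ^ 'n"
  shows "P ** (a *\<^sub>R H + b *\<^sub>R K) ** Q = a *\<^sub>R (P ** H ** Q) + b *\<^sub>R (P ** K ** Q)"
  by (simp add: matrix_add_ldistrib matrix_mult_add_right matrix_mult_scaleR_left matrix_mult_scaleR_right)

lemma sym_tensors_lincomb:
  assumes "smooth_atlas X A" "h \<in> sym_tensors A" "k \<in> sym_tensors A"
  shows "(\<lambda>c p. a *\<^sub>R h c p + b *\<^sub>R k c p) \<in> sym_tensors A"
proof -
  have "smooth_on (snd c ` fst c) (local_rep (\<lambda>c p. a *\<^sub>R h c p + b *\<^sub>R k c p) c)" if "c \<in> A" for c
  proof -
    have op: "open (snd c ` fst c)" using assms that by (auto simp: smooth_atlas_def is_chart_def)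
    have "local_rep (\<lambda>c p. a *\<^sub>R h c p + b *\<^sub>R k c p) c =
        (\<lambda>x. a *\<^sub>R local_rep h c x + b *\<^sub>R local_rep k c x)"
      by (auto simp: local_rep_def)
    then show ?thesis
      using sym_tensorsD(4)[OF assms(2) that] sym_tensorsD(4)[OF assms(3) that]
      by (auto simp: smooth_on_def intro!: Ck_on_add Ck_on_scaleR op)
  qed
  moreover have "transpose (a *\<^sub>R H + b *\<^sub>R K) = a *\<^sub>R transpose H + b *\<^sub>R transpose K" for H K :: "real ^ 'b ^ 'b"
    by (simp add: transpose_def vec_eq_iff)
  ultimately show ?thesis
  proof (intro sym_tensorsI)
    fix c d p assume cd: "c \<in> A" "d \<in> A" "p \<in> fst c" "p \<in> fst d"
    show "a *\<^sub>R h c p + b *\<^sub>R k c p =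
        transpose (transition_jacobian c d p) ** (a *\<^sub>R h d p + b *\<^sub>R k d p) ** transition_jacobian c d p"
      unfolding matrix_lincomb_sandwich sym_tensorsD(3)[OF assms(2) cd, symmetric]
        sym_tensorsD(3)[OF assms(3) cd, symmetric] ..
  qed (simp_all add: sym_tensorsD(1,2)[OF assms(2)] sym_tensorsD(1,2)[OF assms(3)])
qed

lemma sym_tensors_scaleR:
  assumes "smooth_atlas X A" "h \<in> sym_tensors A"
  shows "(\<lambda>c p. a *\<^sub>R h c p) \<in> sym_tensors A"
  using sym_tensors_lincomb[OF assms(1,2,2), of a 0] by simp

lemma smooth_nbhd_scaleR:
  assumes "smooth_atlas X A" "c \<in> A" "K \<subseteq> snd c ` fst c" "k \<in> sym_tensors A" "h \<in> sym_tensors A" "a \<noteq> 0"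
  shows "(\<lambda>c p. a *\<^sub>R k c p) \<in> smooth_nbhd A h c K vs e \<longleftrightarrow>
    k \<in> smooth_nbhd A (\<lambda>c p. (1 / a) *\<^sub>R h c p) c K vs (e / \<bar>a\<bar>)"
proof -
  have op: "open (snd c ` fst c)" using assms by (auto simp: smooth_atlas_def is_chart_def)
  have sc: "iter_deriv vs (local_rep (\<lambda>c p. b *\<^sub>R m c p) c) x = b *\<^sub>R iter_deriv vs (local_rep m c) x"
    if "m \<in> sym_tensors A" "x \<in> K" for b m x
  proof -
    have "local_rep (\<lambda>c p. b *\<^sub>R m c p) c = (\<lambda>x. b *\<^sub>R local_rep m c x)"
      by (auto simp: local_rep_def)
    then show ?thesis
      using iter_deriv_scaleR[OF op, of x "local_rep m c" vs b] that assms(2,3) sym_tensorsD(4)[of m A c]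
      by auto
  qed
  have nrm: "norm (a *\<^sub>R u - w) = \<bar>a\<bar> * norm (u - (1 / a) *\<^sub>R w)" for u w :: "real ^ 'b ^ 'b"
  proof -
    have "a *\<^sub>R u - w = a *\<^sub>R (u - (1 / a) *\<^sub>R w)"
      using assms(6) by (simp add: scaleR_diff_right)
    then show ?thesis by (metis norm_scaleR)
  qed
  have a: "\<bar>a\<bar> > 0" using assms by simp
  have "(\<exists>e'<e. \<forall>x\<in>K. \<bar>a\<bar> * N x \<le> e') \<longleftrightarrow> (\<exists>e'<e / \<bar>a\<bar>. \<forall>x\<in>K. N x \<le> e')" for N :: "_ \<Rightarrow> real"
  proof
    assume "\<exists>e'<e. \<forall>x\<in>K. \<bar>a\<bar> * N x \<le> e'"
    then obtain e' where "e' < e" "\<forall>x\<in>K. \<bar>a\<bar> * N x \<le> e'" by blast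
    then show "\<exists>e'<e / \<bar>a\<bar>. \<forall>x\<in>K. N x \<le> e'"
      using a by (intro exI[of _ "e' / \<bar>a\<bar>"]) (auto simp: field_simps)
  next
    assume "\<exists>e'<e / \<bar>a\<bar>. \<forall>x\<in>K. N x \<le> e'"
    then obtain e' where "e' < e / \<bar>a\<bar>" "\<forall>x\<in>K. N x \<le> e'" by blast
    then show "\<exists>e'<e. \<forall>x\<in>K. \<bar>a\<bar> * N x \<le> e'"
      using a by (intro exI[of _ "\<bar>a\<bar> * e'"]) (auto simp: field_simps)
  qed
  from this[of "\<lambda>x. norm (iter_deriv vs (local_rep k c) x - (1 / a) *\<^sub>R iter_deriv vs (local_rep h c) x)"]
  show ?thesis
    using assms sym_tensors_scaleR[OF assms(1,4), of a]
    by (simp add: smooth_nbhd_def sc nrm)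
qed

lemma limitin_smooth_scaleR:
  assumes at: "smooth_atlas X A" and l: "limitin (smooth_topology A) f l F"
  shows "limitin (smooth_topology A) (\<lambda>s c p. a *\<^sub>R f s c p) (\<lambda>c p. a *\<^sub>R l c p) F"
proof (cases "a = 0")
  case True
  have "l \<in> sym_tensors A" using l by (simp add: limitin_smooth_topology)
  from sym_tensors_scaleR[OF at this, of 0] show ?thesis
    unfolding limitin_smooth_topology using True by auto
next
  case False
  have sym: "l \<in> sym_tensors A" and ev: "eventually (\<lambda>s. f s \<in> sym_tensors A) F"
    using l by (auto simp: limitin_smooth_topology)
  show ?thesis
    unfolding limitin_smooth_topology
  proof (intro conjI allI impI)
    show "(\<lambda>c p. a *\<^sub>R l c p) \<in> sym_tensors A" by (rule sym_tensors_scaleR[OF at sym])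
    show "\<forall>\<^sub>F s in F. (\<lambda>c p. a *\<^sub>R f s c p) \<in> sym_tensors A"
      using ev by eventually_elim (rule sym_tensors_scaleR[OF at])
    fix h c K vs and e :: real
    assume as: "h \<in> sym_tensors A" "c \<in> A" "compact K" "K \<subseteq> snd c ` fst c" "0 < e"
      "(\<lambda>c p. a *\<^sub>R l c p) \<in> smooth_nbhd A h c K vs e"
    have "l \<in> smooth_nbhd A (\<lambda>c p. (1 / a) *\<^sub>R h c p) c K vs (e / \<bar>a\<bar>)"
      using as False smooth_nbhd_scaleR[OF at as(2,4) sym as(1) False] by blast
    then have "eventually (\<lambda>s. f s \<in> smooth_nbhd A (\<lambda>c p. (1 / a) *\<^sub>R h c p) c K vs (e / \<bar>a\<bar>)) F"
      by (rule l[unfolded limitin_smooth_topology, THEN conjunct2, THEN conjunct2, rule_format,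
            OF sym_tensors_scaleR[OF at as(1)] as(2-4), rotated]) (use as False in simp)
    with ev show "\<forall>\<^sub>F s in F. (\<lambda>c p. a *\<^sub>R f s c p) \<in> smooth_nbhd A h c K vs e"
      by eventually_elim (use smooth_nbhd_scaleR[OF at as(2,4) _ as(1) False] in blast)
  qed
qed

lemma sym_tensors_continuous:
  "h \<in> sym_tensors A \<Longrightarrow> c \<in> A \<Longrightarrow> continuous_on (snd c ` fst c) (local_rep h c)"
  using sym_tensorsD(4)[of h A c] Ck_on.simps(1) unfolding smooth_on_def by blast

lemma has_velocity_vector_derivative:
  assumes "has_velocity A \<gamma> h t T" "c \<in> A" "x \<in> snd c ` fst c"
  shows "((\<lambda>t. local_rep (\<gamma> t) c x) has_vector_derivative local_rep h c x) (at t within T)"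
proof -
  have "uniform_limit {x} (\<lambda>s. local_rep (\<lambda>c p. (\<gamma> s c p - \<gamma> t c p) /\<^sub>R (s - t)) c) (local_rep h c) (at t within T)"
    using assms unfolding has_velocity_def by (intro limitin_smooth_uniform) auto
  then have "((\<lambda>s. local_rep (\<lambda>c p. (\<gamma> s c p - \<gamma> t c p) /\<^sub>R (s - t)) c x) \<longlongrightarrow> local_rep h c x) (at t within T)"
    by (rule tendsto_uniform_limitI) simp
  then have "((\<lambda>s. (local_rep (\<gamma> s) c x - local_rep (\<gamma> t) c x) /\<^sub>R (s - t)) \<longlongrightarrow> local_rep h c x) (at t within T)"
    by (simp add: local_rep_def)
  from tendsto_norm_zero[OF LIM_zero[OF this]]
  have "((\<lambda>s. norm ((1 / norm (s - t)) *\<^sub>R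
      (local_rep (\<gamma> s) c x - (local_rep (\<gamma> t) c x + (s - t) *\<^sub>R local_rep h c x)))) \<longlongrightarrow> 0) (at t within T)"
  proof (rule Lim_transform_eventually)
    show "\<forall>\<^sub>F s in at t within T. norm ((local_rep (\<gamma> s) c x - local_rep (\<gamma> t) c x) /\<^sub>R (s - t) - local_rep h c x) =
        norm ((1 / norm (s - t)) *\<^sub>R
          (local_rep (\<gamma> s) c x - (local_rep (\<gamma> t) c x + (s - t) *\<^sub>R local_rep h c x)))"
      unfolding eventually_at_filter
    proof (intro always_eventually allI impI)
      fix s assume "s \<noteq> t"
      then have "local_rep (\<gamma> s) c x - (local_rep (\<gamma> t) c x + (s - t) *\<^sub>R local_rep h c x) =
          (s - t) *\<^sub>R ((local_rep (\<gamma> s) c x - local_rep (\<gamma> t) c x) /\<^sub>R (s - t) - local_rep h c x)"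
        by (simp add: scaleR_diff_right)
      then show "norm ((local_rep (\<gamma> s) c x - local_rep (\<gamma> t) c x) /\<^sub>R (s - t) - local_rep h c x) =
          norm ((1 / norm (s - t)) *\<^sub>R
            (local_rep (\<gamma> s) c x - (local_rep (\<gamma> t) c x + (s - t) *\<^sub>R local_rep h c x)))"
        using \<open>s \<noteq> t\<close> by (simp only: norm_scaleR) simp
    qed
  qed
  from tendsto_norm_zero_cancel[OF this] show ?thesis
    unfolding has_vector_derivative_def has_derivative_within
    by (intro conjI bounded_linear_scaleR_left)
qed

lemma has_velocity_uniform:
  assumes "has_velocity A \<gamma> h t T" "c \<in> A" "compact K" "K \<subseteq> snd c ` fst c"
  shows "uniform_limit K (\<lambda>s. local_rep (\<gamma> s) c) (local_rep (\<gamma> t) c) (at t within T)"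
proof (rule uniform_limitI)
  fix e :: real assume e: "e > 0"
  have ul: "uniform_limit K (\<lambda>s. local_rep (\<lambda>c p. (\<gamma> s c p - \<gamma> t c p) /\<^sub>R (s - t)) c) (local_rep h c) (at t within T)"
    using assms unfolding has_velocity_def by (intro limitin_smooth_uniform)
  have "h \<in> sym_tensors A" using assms(1) by (simp add: has_velocity_def limitin_smooth_topology)
  then have "continuous_on K (local_rep h c)"
    using assms(2,4) sym_tensors_continuous continuous_on_subset by blast
  then have "bounded (local_rep h c ` K)"
    using assms(3) compact_continuous_image compact_imp_bounded by blast
  then obtain B where B: "B > 0" "\<And>x. x \<in> K \<Longrightarrow> norm (local_rep h c x) \<le> B"
    by (auto simp: bounded_pos)
  have "eventually (\<lambda>s. \<forall>x\<in>K. dist (local_rep (\<lambda>c p. (\<gamma> s c p - \<gamma> t c p) /\<^sub>R (s - t)) c x) (local_rep h c x) < 1) (at t within T)"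
    using uniform_limitD[OF ul, of 1] by simp
  moreover have "eventually (\<lambda>s. dist s t < e / (B + 1) \<and> s \<noteq> t) (at t within T)"
    using e B unfolding eventually_at by (intro exI[of _ "e / (B + 1)"]) auto
  ultimately show "\<forall>\<^sub>F s in at t within T. \<forall>x\<in>K. dist (local_rep (\<gamma> s) c x) (local_rep (\<gamma> t) c x) < e"
  proof eventually_elim
    case (elim s)
    show ?case
    proof
      fix x assume x: "x \<in> K"
      let ?q = "(local_rep (\<gamma> s) c x - local_rep (\<gamma> t) c x) /\<^sub>R (s - t)"
      have "dist ?q (local_rep h c x) < 1" using elim(1) x by (auto simp: local_rep_def)
      then have "norm ?q < B + 1"
        using B(2)[OF x] norm_triangle_sub[of ?q "local_rep h c x"] by (auto simp: dist_norm)
      have "local_rep (\<gamma> s) c x - local_rep (\<gamma> t) c x = (s - t) *\<^sub>R ?q"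
        using elim by simp
      then have "norm (local_rep (\<gamma> s) c x - local_rep (\<gamma> t) c x) = \<bar>s - t\<bar> * norm ?q"
        by (metis norm_scaleR)
      also have "\<dots> \<le> \<bar>s - t\<bar> * (B + 1)"
        using \<open>norm ?q < B + 1\<close> by (intro mult_left_mono) auto
      also have "\<dots> < e"
        using elim(2) B by (simp add: dist_real_def field_simps)
      finally show "dist (local_rep (\<gamma> s) c x) (local_rep (\<gamma> t) c x) < e" by (simp add: dist_norm)
    qed
  qed
qed

lemma curve_jointly_continuous:
  assumes "\<And>t. t \<in> T \<Longrightarrow> has_velocity A \<gamma> (h t) t T" "\<And>t. t \<in> T \<Longrightarrow> \<gamma> t \<in> sym_tensors A"
    "c \<in> A" "compact K" "K \<subseteq> snd c ` fst c"
  shows "continuous_on (T \<times> K) (\<lambda>z. local_rep (\<gamma> (fst z)) c (snd z))"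
  unfolding continuous_on_iff
proof (intro ballI allI impI)
  fix z and e :: real assume z: "z \<in> T \<times> K" and e: "0 < e"
  obtain t x where tx: "z = (t, x)" "t \<in> T" "x \<in> K" using z by auto
  have "\<forall>\<^sub>F s in at t within T. \<forall>x\<in>K. dist (local_rep (\<gamma> s) c x) (local_rep (\<gamma> t) c x) < e / 2"
    using uniform_limitD[OF has_velocity_uniform[OF assms(1)[OF tx(2)] assms(3-5)], of "e / 2"] e by simp
  then obtain d1 where d1: "d1 > 0"
    "\<And>s y. s \<in> T \<Longrightarrow> s \<noteq> t \<Longrightarrow> dist s t < d1 \<Longrightarrow> y \<in> K \<Longrightarrow> dist (local_rep (\<gamma> s) c y) (local_rep (\<gamma> t) c y) < e / 2"
    unfolding eventually_at by blast
  have d1': "dist (local_rep (\<gamma> s) c y) (local_rep (\<gamma> t) c y) < e / 2" if "s \<in> T" "dist s t < d1" "y \<in> K" for s y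
    using d1(2)[of s y] that e by (cases "s = t") auto
  have "continuous_on K (local_rep (\<gamma> t) c)"
    using sym_tensors_continuous[OF assms(2)[OF tx(2)] assms(3)] assms(5) continuous_on_subset by blast
  then obtain d2 where d2: "d2 > 0" "\<And>y. y \<in> K \<Longrightarrow> dist y x < d2 \<Longrightarrow> dist (local_rep (\<gamma> t) c y) (local_rep (\<gamma> t) c x) < e / 2"
    using tx(3) e unfolding continuous_on_iff by (metis half_gt_zero)
  show "\<exists>d>0. \<forall>z'\<in>T \<times> K. dist z' z < d \<longrightarrow>
      dist (local_rep (\<gamma> (fst z')) c (snd z')) (local_rep (\<gamma> (fst z)) c (snd z)) < e"
  proof (intro exI[of _ "min d1 d2"] conjI ballI impI)
    show "0 < min d1 d2" using d1 d2 by simp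
    fix z' assume z': "z' \<in> T \<times> K" "dist z' z < min d1 d2"
    obtain s y where sy: "z' = (s, y)" "s \<in> T" "y \<in> K" using z' by auto
    have "dist s t < d1" "dist y x < d2"
      using z'(2) dist_fst_le[of z' z] dist_snd_le[of z' z] tx sy by auto
    then have "dist (local_rep (\<gamma> s) c y) (local_rep (\<gamma> t) c y) < e / 2"
      "dist (local_rep (\<gamma> t) c y) (local_rep (\<gamma> t) c x) < e / 2"
      using d1' d2 sy by auto
    then show "dist (local_rep (\<gamma> (fst z')) c (snd z')) (local_rep (\<gamma> (fst z)) c (snd z)) < e"
      using tx sy dist_triangle_half_l by (metis dist_commute fst_conv snd_conv dist_triangle_half_r)
  qed
qed

section \<open>Existence and uniqueness of the volume measure\<close>

locale closed_smooth_manifold =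
  fixes X :: "'a topology" and A :: "('a, 'n::finite) chart set"
  assumes closed_manifold: "closed_manifold X A"
begin

lemma atlas: "smooth_atlas X A"
  using closed_manifold by (simp add: closed_manifold_def smooth_manifold_def)

lemma chart: "c \<in> A \<Longrightarrow> is_chart X c"
  using atlas by (simp add: smooth_atlas_def)

lemma chart_openin: "c \<in> A \<Longrightarrow> openin X (fst c)"
  and chart_open_image: "c \<in> A \<Longrightarrow> open (snd c ` fst c)"
  using chart by (auto simp: is_chart_def)

lemma chart_subset: "c \<in> A \<Longrightarrow> fst c \<subseteq> topspace X"
  using chart_openin openin_subset by blast

lemma chart_cover: "p \<in> topspace X \<Longrightarrow> \<exists>c\<in>A. p \<in> fst c"
  using atlas by (auto simp: smooth_atlas_def)

lemma chart_homeo: "c \<in> A \<Longrightarrow> homeomorphic_map (subtopology X (fst c)) (top_of_set (snd c ` fst c)) (snd c)"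
  using chart by (simp add: is_chart_def)

lemma chart_topspace: "c \<in> A \<Longrightarrow> topspace (subtopology X (fst c)) = fst c"
  using chart_subset by (simp add: Int_absorb1)

lemma chart_inj: "c \<in> A \<Longrightarrow> inj_on (snd c) (fst c)"
  using homeomorphic_imp_injective_map[OF chart_homeo] chart_topspace by metis

lemma chart_image_open:
  assumes "c \<in> A" "openin X V"
  shows "open (snd c ` (V \<inter> fst c))"
proof -
  have "openin (subtopology X (fst c)) (V \<inter> fst c)"
    using assms(2) by (auto simp: openin_subtopology)
  then have "openin (top_of_set (snd c ` fst c)) (snd c ` (V \<inter> fst c))"
    using homeomorphic_imp_open_map[OF chart_homeo[OF assms(1)]] by (simp add: open_map_def)
  then show ?thesis
    using chart_open_image[OF assms(1)] openin_open_eq by blast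
qed

lemma chart_preimage_open:
  assumes "c \<in> A" "open W"
  shows "openin X {p \<in> fst c. snd c p \<in> W}"
proof -
  have "openin (top_of_set (snd c ` fst c)) (snd c ` fst c \<inter> W)"
    using assms(2) by (rule openin_open_Int)
  from openin_continuous_map_preimage[OF homeomorphic_imp_continuous_map[OF chart_homeo[OF assms(1)]] this]
  have "openin (subtopology X (fst c)) {p \<in> fst c. snd c p \<in> snd c ` fst c \<inter> W}"
    by (simp only: chart_topspace[OF assms(1)])
  moreover have "{p \<in> fst c. snd c p \<in> snd c ` fst c \<inter> W} = {p \<in> fst c. snd c p \<in> W}" by auto
  ultimately show ?thesis
    using openin_trans_full[OF _ chart_openin[OF assms(1)]] by simp
qed

definition manifold_borel :: "'a measure" where
  "manifold_borel = sigma (topspace X) {U. openin X U}"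

lemma space_manifold_borel [simp]: "space manifold_borel = topspace X"
  by (simp add: manifold_borel_def space_measure_of_conv)

lemma open_in_manifold_borel: "openin X U \<Longrightarrow> U \<in> sets manifold_borel"
  unfolding manifold_borel_def by (subst sets_measure_of) (auto intro: sigma_sets.Basic dest: openin_subset)

lemma chart_in_manifold_borel [simp]: "c \<in> A \<Longrightarrow> fst c \<in> sets manifold_borel"
  by (rule open_in_manifold_borel[OF chart_openin])

lemma measurable_manifold_borel:
  assumes "f \<in> space M \<rightarrow> topspace X" "\<And>U. openin X U \<Longrightarrow> f -` U \<inter> space M \<in> sets M"
  shows "f \<in> measurable M manifold_borel"
  unfolding manifold_borel_def
  by (rule measurable_measure_of) (use assms in \<open>auto dest: openin_subset\<close>)

text \<open>The value off the image of the chart only serves to make the map total.\<close>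

definition chart_inv :: "('a, 'n) chart \<Rightarrow> real ^ 'n \<Rightarrow> 'a" where
  "chart_inv c x = (if x \<in> snd c ` fst c then inv_into (fst c) (snd c) x else (SOME p. p \<in> fst c))"

lemma chart_inv [simp]: "c \<in> A \<Longrightarrow> p \<in> fst c \<Longrightarrow> chart_inv c (snd c p) = p"
  using chart_inj by (simp add: chart_inv_def)

lemma chart_inv_vimage:
  assumes "c \<in> A" "B \<subseteq> fst c"
  shows "chart_inv c -` B \<inter> snd c ` fst c = snd c ` B"
  using assms by auto

lemma measurable_chart_inv:
  assumes "c \<in> A" "fst c \<noteq> {}"
  shows "chart_inv c \<in> measurable borel manifold_borel"
proof (rule measurable_manifold_borel)
  have some: "(SOME p. p \<in> fst c) \<in> fst c"
    using assms(2) by (meson ex_in_conv someI_ex)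
  have "chart_inv c x \<in> fst c" for x
    using some by (auto simp: chart_inv_def intro: inv_into_into)
  then show "chart_inv c \<in> space borel \<rightarrow> topspace X"
    using chart_subset[OF assms(1)] by auto
  fix U assume U: "openin X U"
  have "chart_inv c -` U \<inter> space borel = snd c ` (U \<inter> fst c) \<union>
      (if (SOME p. p \<in> fst c) \<in> U then - (snd c ` fst c) else {})"
    using assms(1) some by (auto simp: chart_inv_def chart_inj inv_into_f_f split: if_splits)
  also have "\<dots> \<in> sets borel"
    using chart_image_open[OF assms(1) U] chart_open_image[OF assms(1)] by auto
  finally show "chart_inv c -` U \<inter> space borel \<in> sets borel" .
qed

lemma chart_image_borel:
  assumes "c \<in> A" "B \<in> sets manifold_borel" "B \<subseteq> fst c"
  shows "snd c ` B \<in> sets borel"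
proof (cases "fst c = {}")
  case False
  have "chart_inv c -` B \<inter> space borel \<in> sets borel"
    by (rule measurable_sets[OF measurable_chart_inv[OF assms(1) False] assms(2)])
  then have "chart_inv c -` B \<inter> space borel \<inter> snd c ` fst c \<in> sets borel"
    using chart_open_image[OF assms(1)] by auto
  then show ?thesis
    using chart_inv_vimage[OF assms(1,3)] by simp
qed (use assms in auto)

lemma metric_spd:
  assumes "g \<in> riem_metrics A" "c \<in> A"
  shows "p \<in> fst c \<Longrightarrow> spd (g c p)" "x \<in> snd c ` fst c \<Longrightarrow> spd (local_rep g c x)"
proof -
  have *: "spd (g c p)" if "p \<in> fst c" for p
    using assms that sym_tensorsD(2)[of g A c p] by (auto simp: riem_metrics_def spd_def)
  show "spd (g c p)" if "p \<in> fst c" by (rule *[OF that])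
  show "spd (local_rep g c x)" if "x \<in> snd c ` fst c"
    using that * local_rep_inv(2)[OF chart[OF assms(2)]] by auto
qed

lemma metric_sym: "g \<in> riem_metrics A \<Longrightarrow> g \<in> sym_tensors A"
  by (simp add: riem_metrics_def)

text \<open>The maximum gives \<open>0\<close> instead of a negative junk value off the image of the chart.\<close>

definition density_rep :: "('a, 'n) tensor_field \<Rightarrow> ('a, 'n) chart \<Rightarrow> real ^ 'n \<Rightarrow> real" where
  "density_rep g c x = max 0 (sqrt (det (local_rep g c x)))"

lemma ennreal_density_rep: "ennreal (sqrt (det (local_rep g c x))) = ennreal (density_rep g c x)"
  by (simp add: density_rep_def max_def ennreal_neg)

lemma continuous_density_rep:
  "g \<in> riem_metrics A \<Longrightarrow> c \<in> A \<Longrightarrow> continuous_on (snd c ` fst c) (density_rep g c)"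
  unfolding density_rep_def
  by (intro continuous_intros sym_tensors_continuous) (auto intro: metric_sym)

lemma measurable_density_rep:
  assumes "g \<in> riem_metrics A" "c \<in> A" "S \<in> sets borel" "S \<subseteq> snd c ` fst c"
  shows "(\<lambda>x. indicator S x * density_rep g c x) \<in> borel_measurable borel"
  using borel_measurable_continuous_on_indicator[OF assms(3) continuous_on_subset[OF continuous_density_rep assms(4)]] assms
  by simp

lemma transition_law:
  assumes "g \<in> riem_metrics A" "c \<in> A" "d \<in> A" "p \<in> fst c" "p \<in> fst d"
  shows "det (transition_jacobian c d p) \<noteq> 0"
    and "density_rep g c (snd c p) = \<bar>det (transition_jacobian c d p)\<bar> * density_rep g d (snd d p)"
proof -
  let ?J = "transition_jacobian c d p"
  have law: "g c p = transpose ?J ** g d p ** ?J"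
    by (rule sym_tensorsD(3)[OF metric_sym[OF assms(1)] assms(2-5)])
  have det: "det (g c p) = (det ?J)\<^sup>2 * det (g d p)"
    unfolding law det_mul det_transpose power2_eq_square by (simp only: mult_ac)
  have pos: "det (g c p) > 0" "det (g d p) > 0"
    using assms by (auto intro: spd_det_pos metric_spd)
  show "det ?J \<noteq> 0"
  proof
    assume "det ?J = 0"
    then have "det (g c p) = 0" unfolding det by simp
    then show False using pos by simp
  qed
  have "density_rep g c (snd c p) = sqrt (det (g c p))"
    unfolding density_rep_def local_rep_inv(2)[OF chart[OF assms(2)] assms(4), of g] using pos(1) by simp
  also have "\<dots> = \<bar>det ?J\<bar> * sqrt (det (g d p))"
    unfolding det real_sqrt_mult by simp
  also have "sqrt (det (g d p)) = density_rep g d (snd d p)"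
    unfolding density_rep_def local_rep_inv(2)[OF chart[OF assms(3)] assms(5), of g] using pos(2) by simp
  finally show "density_rep g c (snd c p) = \<bar>det ?J\<bar> * density_rep g d (snd d p)" .
qed

lemma transition_apply: "c \<in> A \<Longrightarrow> p \<in> fst c \<Longrightarrow> transition c d (snd c p) = snd d p"
  using local_rep_inv(1)[OF chart] by (simp add: transition_def)

lemma transition_has_derivative:
  assumes "c \<in> A" "d \<in> A" "p \<in> fst c" "p \<in> fst d"
  shows "(transition c d has_derivative (*v) (transition_jacobian c d p)) (at (snd c p))"
proof -
  have "Ck_on (Suc 0) (snd c ` (fst c \<inter> fst d)) (transition c d)"
    using atlas assms(1,2) unfolding smooth_atlas_def smooth_on_def by blast
  then have "transition c d differentiable at (snd c p)"
    using assms(3,4) by auto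
  then show ?thesis
    unfolding transition_jacobian_def by (simp add: jacobian_works)
qed

lemma chart_change_integral:
  assumes g: "g \<in> riem_metrics A" and cd: "c \<in> A" "d \<in> A"
    and B: "B \<in> sets manifold_borel" "B \<subseteq> fst c" "B \<subseteq> fst d"
  shows "(\<integral>\<^sup>+x\<in>snd c ` B. ennreal (density_rep g c x) \<partial>lborel) =
    (\<integral>\<^sup>+x\<in>snd d ` B. ennreal (density_rep g d x) \<partial>lborel)"
proof -
  have im: "transition c d ` snd c ` B = snd d ` B"
    unfolding image_image by (rule image_cong[OF refl]) (use B transition_apply[OF cd(1)] in blast)
  have inv: "inv_into (fst c) (snd c) (snd c p) = p" if "p \<in> B" for p
    by (rule local_rep_inv(1)[OF chart[OF cd(1)]]) (use that B in blast)
  have "(\<integral>\<^sup>+x\<in>snd c ` B. ennreal (density_rep g c x) \<partial>lborel) =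
    (\<integral>\<^sup>+x\<in>transition c d ` snd c ` B. ennreal (density_rep g d x) \<partial>lborel)"
  proof (rule nn_integral_change_of_variables[where
        J = "\<lambda>x. transition_jacobian c d (inv_into (fst c) (snd c) x)"])
    show "snd c ` B \<in> sets borel" "transition c d ` snd c ` B \<in> sets borel"
      unfolding im by (rule chart_image_borel[OF cd(1) B(1,2)], rule chart_image_borel[OF cd(2) B(1,3)])
    show "inj_on (transition c d) (snd c ` B)"
    proof (rule inj_onI)
      fix x y assume "x \<in> snd c ` B" "y \<in> snd c ` B" and eq: "transition c d x = transition c d y"
      then obtain p q where pq: "p \<in> B" "q \<in> B" "x = snd c p" "y = snd c q" by blast
      have "p \<in> fst c" "q \<in> fst c" "p \<in> fst d" "q \<in> fst d" using pq B by auto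
      then have "snd d p = snd d q"
        using eq unfolding pq(3,4) by (simp only: transition_apply[OF cd(1)])
      then have "p = q"
        by (rule inj_onD[OF chart_inj[OF cd(2)]]) fact+
      then show "x = y" using pq(3,4) by simp
    qed
    show "(\<lambda>x. indicator (snd c ` B) x * density_rep g c x) \<in> borel_measurable borel"
      using B by (intro measurable_density_rep g cd chart_image_borel) auto
    show "(\<lambda>x. indicator (transition c d ` snd c ` B) x * density_rep g d x) \<in> borel_measurable borel"
      unfolding im using B by (intro measurable_density_rep g cd chart_image_borel) auto
    show "0 \<le> density_rep g d y" for y by (simp add: density_rep_def)
    fix x assume "x \<in> snd c ` B"
    then obtain p where p: "p \<in> B" "x = snd c p" by blast
    then have p': "p \<in> fst c" "p \<in> fst d" using B by auto
    show "(transition c d has_derivative (*v) (transition_jacobian c d (inv_into (fst c) (snd c) x))) (at x)"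
      unfolding p(2) inv[OF p(1)] by (rule transition_has_derivative[OF cd p'])
    show "density_rep g c x =
        \<bar>det (transition_jacobian c d (inv_into (fst c) (snd c) x))\<bar> * density_rep g d (transition c d x)"
      unfolding p(2) inv[OF p(1)] transition_apply[OF cd(1) p'(1)]
      by (rule transition_law(2)[OF g cd p'])
  qed
  then show ?thesis by (simp add: im)
qed

text \<open>Borel pieces with compact closure inside a chart; compactness of \<open>K i\<close> makes all
  local integrals finite and continuous in parameters.\<close>

definition borel_partition ::
    "nat \<Rightarrow> (nat \<Rightarrow> ('a, 'n) chart) \<Rightarrow> (nat \<Rightarrow> (real ^ 'n) set) \<Rightarrow> (nat \<Rightarrow> 'a set) \<Rightarrow> bool" where
  "borel_partition m ch K D \<longleftrightarrow>
     (\<forall>i<m. ch i \<in> A \<and> fst (ch i) \<noteq> {} \<and> compact (K i) \<and> K i \<subseteq> snd (ch i) ` fst (ch i) \<and>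
        D i \<in> sets manifold_borel \<and> D i \<subseteq> fst (ch i) \<and> snd (ch i) ` D i \<subseteq> K i) \<and>
     disjoint_family_on D {..<m} \<and> (\<Union>i<m. D i) = topspace X"

lemma borel_partitionD:
  assumes "borel_partition m ch K D"
  shows "i < m \<Longrightarrow> ch i \<in> A" "i < m \<Longrightarrow> fst (ch i) \<noteq> {}" "i < m \<Longrightarrow> compact (K i)"
    "i < m \<Longrightarrow> K i \<subseteq> snd (ch i) ` fst (ch i)" "i < m \<Longrightarrow> D i \<in> sets manifold_borel"
    "i < m \<Longrightarrow> D i \<subseteq> fst (ch i)" "i < m \<Longrightarrow> snd (ch i) ` D i \<subseteq> K i"
    "disjoint_family_on D {..<m}" "(\<Union>i<m. D i) = topspace X"
  using assms unfolding borel_partition_def by blast+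

lemma borel_partition_exists:
  obtains m ch K D where "borel_partition m ch K D"
proof -
  have "\<exists>c r. c \<in> A \<and> p \<in> fst c \<and> r > 0 \<and> cball (snd c p) r \<subseteq> snd c ` fst c" if p: "p \<in> topspace X" for p
  proof -
    obtain c where c: "c \<in> A" "p \<in> fst c" using chart_cover[OF p] by blast
    then obtain r where "r > 0" "cball (snd c p) r \<subseteq> snd c ` fst c"
      using chart_open_image[OF c(1)] open_contains_cball by (metis imageI)
    then show ?thesis using c by blast
  qed
  then obtain c r where cr: "\<And>p. p \<in> topspace X \<Longrightarrow>
      c p \<in> A \<and> p \<in> fst (c p) \<and> r p > 0 \<and> cball (snd (c p) p) (r p) \<subseteq> snd (c p) ` fst (c p)"
    by metis
  define U where "U p = {q \<in> fst (c p). snd (c p) q \<in> ball (snd (c p) p) (r p)}" for p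
  have U: "openin X (U p)" "p \<in> U p" if "p \<in> topspace X" for p
    using cr[OF that] chart_preimage_open[of "c p" "ball (snd (c p) p) (r p)"] by (auto simp: U_def)
  have "compact_space X" using closed_manifold by (simp add: closed_manifold_def)
  moreover have "\<Union>(U ` topspace X) = topspace X"
    using U openin_subset by blast
  ultimately obtain F where F: "finite F" "F \<subseteq> U ` topspace X" "\<Union>F = topspace X"
    unfolding compact_space using U(1) by (metis (no_types, lifting) imageE)
  then obtain P where P: "finite P" "P \<subseteq> topspace X" "F = U ` P"
    by (metis finite_subset_image)
  obtain e :: "nat \<Rightarrow> 'a" where e: "P = e ` {..<card P}"
    using P(1) by (metis bij_betw_def ex_bij_betw_nat_finite lessThan_atLeast0)
  define D where "D i = U (e i) - (\<Union>j<i. U (e j))" for i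
  have eP: "e i \<in> topspace X" if "i < card P" for i using e P(2) that by blast
  let ?ch = "\<lambda>i. c (e i)" and ?K = "\<lambda>i. cball (snd (c (e i)) (e i)) (r (e i))"
  have "borel_partition (card P) ?ch ?K D"
    unfolding borel_partition_def
  proof (intro conjI allI impI)
    fix i assume i: "i < card P"
    note cri = cr[OF eP[OF i]]
    show "?ch i \<in> A" "fst (?ch i) \<noteq> {}" using cri by auto
    show "compact (?K i)" by simp
    show "?K i \<subseteq> snd (?ch i) ` fst (?ch i)" using cri by simp
    have "U (e j) \<in> sets manifold_borel" if "j \<le> i" for j
      using that i by (intro open_in_manifold_borel U(1) eP) simp
    then show "D i \<in> sets manifold_borel"
      unfolding D_def by (intro sets.Diff sets.finite_UN) auto
    show "D i \<subseteq> fst (?ch i)" "snd (?ch i) ` D i \<subseteq> ?K i"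
      by (auto simp: D_def U_def)
  next
    have "D i \<inter> D j = {}" if "i < j" for i j
      using that by (auto simp: D_def)
    then show "disjoint_family_on D {..<card P}"
      unfolding disjoint_family_on_def by (metis Int_commute nat_neq_iff)
    have "(\<Union>i<n. D i) = (\<Union>i<n. U (e i))" for n
      by (induction n) (auto simp: D_def lessThan_Suc)
    moreover have "(\<lambda>i. U (e i)) ` {..<card P} = F"
      using e P(3) by (metis image_image)
    ultimately show "(\<Union>i<card P. D i) = topspace X" using F(3) by simp
  qed
  then show ?thesis by (rule that)
qed

definition is_volume :: "('a, 'n) tensor_field \<Rightarrow> 'a measure \<Rightarrow> bool" where
  "is_volume g \<mu> \<longleftrightarrow> sets \<mu> = sets manifold_borel \<and>
     (\<forall>c\<in>A. \<forall>B\<in>sets manifold_borel. B \<subseteq> fst c \<longrightarrow>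
        emeasure \<mu> B = (\<integral>\<^sup>+x\<in>snd c ` B. ennreal (density_rep g c x) \<partial>lborel))"

lemma volume_measure_eq_The: "volume_measure X A g = (THE \<mu>. is_volume g \<mu>)"
  unfolding volume_measure_def is_volume_def manifold_borel_def ennreal_density_rep
  by (rule arg_cong[of _ _ The]) auto

lemma is_volume_unique:
  assumes "is_volume g \<mu>" "is_volume g \<nu>"
  shows "\<mu> = \<nu>"
proof -
  obtain m ch K D where part: "borel_partition m ch K D" by (rule borel_partition_exists)
  note D = borel_partitionD(1,5,6,8,9)[OF part]
  have sum: "emeasure \<kappa> B = (\<Sum>i<m. emeasure \<kappa> (B \<inter> D i))" if "sets \<kappa> = sets manifold_borel" "B \<in> sets manifold_borel" for \<kappa> B
  proof -
    have "B = (\<Union>i<m. B \<inter> D i)"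
      using D(5) sets.sets_into_space[OF that(2)] by auto
    moreover have "(\<Sum>i<m. emeasure \<kappa> (B \<inter> D i)) = emeasure \<kappa> (\<Union>i<m. B \<inter> D i)"
      using D(4) that D(2) by (intro sum_emeasure) (auto simp: disjoint_family_on_def)
    ultimately show ?thesis by simp
  qed
  show ?thesis
  proof (rule measure_eqI)
    show "sets \<mu> = sets \<nu>" using assms by (simp add: is_volume_def)
    fix B assume "B \<in> sets \<mu>"
    then have B: "B \<in> sets manifold_borel" using assms by (simp add: is_volume_def)
    have "emeasure \<mu> (B \<inter> D i) = emeasure \<nu> (B \<inter> D i)" if "i < m" for i
    proof -
      have "B \<inter> D i \<in> sets manifold_borel" "B \<inter> D i \<subseteq> fst (ch i)" using B D that by auto
      then show ?thesis
        using assms D(1)[OF that] unfolding is_volume_def by metis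
    qed
    then show "emeasure \<mu> B = emeasure \<nu> B"
      using sum[of \<mu> B] sum[of \<nu> B] B assms by (simp add: is_volume_def)
  qed
qed

definition piece_measure :: "('a, 'n) tensor_field \<Rightarrow> ('a, 'n) chart \<Rightarrow> 'a set \<Rightarrow> 'a measure" where
  "piece_measure g c D = distr (density lborel (\<lambda>x. ennreal (indicator (snd c ` D) x * density_rep g c x))) manifold_borel (chart_inv c)"

lemma emeasure_piece_measure:
  assumes g: "g \<in> riem_metrics A" and c: "c \<in> A" "fst c \<noteq> {}"
    and D: "D \<in> sets manifold_borel" "D \<subseteq> fst c" and B: "B \<in> sets manifold_borel"
  shows "emeasure (piece_measure g c D) B =
    (\<integral>\<^sup>+x\<in>snd c ` (B \<inter> D). ennreal (density_rep g c x) \<partial>lborel)"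
proof -
  have [measurable]: "chart_inv c \<in> measurable borel manifold_borel"
    by (rule measurable_chart_inv[OF c])
  have [measurable]: "(\<lambda>x. indicator (snd c ` D) x * density_rep g c x) \<in> borel_measurable borel"
    using D by (intro measurable_density_rep g c chart_image_borel) auto
  have vB: "chart_inv c -` B \<in> sets borel"
    using measurable_sets[OF measurable_chart_inv[OF c] B] by simp
  have "emeasure (piece_measure g c D) B =
      emeasure (density lborel (\<lambda>x. ennreal (indicator (snd c ` D) x * density_rep g c x))) (chart_inv c -` B)"
    unfolding piece_measure_def using B by (subst emeasure_distr) auto
  also have "\<dots> = (\<integral>\<^sup>+x. ennreal (indicator (snd c ` D) x * density_rep g c x) * indicator (chart_inv c -` B) x \<partial>lborel)"
    using vB by (subst emeasure_density) auto
  also have "\<dots> = (\<integral>\<^sup>+x\<in>snd c ` (B \<inter> D). ennreal (density_rep g c x) \<partial>lborel)"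
  proof (intro nn_integral_cong)
    fix x
    have "x \<in> snd c ` (B \<inter> D) \<longleftrightarrow> x \<in> snd c ` D \<and> chart_inv c x \<in> B"
      using c(1) D(2) by auto
    then show "ennreal (indicator (snd c ` D) x * density_rep g c x) * indicator (chart_inv c -` B) x =
        ennreal (density_rep g c x) * indicator (snd c ` (B \<inter> D)) x"
      by (auto simp: indicator_def)
  qed
  finally show ?thesis .
qed

lemma is_volume_exists:
  assumes g: "g \<in> riem_metrics A"
  shows "\<exists>\<mu>. is_volume g \<mu>"
proof -
  obtain m ch K D where part: "borel_partition m ch K D" by (rule borel_partition_exists)
  note D = borel_partitionD(1,2,5,6,8,9)[OF part]
  define \<nu> where "\<nu> i = piece_measure g (ch i) (D i)" for i
  have sets_\<nu>: "sets (\<nu> i) = sets manifold_borel" for i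
    by (simp add: \<nu>_def piece_measure_def)
  define F where "F B = (\<Sum>i<m. emeasure (\<nu> i) B)" for B
  define \<mu> where "\<mu> = measure_of (topspace X) (sets manifold_borel) F"
  have sa: "sigma_algebra (topspace X) (sets manifold_borel)"
    using sets.sigma_algebra_axioms[of manifold_borel] by simp
  have sets_\<mu>: "sets \<mu> = sets manifold_borel"
    unfolding \<mu>_def using sa sets.space_closed[of manifold_borel]
    by (simp add: sets_measure_of sigma_algebra.sigma_sets_eq)
  have em: "emeasure \<mu> B = F B" if "B \<in> sets manifold_borel" for B
    unfolding \<mu>_def
  proof (rule emeasure_measure_of_sigma[OF sa _ _ that])
    show "positive (sets manifold_borel) F" by (simp add: positive_def F_def)
    show "countably_additive (sets manifold_borel) F"
      unfolding countably_additive_def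
    proof (intro allI impI)
      fix B :: "nat \<Rightarrow> 'a set"
      assume B: "range B \<subseteq> sets manifold_borel" "disjoint_family B" "\<Union>(range B) \<in> sets manifold_borel"
      have "(\<Sum>n. F (B n)) = (\<Sum>i<m. \<Sum>n. emeasure (\<nu> i) (B n))"
        unfolding F_def by (rule suminf_sum) auto
      also have "\<dots> = F (\<Union>(range B))"
        unfolding F_def using B by (intro sum.cong suminf_emeasure) (auto simp: sets_\<nu>)
      finally show "(\<Sum>n. F (B n)) = F (\<Union>(range B))" .
    qed
  qed
  have "emeasure \<mu> B = (\<integral>\<^sup>+x\<in>snd c ` B. ennreal (density_rep g c x) \<partial>lborel)"
    if c: "c \<in> A" and B: "B \<in> sets manifold_borel" "B \<subseteq> fst c" for c B
  proof (cases "B = {}")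
    case True
    then show ?thesis using em[of "{}"] by (simp add: F_def)
  next
    case False
    then have ne: "fst c \<noteq> {}" using B by auto
    have BU: "B = (\<Union>i<m. B \<inter> D i)"
      using D(6) sets.sets_into_space[OF B(1)] by auto
    have "emeasure \<mu> B = (\<Sum>i<m. emeasure (\<nu> i) B)"
      using em[OF B(1)] by (simp add: F_def)
    also have "\<dots> = (\<Sum>i<m. emeasure (piece_measure g c B) (B \<inter> D i))"
    proof (intro sum.cong refl)
      fix i assume "i \<in> {..<m}"
      then have i: "i < m" by simp
      have "emeasure (\<nu> i) B = (\<integral>\<^sup>+x\<in>snd (ch i) ` (B \<inter> D i). ennreal (density_rep g (ch i) x) \<partial>lborel)"
        unfolding \<nu>_def by (intro emeasure_piece_measure g D B i)
      also have "\<dots> = (\<integral>\<^sup>+x\<in>snd c ` (B \<inter> D i). ennreal (density_rep g c x) \<partial>lborel)"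
        using D(3,4)[OF i] B by (intro chart_change_integral g D(1) i c) auto
      also have "\<dots> = emeasure (piece_measure g c B) (B \<inter> D i)"
        using D(3)[OF i] B by (subst emeasure_piece_measure[OF g c ne B]) (auto simp: Int_ac)
      finally show "emeasure (\<nu> i) B = emeasure (piece_measure g c B) (B \<inter> D i)" .
    qed
    also have "\<dots> = emeasure (piece_measure g c B) (\<Union>i<m. B \<inter> D i)"
      using D(3,5) B by (intro sum_emeasure) (auto simp: disjoint_family_on_def piece_measure_def)
    also have "\<dots> = emeasure (piece_measure g c B) B"
      using BU by simp
    also have "\<dots> = (\<integral>\<^sup>+x\<in>snd c ` B. ennreal (density_rep g c x) \<partial>lborel)"
      by (subst emeasure_piece_measure[OF g c ne B B(1)]) simp
    finally show ?thesis .
  qed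
  then have "is_volume g \<mu>"
    unfolding is_volume_def using sets_\<mu> by blast
  then show ?thesis by blast
qed

lemma is_volume_volume_measure:
  assumes "g \<in> riem_metrics A"
  shows "is_volume g (volume_measure X A g)"
  unfolding volume_measure_eq_The
  using is_volume_exists[OF assms] is_volume_unique by (metis theI)

lemma sets_volume_measure [simp]: "g \<in> riem_metrics A \<Longrightarrow> sets (volume_measure X A g) = sets manifold_borel"
  using is_volume_volume_measure by (simp add: is_volume_def)

lemma space_volume_measure [simp]: "g \<in> riem_metrics A \<Longrightarrow> space (volume_measure X A g) = topspace X"
  using sets_eq_imp_space_eq[OF sets_volume_measure] by simp

lemma volume_density_piece:
  assumes g: "g \<in> riem_metrics A" and c: "c \<in> A" "fst c \<noteq> {}"
    and D: "D \<in> sets manifold_borel" "D \<subseteq> fst c"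
  shows "density (volume_measure X A g) (indicator D) = piece_measure g c D"
proof (rule measure_eqI)
  show "sets (density (volume_measure X A g) (indicator D)) = sets (piece_measure g c D)"
    using g by (simp add: piece_measure_def)
  fix B assume "B \<in> sets (density (volume_measure X A g) (indicator D))"
  then have B: "B \<in> sets manifold_borel" using g by simp
  have "emeasure (density (volume_measure X A g) (indicator D)) B = emeasure (volume_measure X A g) (B \<inter> D)"
  proof -
    have D': "D \<in> sets (volume_measure X A g)" and B': "B \<in> sets (volume_measure X A g)"
      using D B g by simp_all
    have "emeasure (density (volume_measure X A g) (indicator D)) B =
        (\<integral>\<^sup>+p. indicator D p * indicator B p \<partial>volume_measure X A g)"
      by (rule emeasure_density[OF borel_measurable_indicator[OF D'] B'])
    also have "\<dots> = (\<integral>\<^sup>+p. indicator (B \<inter> D) p \<partial>volume_measure X A g)"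
      by (intro nn_integral_cong) (auto simp: indicator_def)
    also have "\<dots> = emeasure (volume_measure X A g) (B \<inter> D)"
      using B' D' by (intro nn_integral_indicator) auto
    finally show ?thesis .
  qed
  also have "\<dots> = (\<integral>\<^sup>+x\<in>snd c ` (B \<inter> D). ennreal (density_rep g c x) \<partial>lborel)"
    using is_volume_volume_measure[OF g] c D B unfolding is_volume_def by blast
  finally show "emeasure (density (volume_measure X A g) (indicator D)) B = emeasure (piece_measure g c D) B"
    by (simp add: emeasure_piece_measure[OF g c D B])
qed

lemma nn_integral_volume_piece:
  assumes g: "g \<in> riem_metrics A" and c: "c \<in> A" and D: "D \<in> sets manifold_borel" "D \<subseteq> fst c"
    and F [measurable]: "F \<in> borel_measurable manifold_borel"
  shows "(\<integral>\<^sup>+p\<in>D. F p \<partial>volume_measure X A g) =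
    (\<integral>\<^sup>+x\<in>snd c ` D. (ennreal (density_rep g c x) * F (inv_into (fst c) (snd c) x)) \<partial>lborel)"
proof (cases "D = {}")
  case False
  then have ne: "fst c \<noteq> {}" using D by auto
  have [measurable]: "chart_inv c \<in> measurable borel manifold_borel"
    by (rule measurable_chart_inv[OF c ne])
  have [measurable]: "(\<lambda>x. indicator (snd c ` D) x * density_rep g c x) \<in> borel_measurable borel"
    using D by (intro measurable_density_rep g c chart_image_borel) auto
  have Fm: "F \<in> borel_measurable (volume_measure X A g)"
    using F measurable_cong_sets[OF sets_volume_measure[OF g] refl] by blast
  have "(\<integral>\<^sup>+p\<in>D. F p \<partial>volume_measure X A g) = (\<integral>\<^sup>+p. F p \<partial>density (volume_measure X A g) (indicator D))"
    using D g Fm by (subst nn_integral_density) (auto simp: mult.commute intro!: borel_measurable_indicator)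
  also have "\<dots> = (\<integral>\<^sup>+p. F p \<partial>piece_measure g c D)"
    by (simp add: volume_density_piece[OF g c ne D])
  also have "\<dots> = (\<integral>\<^sup>+x. ennreal (indicator (snd c ` D) x * density_rep g c x) * F (chart_inv c x) \<partial>lborel)"
    unfolding piece_measure_def by (subst nn_integral_distr, simp_all add: nn_integral_density)
  also have "\<dots> = (\<integral>\<^sup>+x\<in>snd c ` D. (ennreal (density_rep g c x) * F (inv_into (fst c) (snd c) x)) \<partial>lborel)"
    using D by (intro nn_integral_cong) (auto simp: indicator_def chart_inv_def)
  finally show ?thesis .
qed simp

end

section \<open>Local formula for the L2 metric\<close>

lemma trace_change_of_frame:
  fixes J G H :: "real ^ 'n ^ 'n"
  assumes J: "det J \<noteq> 0" and G: "det G \<noteq> 0"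
    and G': "G' = transpose J ** G ** J" and H': "H' = transpose J ** H ** J"
  shows "trace (matrix_inv G' ** H' ** matrix_inv G' ** H') = trace (matrix_inv G ** H ** matrix_inv G ** H)"
proof -
  define I where "I = matrix_inv J"
  have I: "J ** I = mat 1" "I ** J = mat 1"
    using matrix_inv_inverse[OF J] by (simp_all add: I_def)
  have tI: "transpose J ** transpose I = mat 1" "transpose I ** transpose J = mat 1"
    using I by (metis matrix_transpose_mul transpose_mat)+
  define M where "M = matrix_inv G ** H"
  have "G' ** (I ** matrix_inv G ** transpose I) = transpose J ** (G ** (J ** I) ** matrix_inv G) ** transpose I"
    unfolding G' by (simp only: matrix_mul_assoc)
  then have "G' ** (I ** matrix_inv G ** transpose I) = mat 1"
    by (simp add: I tI matrix_inv_inverse[OF G])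
  then have "matrix_inv G' = I ** matrix_inv G ** transpose I"
    by (rule matrix_inv_eqI)
  then have "matrix_inv G' ** H' = I ** matrix_inv G ** (transpose I ** transpose J) ** H ** J"
    unfolding H' by (simp only: matrix_mul_assoc)
  then have M: "matrix_inv G' ** H' = I ** M ** J"
    by (simp add: tI M_def matrix_mul_assoc)
  have "trace (matrix_inv G' ** H' ** matrix_inv G' ** H') = trace ((I ** M ** J) ** (I ** M ** J))"
    by (simp only: M[symmetric] matrix_mul_assoc)
  also have "(I ** M ** J) ** (I ** M ** J) = I ** (M ** (J ** I) ** M ** J)"
    by (simp only: matrix_mul_assoc)
  also have "trace \<dots> = trace (M ** M ** J ** I)"
    by (subst trace_mul_sym) (simp add: I)
  also have "M ** M ** J ** I = M ** M ** (J ** I)"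
    by (simp only: matrix_mul_assoc)
  also have "\<dots> = matrix_inv G ** H ** matrix_inv G ** H"
    by (simp add: I M_def matrix_mul_assoc)
  finally show ?thesis .
qed

lemma continuous_on_set_integral_parameter:
  fixes f :: "'t::{first_countable_topology, t2_space} \<Rightarrow> 'b::euclidean_space \<Rightarrow> real"
  assumes T: "compact T" and K: "compact K" and E: "E \<in> sets borel" "E \<subseteq> K"
    and f: "continuous_on (T \<times> K) (\<lambda>z. f (fst z) (snd z))"
  shows "continuous_on T (\<lambda>t. LINT x:E|lborel. f t x)"
  unfolding continuous_on_sequentially
proof (intro allI ballI impI)
  fix u t assume t: "t \<in> T" and u: "(\<forall>n. u n \<in> T) \<and> u \<longlonglongrightarrow> t"
  have "bounded ((\<lambda>z. f (fst z) (snd z)) ` (T \<times> K))"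
    by (intro compact_imp_bounded compact_continuous_image f compact_Times T K)
  then obtain B where B: "\<And>z. z \<in> T \<times> K \<Longrightarrow> \<bar>f (fst z) (snd z)\<bar> \<le> B"
    unfolding bounded_iff by auto blast
  have cont: "continuous_on K (f s)" if "s \<in> T" for s
  proof -
    have "continuous_on K (\<lambda>x. (s, x))" by (rule continuous_on_Pair[OF continuous_on_const continuous_on_id])
    from continuous_on_compose2[OF f this] show ?thesis using that by auto
  qed
  have "(\<lambda>n. \<integral>x. indicator E x *\<^sub>R f (u n) x \<partial>lborel) \<longlonglongrightarrow> (\<integral>x. indicator E x *\<^sub>R f t x \<partial>lborel)"
  proof (rule integral_dominated_convergence[where w = "\<lambda>x. indicator K x *\<^sub>R B"])
    show "(\<lambda>x. indicator E x *\<^sub>R f t x) \<in> borel_measurable lborel"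
      using borel_measurable_continuous_on_indicator[OF E(1) continuous_on_subset[OF cont[OF t] E(2)]] by simp
    show "(\<lambda>x. indicator E x *\<^sub>R f (u n) x) \<in> borel_measurable lborel" for n
      using borel_measurable_continuous_on_indicator[OF E(1) continuous_on_subset[OF cont E(2)]] u by simp
    show "integrable lborel (\<lambda>x. indicator K x *\<^sub>R B)"
      by (rule borel_integrable_compact[OF K continuous_on_const])
    show "AE x in lborel. (\<lambda>n. indicator E x *\<^sub>R f (u n) x) \<longlonglongrightarrow> indicator E x *\<^sub>R f t x"
    proof (rule AE_I2)
      fix x
      show "(\<lambda>n. indicator E x *\<^sub>R f (u n) x) \<longlonglongrightarrow> indicator E x *\<^sub>R f t x"
      proof (cases "x \<in> E")
        case True
        have "(\<lambda>n. (u n, x)) \<longlonglongrightarrow> (t, x)" using u by (intro tendsto_intros) auto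
        then have "((\<lambda>z. f (fst z) (snd z)) \<circ> (\<lambda>n. (u n, x))) \<longlonglongrightarrow> f (fst (t, x)) (snd (t, x))"
          using f[unfolded continuous_on_sequentially, rule_format, of "(t, x)" "\<lambda>n. (u n, x)"] True E t u
          by auto
        then show ?thesis using True by (simp add: o_def)
      qed simp
    qed
    show "AE x in lborel. norm (indicator E x *\<^sub>R f (u n) x) \<le> indicator K x *\<^sub>R B" for n
      using B[of "(u n, x)" for x] u E(2) by (intro AE_I2) (auto simp: indicator_def intro: order_trans[OF abs_ge_zero])
  qed
  then show "((\<lambda>t. LINT x:E|lborel. f t x) \<circ> u) \<longlonglongrightarrow> (LINT x:E|lborel. f t x)"
    by (simp add: set_lebesgue_integral_def o_def)
qed

context closed_smooth_manifold
begin

definition energy_rep ::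
    "('a, 'n) tensor_field \<Rightarrow> ('a, 'n) tensor_field \<Rightarrow> ('a, 'n) chart \<Rightarrow> real ^ 'n \<Rightarrow> real" where
  "energy_rep g h c x = energy (local_rep g c x) (local_rep h c x)"

lemma local_rep_symmetric:
  assumes "h \<in> sym_tensors A" "c \<in> A" "x \<in> snd c ` fst c"
  shows "transpose (local_rep h c x) = local_rep h c x"
  using assms sym_tensorsD(2)[OF assms(1,2)] local_rep_inv(2)[OF chart[OF assms(2)]] by auto

lemma energy_rep_nonneg:
  assumes "g \<in> riem_metrics A" "h \<in> sym_tensors A" "c \<in> A" "x \<in> snd c ` fst c"
  shows "energy_rep g h c x \<ge> 0"
  unfolding energy_rep_def
  by (intro energy_nonneg metric_spd(2) local_rep_symmetric assms)

lemma continuous_energy_rep: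
  assumes "g \<in> riem_metrics A" "h \<in> sym_tensors A" "c \<in> A"
  shows "continuous_on (snd c ` fst c) (energy_rep g h c)"
  unfolding energy_rep_def
  by (intro continuous_on_energy sym_tensors_continuous[OF metric_sym[OF assms(1)] assms(3)]
      sym_tensors_continuous[OF assms(2,3)] metric_spd(2) assms)

lemma tr_prod_chart:
  assumes g: "g \<in> riem_metrics A" and h: "h \<in> sym_tensors A" and c: "c \<in> A" "p \<in> fst c"
  shows "tr_prod A g h h p = trace (matrix_inv (g c p) ** h c p ** matrix_inv (g c p) ** h c p)"
proof -
  define d where "d = (SOME c. c \<in> A \<and> p \<in> fst c)"
  have d: "d \<in> A" "p \<in> fst d"
    using someI[of "\<lambda>c. c \<in> A \<and> p \<in> fst c" c] c by (auto simp: d_def)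
  have "tr_prod A g h h p = trace (matrix_inv (g d p) ** h d p ** matrix_inv (g d p) ** h d p)"
    by (simp add: tr_prod_def d_def Let_def)
  also have "\<dots> = trace (matrix_inv (g c p) ** h c p ** matrix_inv (g c p) ** h c p)"
  proof (rule trace_change_of_frame)
    show "det (transition_jacobian d c p) \<noteq> 0"
      by (rule transition_law(1)[OF g d(1) c(1) d(2) c(2)])
    show "det (g c p) \<noteq> 0"
      using spd_det_pos[OF metric_spd(1)[OF g c]] by simp
  qed (rule sym_tensorsD(3)[OF metric_sym[OF g] d(1) c(1) d(2) c(2)],
       rule sym_tensorsD(3)[OF h d(1) c(1) d(2) c(2)])
  finally show ?thesis .
qed

lemma tr_prod_nonneg:
  assumes "g \<in> riem_metrics A" "h \<in> sym_tensors A" "p \<in> topspace X"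
  shows "tr_prod A g h h p \<ge> 0"
proof -
  obtain c where c: "c \<in> A" "p \<in> fst c" using chart_cover[OF assms(3)] by blast
  show ?thesis
    unfolding tr_prod_chart[OF assms(1,2) c]
    by (intro spd_trace_pos(1) metric_spd(1)[OF assms(1)] sym_tensorsD(2)[OF assms(2)] c)
qed

lemma measurable_tr_prod:
  assumes g: "g \<in> riem_metrics A" and h: "h \<in> sym_tensors A"
  shows "tr_prod A g h h \<in> borel_measurable manifold_borel"
proof (rule borel_measurableI)
  fix W :: "real set" assume W: "open W"
  let ?f = "\<lambda>c x. trace (matrix_inv (local_rep g c x) ** local_rep h c x ** matrix_inv (local_rep g c x) ** local_rep h c x)"
  have op: "openin X {p \<in> fst c. tr_prod A g h h p \<in> W}" if c: "c \<in> A" for c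
  proof -
    have "continuous_on (snd c ` fst c) (?f c)"
    proof -
      have "det (local_rep g c x) \<noteq> 0" if "x \<in> snd c ` fst c" for x
        using spd_det_pos[OF metric_spd(2)[OF g c that]] by simp
      then show ?thesis
        by (intro continuous_intros sym_tensors_continuous[OF h c] sym_tensors_continuous[OF metric_sym[OF g] c])
    qed
    then have "open (?f c -` W \<inter> snd c ` fst c)"
      using chart_open_image[OF c] W by (simp add: continuous_on_open_vimage Int_commute)
    from chart_preimage_open[OF c this]
    have "openin X {p \<in> fst c. snd c p \<in> ?f c -` W \<inter> snd c ` fst c}" .
    moreover have "?f c (snd c p) = tr_prod A g h h p" if "p \<in> fst c" for p
      by (simp only: tr_prod_chart[OF g h c that] local_rep_inv(2)[OF chart[OF c] that])
    then have "{p \<in> fst c. snd c p \<in> ?f c -` W \<inter> snd c ` fst c} = {p \<in> fst c. tr_prod A g h h p \<in> W}"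
      by (intro Collect_cong conj_cong) auto
    ultimately show ?thesis by simp
  qed
  have "tr_prod A g h h -` W \<inter> space manifold_borel = (\<Union>c\<in>A. {p \<in> fst c. tr_prod A g h h p \<in> W})"
    using chart_cover chart_subset by (auto simp: subset_iff)
  also have "openin X \<dots>" using op by (intro openin_Union) auto
  then have "(\<Union>c\<in>A. {p \<in> fst c. tr_prod A g h h p \<in> W}) \<in> sets manifold_borel" by (rule open_in_manifold_borel)
  finally show "tr_prod A g h h -` W \<inter> space manifold_borel \<in> sets manifold_borel" .
qed

lemma nn_integral_tr_prod_piece:
  assumes g: "g \<in> riem_metrics A" and h: "h \<in> sym_tensors A" and c: "c \<in> A"
    and D: "D \<in> sets manifold_borel" "D \<subseteq> fst c"
  shows "(\<integral>\<^sup>+p\<in>D. ennreal (tr_prod A g h h p) \<partial>volume_measure X A g) =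
    (\<integral>\<^sup>+x\<in>snd c ` D. ennreal (energy_rep g h c x) \<partial>lborel)"
proof -
  have "(\<integral>\<^sup>+p\<in>D. ennreal (tr_prod A g h h p) \<partial>volume_measure X A g) =
    (\<integral>\<^sup>+x\<in>snd c ` D. (ennreal (density_rep g c x) * ennreal (tr_prod A g h h (inv_into (fst c) (snd c) x))) \<partial>lborel)"
    using measurable_tr_prod[OF g h] by (intro nn_integral_volume_piece g c D) measurable
  also have "\<dots> = (\<integral>\<^sup>+x\<in>snd c ` D. ennreal (energy_rep g h c x) \<partial>lborel)"
  proof (intro nn_integral_cong)
    fix x
    have "ennreal (density_rep g c x) * ennreal (tr_prod A g h h (inv_into (fst c) (snd c) x)) =
        ennreal (energy_rep g h c x)" if "x \<in> snd c ` D"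
    proof -
      obtain p where p: "p \<in> fst c" "x = snd c p" using \<open>x \<in> snd c ` D\<close> D by auto
      have rep: "local_rep k c x = k c p" for k
        unfolding p(2) by (rule local_rep_inv(2)[OF chart[OF c] p(1)])
      have inv: "inv_into (fst c) (snd c) x = p"
        unfolding p(2) by (rule local_rep_inv(1)[OF chart[OF c] p(1)])
      have pos: "det (g c p) > 0" by (rule spd_det_pos[OF metric_spd(1)[OF g c p(1)]])
      have "energy_rep g h c x = tr_prod A g h h p * density_rep g c x"
        using pos by (simp add: energy_rep_def energy_def rep density_rep_def tr_prod_chart[OF g h c p(1)])
      then show ?thesis
        unfolding inv by (simp add: ennreal_mult'' density_rep_def mult.commute)
    qed
    then show "ennreal (density_rep g c x) * ennreal (tr_prod A g h h (inv_into (fst c) (snd c) x)) *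
        indicator (snd c ` D) x = ennreal (energy_rep g h c x) * indicator (snd c ` D) x"
      by (auto simp: indicator_def)
  qed
  finally show ?thesis .
qed

lemma energy_rep_set_integrable:
  assumes "g \<in> riem_metrics A" "h \<in> sym_tensors A" "c \<in> A" "compact K" "K \<subseteq> snd c ` fst c"
    "E \<in> sets borel" "E \<subseteq> K"
  shows "set_integrable lborel E (energy_rep g h c)"
proof (rule set_integrable_subset)
  show "set_integrable lborel K (energy_rep g h c)"
    unfolding set_integrable_def
    by (intro borel_integrable_compact assms continuous_on_subset[OF continuous_energy_rep])
qed (use assms in auto)

lemma L2_inner_partition:
  assumes g: "g \<in> riem_metrics A" and h: "h \<in> sym_tensors A" and part: "borel_partition m ch K D"
  shows "(\<integral>\<^sup>+p. ennreal (tr_prod A g h h p) \<partial>volume_measure X A g) = ennreal (L2_inner X A g h h)"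
    and "L2_inner X A g h h = (\<Sum>i<m. LINT x:snd (ch i) ` D i|lborel. energy_rep g h (ch i) x)"
    and "L2_inner X A g h h \<ge> 0"
proof -
  note P = borel_partitionD[OF part]
  let ?\<mu> = "volume_measure X A g" and ?F = "\<lambda>p. ennreal (tr_prod A g h h p)"
  let ?I = "\<lambda>i. LINT x:snd (ch i) ` D i|lborel. energy_rep g h (ch i) x"
  have trm: "tr_prod A g h h \<in> borel_measurable ?\<mu>"
    using measurable_tr_prod[OF g h] measurable_cong_sets[OF sets_volume_measure[OF g] refl] by blast
  then have Fm: "?F \<in> borel_measurable ?\<mu>" by measurable
  have Dm: "D i \<in> sets ?\<mu>" if "i < m" for i using P(5)[OF that] g by simp
  have Im: "snd (ch i) ` D i \<in> sets borel" if "i < m" for i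
    by (rule chart_image_borel[OF P(1,5,6)[OF that]])
  have piece: "(\<integral>\<^sup>+p\<in>D i. ?F p \<partial>?\<mu>) = ennreal (?I i)" and I0: "?I i \<ge> 0" if i: "i < m" for i
  proof -
    have nn: "indicator (snd (ch i) ` D i) x *\<^sub>R energy_rep g h (ch i) x \<ge> 0" for x
      using energy_rep_nonneg[OF g h P(1)[OF i], of x] P(4,7)[OF i] by (auto simp: indicator_def)
    then show "?I i \<ge> 0" unfolding set_lebesgue_integral_def by (intro integral_nonneg_AE AE_I2)
    have "(\<integral>\<^sup>+p\<in>D i. ?F p \<partial>?\<mu>) = (\<integral>\<^sup>+x\<in>snd (ch i) ` D i. ennreal (energy_rep g h (ch i) x) \<partial>lborel)"
      by (rule nn_integral_tr_prod_piece[OF g h P(1,5,6)[OF i]])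
    also have "\<dots> = (\<integral>\<^sup>+x. ennreal (indicator (snd (ch i) ` D i) x *\<^sub>R energy_rep g h (ch i) x) \<partial>lborel)"
      by (intro nn_integral_cong) (auto simp: indicator_def)
    also have "\<dots> = ennreal (?I i)"
      unfolding set_lebesgue_integral_def
      using energy_rep_set_integrable[OF g h P(1)[OF i] P(3)[OF i] P(4)[OF i] Im[OF i] P(7)[OF i]] nn
      by (intro nn_integral_eq_integral AE_I2) (auto simp: set_integrable_def)
    finally show "(\<integral>\<^sup>+p\<in>D i. ?F p \<partial>?\<mu>) = ennreal (?I i)" .
  qed
  have "(\<integral>\<^sup>+p. ?F p \<partial>?\<mu>) = (\<integral>\<^sup>+p. (\<Sum>i<m. ?F p * indicator (D i) p) \<partial>?\<mu>)"
  proof (intro nn_integral_cong)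
    fix p assume "p \<in> space ?\<mu>"
    then have "p \<in> (\<Union>i<m. D i)" using P(9) g by simp
    then have "(\<Sum>i<m. indicator (D i) p) = (1 :: ennreal)"
      using indicator_UN_disjoint[OF _ P(8), of p] by simp
    then show "?F p = (\<Sum>i<m. ?F p * indicator (D i) p)"
      by (simp flip: sum_distrib_left)
  qed
  also have "\<dots> = (\<Sum>i<m. \<integral>\<^sup>+p\<in>D i. ?F p \<partial>?\<mu>)"
    by (intro nn_integral_sum borel_measurable_times_ennreal Fm borel_measurable_indicator Dm) simp
  also have "\<dots> = ennreal (\<Sum>i<m. ?I i)"
    using piece I0 by (subst sum_ennreal[symmetric]) auto
  finally have nn: "(\<integral>\<^sup>+p. ?F p \<partial>?\<mu>) = ennreal (\<Sum>i<m. ?I i)" .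
  have "L2_inner X A g h h = enn2real (\<integral>\<^sup>+p. ?F p \<partial>?\<mu>)"
    unfolding L2_inner_def
    using tr_prod_nonneg[OF g h] g by (intro integral_eq_nn_integral trm AE_I2) simp
  also have "\<dots> = (\<Sum>i<m. ?I i)"
    unfolding nn using I0 by (intro enn2real_ennreal sum_nonneg) auto
  finally show eq: "L2_inner X A g h h = (\<Sum>i<m. ?I i)" .
  show "L2_inner X A g h h \<ge> 0" unfolding eq using I0 by (intro sum_nonneg) auto
  show "(\<integral>\<^sup>+p. ?F p \<partial>?\<mu>) = ennreal (L2_inner X A g h h)" unfolding eq by (rule nn)
qed

lemma L2_inner_nonneg:
  assumes "g \<in> riem_metrics A" "h \<in> sym_tensors A"
  shows "L2_inner X A g h h \<ge> 0"
  using borel_partition_exists L2_inner_partition(3)[OF assms] by metis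

lemma integral_energy_le_L2_inner:
  assumes g: "g \<in> riem_metrics A" and h: "h \<in> sym_tensors A" and c: "c \<in> A"
    and box: "cbox a b \<subseteq> snd c ` fst c"
  shows "integral (cbox a b) (energy_rep g h c) \<le> L2_inner X A g h h"
proof -
  obtain m ch K D where part: "borel_partition m ch K D" by (rule borel_partition_exists)
  define D' where "D' = {p \<in> fst c. snd c p \<in> cbox a b}"
  have "D' = fst c - {p \<in> fst c. snd c p \<in> - cbox a b}" by (auto simp: D'_def)
  moreover have "{p \<in> fst c. snd c p \<in> - cbox a b} \<in> sets manifold_borel"
    by (intro open_in_manifold_borel chart_preimage_open c) auto
  ultimately have D': "D' \<in> sets manifold_borel" "D' \<subseteq> fst c" using c by (auto simp: D'_def)
  have im: "snd c ` D' = cbox a b" using box by (auto simp: D'_def)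
  have int: "energy_rep g h c integrable_on cbox a b"
    by (intro integrable_continuous continuous_on_subset[OF continuous_energy_rep[OF g h c] box])
  have "ennreal (integral (cbox a b) (energy_rep g h c)) =
      (\<integral>\<^sup>+x\<in>cbox a b. ennreal (energy_rep g h c x) \<partial>lborel)"
    by (rule nn_integral_has_integral_lebesgue'[symmetric])
       (use energy_rep_nonneg[OF g h c] box int in \<open>auto simp: has_integral_integral[symmetric]\<close>)
  also have "\<dots> = (\<integral>\<^sup>+p\<in>D'. ennreal (tr_prod A g h h p) \<partial>volume_measure X A g)"
    by (simp add: nn_integral_tr_prod_piece[OF g h c D'] im)
  also have "\<dots> \<le> (\<integral>\<^sup>+p. ennreal (tr_prod A g h h p) \<partial>volume_measure X A g)"
    by (intro nn_integral_mono) (auto simp: indicator_def)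
  also have "\<dots> = ennreal (L2_inner X A g h h)"
    by (rule L2_inner_partition(1)[OF g h part])
  finally show ?thesis
    using L2_inner_nonneg[OF g h] by (simp add: ennreal_le_iff)
qed

lemma continuous_on_L2_inner:
  assumes T: "compact (T :: real set)"
    and g: "\<And>t. t \<in> T \<Longrightarrow> \<gamma> t \<in> riem_metrics A" and h: "\<And>t. t \<in> T \<Longrightarrow> h t \<in> sym_tensors A"
    and cg: "\<And>c K. c \<in> A \<Longrightarrow> compact K \<Longrightarrow> K \<subseteq> snd c ` fst c \<Longrightarrow>
      continuous_on (T \<times> K) (\<lambda>z. local_rep (\<gamma> (fst z)) c (snd z))"
    and ch: "\<And>c K. c \<in> A \<Longrightarrow> compact K \<Longrightarrow> K \<subseteq> snd c ` fst c \<Longrightarrow>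
      continuous_on (T \<times> K) (\<lambda>z. local_rep (h (fst z)) c (snd z))"
  shows "continuous_on T (\<lambda>t. L2_inner X A (\<gamma> t) (h t) (h t))"
proof -
  obtain m ch K D where part: "borel_partition m ch K D" by (rule borel_partition_exists)
  note P = borel_partitionD[OF part]
  have "continuous_on T (\<lambda>t. \<Sum>i<m. LINT x:snd (ch i) ` D i|lborel. energy_rep (\<gamma> t) (h t) (ch i) x)"
  proof (intro continuous_on_sum)
    fix i assume "i \<in> {..<m}"
    then have i: "i < m" by simp
    show "continuous_on T (\<lambda>t. LINT x:snd (ch i) ` D i|lborel. energy_rep (\<gamma> t) (h t) (ch i) x)"
    proof (rule continuous_on_set_integral_parameter[OF T P(3)[OF i] chart_image_borel[OF P(1,5,6)[OF i]] P(7)[OF i]])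
      show "continuous_on (T \<times> K i) (\<lambda>z. energy_rep (\<gamma> (fst z)) (h (fst z)) (ch i) (snd z))"
        unfolding energy_rep_def
        using P(4)[OF i] by (intro continuous_on_energy cg assms(5) P i metric_spd(2) g) auto
    qed
  qed
  then show ?thesis
    by (rule continuous_on_eq) (simp add: L2_inner_partition(2)[OF g h part])
qed

end

section \<open>Lengths of piecewise smooth paths\<close>

lemma affine_vimage_eq_image:
  fixes r q :: real
  assumes "r \<noteq> 0"
  shows "(\<lambda>t. r * t + q) -` S = (\<lambda>x. (1 / r) * x - q / r) ` S"
proof (intro equalityI subsetI)
  fix t assume "t \<in> (\<lambda>t. r * t + q) -` S"
  moreover have "t = (1 / r) * (r * t + q) - q / r" using assms by (simp add: field_simps)
  ultimately show "t \<in> (\<lambda>x. (1 / r) * x - q / r) ` S" by (intro image_eqI) auto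
next
  fix t assume "t \<in> (\<lambda>x. (1 / r) * x - q / r) ` S"
  then obtain x where x: "x \<in> S" "t = (1 / r) * x - q / r" by blast
  have "r * t + q = x" unfolding x(2) using assms by (simp add: field_simps)
  then show "t \<in> (\<lambda>t. r * t + q) -` S" using x(1) by simp
qed

lemma filterlim_affine_within:
  fixes r q :: real
  assumes "r \<noteq> 0"
  shows "filterlim (\<lambda>t. r * t + q) (at (r * t0 + q) within T) (at t0 within (\<lambda>t. r * t + q) -` T)"
  unfolding filterlim_at
proof
  show "((\<lambda>t. r * t + q) \<longlongrightarrow> r * t0 + q) (at t0 within (\<lambda>t. r * t + q) -` T)"
    by (intro tendsto_intros)
  show "\<forall>\<^sub>F t in at t0 within (\<lambda>t. r * t + q) -` T. r * t + q \<in> T \<and> r * t + q \<noteq> r * t0 + q"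
    unfolding eventually_at_filter using assms by (intro always_eventually) auto
qed

context closed_smooth_manifold
begin

lemma has_velocity_cong:
  assumes "\<And>s. s \<in> T \<Longrightarrow> \<gamma> s = \<gamma>' s" "\<gamma> t = \<gamma>' t" "has_velocity A \<gamma> h t T"
  shows "has_velocity A \<gamma>' h t T"
  unfolding has_velocity_def
proof (rule limitin_transform_eventually[OF _ assms(3)[unfolded has_velocity_def]])
  show "\<forall>\<^sub>F s in at t within T. (\<lambda>c p. (\<gamma> s c p - \<gamma> t c p) /\<^sub>R (s - t)) = (\<lambda>c p. (\<gamma>' s c p - \<gamma>' t c p) /\<^sub>R (s - t))"
    unfolding eventually_at_filter using assms by (intro always_eventually) auto
qed

lemma has_velocity_sym: "has_velocity A \<gamma> h t T \<Longrightarrow> h \<in> sym_tensors A"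
  by (simp add: has_velocity_def limitin_smooth_topology)

lemma has_velocity_scaleR:
  assumes "has_velocity A \<gamma> h t T"
  shows "has_velocity A (\<lambda>s c p. a *\<^sub>R \<gamma> s c p) (\<lambda>c p. a *\<^sub>R h c p) t T"
proof -
  have "(\<lambda>s c p. (a *\<^sub>R \<gamma> s c p - a *\<^sub>R \<gamma> t c p) /\<^sub>R (s - t)) =
      (\<lambda>s c p. a *\<^sub>R ((\<gamma> s c p - \<gamma> t c p) /\<^sub>R (s - t)))"
    by (simp add: scaleR_diff_right mult.commute fun_eq_iff)
  then show ?thesis
    using limitin_smooth_scaleR[OF atlas assms[unfolded has_velocity_def], of a]
    unfolding has_velocity_def by simp
qed

lemma has_velocity_affine:
  assumes "has_velocity A \<gamma> h (r * t + q) T" "r \<noteq> 0"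
  shows "has_velocity A (\<lambda>s. \<gamma> (r * s + q)) (\<lambda>c p. r *\<^sub>R h c p) t ((\<lambda>s. r * s + q) -` T)"
proof -
  let ?Q = "\<lambda>s c p. (\<gamma> s c p - \<gamma> (r * t + q) c p) /\<^sub>R (s - (r * t + q))"
  have "limitin (smooth_topology A) (\<lambda>s. ?Q (r * s + q)) h (at t within (\<lambda>s. r * s + q) -` T)"
    unfolding limitin_def
  proof (intro conjI allI impI)
    show "h \<in> topspace (smooth_topology A)"
      using assms(1) unfolding has_velocity_def limitin_def by blast
    fix U assume U: "openin (smooth_topology A) U \<and> h \<in> U"
    then have "\<forall>\<^sub>F s in at (r * t + q) within T. ?Q s \<in> U"
      using assms(1) unfolding has_velocity_def limitin_def by blast
    then show "\<forall>\<^sub>F s in at t within (\<lambda>s. r * s + q) -` T. ?Q (r * s + q) \<in> U"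
      by (rule eventually_compose_filterlim[OF _ filterlim_affine_within[OF assms(2)]])
  qed
  from limitin_smooth_scaleR[OF atlas this, of r]
  have "limitin (smooth_topology A) (\<lambda>s c p. r *\<^sub>R ?Q (r * s + q) c p) (\<lambda>c p. r *\<^sub>R h c p)
      (at t within (\<lambda>s. r * s + q) -` T)" .
  moreover have "(\<lambda>s c p. r *\<^sub>R ?Q (r * s + q) c p) =
      (\<lambda>s c p. (\<gamma> (r * s + q) c p - \<gamma> (r * t + q) c p) /\<^sub>R (s - t))"
  proof (intro ext)
    fix s c p
    have "r * s + q - (r * t + q) = r * (s - t)" by (simp add: right_diff_distrib)
    then have "r * inverse (r * s + q - (r * t + q)) = inverse (s - t)"
      using assms(2) by simp
    then show "r *\<^sub>R ?Q (r * s + q) c p = (\<gamma> (r * s + q) c p - \<gamma> (r * t + q) c p) /\<^sub>R (s - t)"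
      by (simp only: scaleR_scaleR)
  qed
  ultimately show ?thesis
    unfolding has_velocity_def by simp
qed

lemma smooth_curve_on_affine:
  assumes "smooth_curve_on A T \<gamma>" "r \<noteq> 0"
  shows "smooth_curve_on A ((\<lambda>s. r * s + q) -` T) (\<lambda>s. \<gamma> (r * s + q))"
proof -
  obtain D where D: "\<And>t. t \<in> T \<Longrightarrow> D 0 t = \<gamma> t" "\<And>k t. t \<in> T \<Longrightarrow> has_velocity A (D k) (D (Suc k) t) t T"
    using assms(1) unfolding smooth_curve_on_def by blast
  define D' where "D' k t = (\<lambda>c p. r ^ k *\<^sub>R D k (r * t + q) c p)" for k :: nat and t
  have D'_eq: "D' k = (\<lambda>t c p. r ^ k *\<^sub>R D k (r * t + q) c p)" for k
    by (simp add: D'_def fun_eq_iff)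
  have "has_velocity A (D' k) (D' (Suc k) t) t ((\<lambda>s. r * s + q) -` T)" if "t \<in> (\<lambda>s. r * s + q) -` T" for k t
    using has_velocity_scaleR[OF has_velocity_affine[OF D(2)[of "r * t + q" k] assms(2)], of "r ^ k"] that
    by (simp add: D'_eq mult.commute)
  moreover have "D' 0 t = \<gamma> (r * t + q)" if "t \<in> (\<lambda>s. r * s + q) -` T" for t
    using D(1)[of "r * t + q"] that by (simp add: D'_def)
  ultimately show ?thesis unfolding smooth_curve_on_def by blast
qed

lemma smooth_curve_on_cong:
  assumes "smooth_curve_on A T \<gamma>" "\<And>t. t \<in> T \<Longrightarrow> \<gamma> t = \<gamma>' t"
  shows "smooth_curve_on A T \<gamma>'"
  using assms unfolding smooth_curve_on_def by metis

lemma L2_norm_scaleR: "L2_norm X A g (\<lambda>c p. r *\<^sub>R h c p) = \<bar>r\<bar> * L2_norm X A g h"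
proof -
  have "tr_prod A g (\<lambda>c p. r *\<^sub>R h c p) (\<lambda>c p. r *\<^sub>R h c p) p = r\<^sup>2 * tr_prod A g h h p" for p
    by (simp add: tr_prod_def Let_def matrix_mult_scaleR_left matrix_mult_scaleR_right trace_scaleR power2_eq_square)
  then have "L2_inner X A g (\<lambda>c p. r *\<^sub>R h c p) (\<lambda>c p. r *\<^sub>R h c p) = r\<^sup>2 * L2_inner X A g h h"
    by (simp add: L2_inner_def)
  then show ?thesis by (simp add: L2_norm_def real_sqrt_mult)
qed

lemma L2_norm_nonneg: "g \<in> riem_metrics A \<Longrightarrow> h \<in> sym_tensors A \<Longrightarrow> L2_norm X A g h \<ge> 0"
  by (simp add: L2_norm_def L2_inner_nonneg)

definition smooth_piece :: "real \<Rightarrow> real \<Rightarrow> (real \<Rightarrow> ('a, 'n) tensor_field) \<Rightarrow> real \<Rightarrow> bool" where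
  "smooth_piece a b \<gamma> l \<longleftrightarrow> a < b \<and> smooth_curve_on A {a..b} \<gamma> \<and>
     (\<exists>h. (\<forall>t\<in>{a..b}. has_velocity A \<gamma> (h t) t {a..b}) \<and>
        ((\<lambda>t. L2_norm X A (\<gamma> t) (h t)) has_integral l) {a..b})"

lemma smooth_piece_affine:
  assumes "smooth_piece a b \<gamma> l" "r \<noteq> 0" "(\<lambda>t. r * t + q) -` {a..b} = {a'..b'}" "a' < b'"
  shows "smooth_piece a' b' (\<lambda>t. \<gamma> (r * t + q)) l"
proof -
  from assms(1) obtain h where ab: "a < b" and sm: "smooth_curve_on A {a..b} \<gamma>"
    and h: "\<And>t. t \<in> {a..b} \<Longrightarrow> has_velocity A \<gamma> (h t) t {a..b}"
    and l: "((\<lambda>t. L2_norm X A (\<gamma> t) (h t)) has_integral l) {a..b}"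
    unfolding smooth_piece_def by blast
  define h' where "h' t = (\<lambda>c p. r *\<^sub>R h (r * t + q) c p)" for t
  have "has_velocity A (\<lambda>t. \<gamma> (r * t + q)) (h' t) t {a'..b'}" if "t \<in> {a'..b'}" for t
    using has_velocity_affine[OF h assms(2)] that unfolding assms(3)[symmetric] h'_def by simp
  moreover have "smooth_curve_on A {a'..b'} (\<lambda>t. \<gamma> (r * t + q))"
    using smooth_curve_on_affine[OF sm assms(2)] unfolding assms(3)[symmetric] .
  moreover have "((\<lambda>t. L2_norm X A (\<gamma> (r * t + q)) (h' t)) has_integral l) {a'..b'}"
  proof -
    have "((\<lambda>t. L2_norm X A (\<gamma> (r * t + q)) (h (r * t + q))) has_integral (1 / \<bar>r\<bar>) * l) {a'..b'}"
    proof -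
      have "(\<lambda>x. (1 / r) *\<^sub>R x + - ((1 / r) *\<^sub>R q)) ` cbox a b = {a'..b'}"
        unfolding assms(3)[symmetric] affine_vimage_eq_image[OF assms(2)] by simp
      with has_integral_affinity[OF l[folded cbox_interval] assms(2), of q] show ?thesis by simp
    qed
    from has_integral_mult_right[OF this, of "\<bar>r\<bar>"] show ?thesis
      using assms(2) by (simp add: h'_def L2_norm_scaleR)
  qed
  ultimately show ?thesis
    unfolding smooth_piece_def using assms(4) by blast
qed

lemma smooth_piece_cong:
  assumes "smooth_piece a b \<gamma> l" "\<And>t. t \<in> {a..b} \<Longrightarrow> \<gamma> t = \<gamma>' t"
  shows "smooth_piece a b \<gamma>' l"
proof -
  from assms(1) obtain h where ab: "a < b" and sm: "smooth_curve_on A {a..b} \<gamma>"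
    and h: "\<And>t. t \<in> {a..b} \<Longrightarrow> has_velocity A \<gamma> (h t) t {a..b}"
    and l: "((\<lambda>t. L2_norm X A (\<gamma> t) (h t)) has_integral l) {a..b}"
    unfolding smooth_piece_def by blast
  have "has_velocity A \<gamma>' (h t) t {a..b}" if "t \<in> {a..b}" for t
    by (rule has_velocity_cong[OF assms(2) assms(2) h]) (use that in auto)
  moreover have "((\<lambda>t. L2_norm X A (\<gamma>' t) (h t)) has_integral l) {a..b}"
    using l assms(2) by (subst has_integral_cong[where g = "\<lambda>t. L2_norm X A (\<gamma> t) (h t)"]) auto
  ultimately show ?thesis
    unfolding smooth_piece_def using ab smooth_curve_on_cong[OF sm assms(2)] by blast
qed

text \<open>Carrying the length along avoids the unspecified velocities at break points.\<close>

inductive piecewise :: "(real \<Rightarrow> ('a, 'n) tensor_field) \<Rightarrow> real \<Rightarrow> real \<Rightarrow> real \<Rightarrow> bool" for \<gamma> where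
  empty: "piecewise \<gamma> a a 0"
| cons: "smooth_piece a b \<gamma> l \<Longrightarrow> piecewise \<gamma> b c L \<Longrightarrow> piecewise \<gamma> a c (l + L)"

lemma piecewise_le: "piecewise \<gamma> a b L \<Longrightarrow> a \<le> b"
  by (induction rule: piecewise.induct) (auto simp: smooth_piece_def)

lemma piecewise_single: "smooth_piece a b \<gamma> l \<Longrightarrow> piecewise \<gamma> a b l"
  using piecewise.cons[OF _ piecewise.empty] by fastforce

lemma piecewise_join:
  assumes "piecewise \<gamma> a b L1" "piecewise \<gamma> b c L2"
  shows "piecewise \<gamma> a c (L1 + L2)"
  using assms
proof (induction rule: piecewise.induct)
  case (cons a b l b' L)
  from piecewise.cons[OF cons.hyps(1) cons.IH[OF cons.prems]] show ?case by (simp add: add.assoc)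
qed simp

lemma piecewise_cong:
  assumes "piecewise \<gamma> a b L" "\<And>t. t \<in> {a..b} \<Longrightarrow> \<gamma> t = \<gamma>' t"
  shows "piecewise \<gamma>' a b L"
  using assms
proof (induction rule: piecewise.induct)
  case (cons a b l c L)
  have le: "a < b" "b \<le> c" using cons.hyps piecewise_le by (auto simp: smooth_piece_def)
  show ?case
    by (rule piecewise.cons[OF smooth_piece_cong[OF cons.hyps(1)] cons.IH]) (use le cons.prems in auto)
qed (rule piecewise.empty)

lemma piecewise_affine:
  assumes "piecewise \<gamma> a b L" "r > 0"
  shows "piecewise (\<lambda>t. \<gamma> (r * t + q)) ((a - q) / r) ((b - q) / r) L"
  using assms(1)
proof (induction rule: piecewise.induct)
  case (cons a b l c L)
  have "(\<lambda>t. r * t + q) -` {a..b} = {(a - q) / r..(b - q) / r}"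
    using assms(2) by (auto simp: field_simps)
  moreover have "(a - q) / r < (b - q) / r"
    using cons.hyps(1) assms(2) by (simp add: smooth_piece_def divide_strict_right_mono)
  ultimately have "smooth_piece ((a - q) / r) ((b - q) / r) (\<lambda>t. \<gamma> (r * t + q)) l"
    using assms(2) by (intro smooth_piece_affine[OF cons.hyps(1)]) auto
  then show ?case by (rule piecewise.cons[OF _ cons.IH])
qed (rule piecewise.empty)

lemma piecewise_reverse:
  assumes "piecewise \<gamma> a b L"
  shows "piecewise (\<lambda>t. \<gamma> (- t)) (- b) (- a) L"
  using assms
proof (induction rule: piecewise.induct)
  case (cons a b l c L)
  have "(\<lambda>t. - 1 * t + 0) -` {a..b} = {- b..- a}" by auto
  then have "smooth_piece (- b) (- a) (\<lambda>t. \<gamma> (- 1 * t + 0)) l"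
    using cons.hyps(1) by (intro smooth_piece_affine[OF cons.hyps(1)]) (auto simp: smooth_piece_def)
  then have "piecewise (\<lambda>t. \<gamma> (- t)) (- b) (- a) l"
    by (intro piecewise_single) simp
  from piecewise_join[OF cons.IH this] show ?case by (simp add: add.commute)
qed (rule piecewise.empty)

lemma smooth_piece_length_nonneg:
  assumes "smooth_piece a b \<gamma> l" "\<And>t. t \<in> {a..b} \<Longrightarrow> \<gamma> t \<in> riem_metrics A"
  shows "l \<ge> 0"
proof -
  from assms(1) obtain h where h: "\<And>t. t \<in> {a..b} \<Longrightarrow> has_velocity A \<gamma> (h t) t {a..b}"
    and l: "((\<lambda>t. L2_norm X A (\<gamma> t) (h t)) has_integral l) {a..b}"
    unfolding smooth_piece_def by blast
  show ?thesis
    by (rule has_integral_nonneg[OF l]) (intro L2_norm_nonneg assms(2) has_velocity_sym[OF h])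
qed

lemma piecewise_length_nonneg:
  assumes "piecewise \<gamma> a b L" "\<And>t. t \<in> {a..b} \<Longrightarrow> \<gamma> t \<in> riem_metrics A"
  shows "L \<ge> 0"
  using assms
proof (induction rule: piecewise.induct)
  case (cons a b l c L)
  have le: "a < b" "b \<le> c" using cons.hyps piecewise_le by (auto simp: smooth_piece_def)
  have "l \<ge> 0" by (rule smooth_piece_length_nonneg[OF cons.hyps(1)]) (use le cons.prems in auto)
  moreover have "L \<ge> 0" by (rule cons.IH) (use le cons.prems in auto)
  ultimately show ?case by simp
qed simp

text \<open>The second derivative makes the velocity a continuous curve of tensors, hence the speed is
  continuous and therefore integrable.\<close>

lemma smooth_curve_velocity:
  assumes "smooth_curve_on A {a..b} \<gamma>" "\<And>t. t \<in> {a..b} \<Longrightarrow> \<gamma> t \<in> riem_metrics A"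
  shows "\<exists>h. (\<forall>t\<in>{a..b}. has_velocity A \<gamma> (h t) t {a..b}) \<and>
    (\<forall>c\<in>A. \<forall>K. compact K \<longrightarrow> K \<subseteq> snd c ` fst c \<longrightarrow>
      continuous_on ({a..b} \<times> K) (\<lambda>z. local_rep (\<gamma> (fst z)) c (snd z)) \<and>
      continuous_on ({a..b} \<times> K) (\<lambda>z. local_rep (h (fst z)) c (snd z))) \<and>
    continuous_on {a..b} (\<lambda>t. L2_norm X A (\<gamma> t) (h t))"
proof -
  obtain D where D: "\<And>t. t \<in> {a..b} \<Longrightarrow> D 0 t = \<gamma> t"
    "\<And>k t. t \<in> {a..b} \<Longrightarrow> has_velocity A (D k) (D (Suc k) t) t {a..b}"
    using assms(1) unfolding smooth_curve_on_def by blast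
  have v: "has_velocity A \<gamma> (D (Suc 0) t) t {a..b}" if "t \<in> {a..b}" for t
    by (rule has_velocity_cong[OF D(1) D(1) D(2)]) (use that in auto)
  have sym: "D (Suc 0) t \<in> sym_tensors A" if "t \<in> {a..b}" for t
    by (rule has_velocity_sym[OF v[OF that]])
  have c0: "continuous_on ({a..b} \<times> K) (\<lambda>z. local_rep (\<gamma> (fst z)) c (snd z))"
    if "c \<in> A" "compact K" "K \<subseteq> snd c ` fst c" for c K
    by (rule curve_jointly_continuous[OF v metric_sym[OF assms(2)] that])
  have c1: "continuous_on ({a..b} \<times> K) (\<lambda>z. local_rep (D (Suc 0) (fst z)) c (snd z))"
    if "c \<in> A" "compact K" "K \<subseteq> snd c ` fst c" for c K
    by (rule curve_jointly_continuous[OF D(2) sym that])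
  have "continuous_on {a..b} (\<lambda>t. L2_inner X A (\<gamma> t) (D (Suc 0) t) (D (Suc 0) t))"
    by (rule continuous_on_L2_inner[OF compact_Icc assms(2) sym c0 c1])
  then have "continuous_on {a..b} (\<lambda>t. L2_norm X A (\<gamma> t) (D (Suc 0) t))"
    unfolding L2_norm_def by (rule continuous_on_real_sqrt)
  with v c0 c1 show ?thesis by (intro exI[of _ "D (Suc 0)"]) simp
qed

lemma smooth_curve_is_piece:
  assumes "a < b" "smooth_curve_on A {a..b} \<gamma>" "\<And>t. t \<in> {a..b} \<Longrightarrow> \<gamma> t \<in> riem_metrics A"
  obtains l where "smooth_piece a b \<gamma> l"
proof -
  obtain h where h: "\<And>t. t \<in> {a..b} \<Longrightarrow> has_velocity A \<gamma> (h t) t {a..b}"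
    and cont: "continuous_on {a..b} (\<lambda>t. L2_norm X A (\<gamma> t) (h t))"
    using smooth_curve_velocity[OF assms(2,3)] by blast
  obtain l where "((\<lambda>t. L2_norm X A (\<gamma> t) (h t)) has_integral l) {a..b}"
    using integrable_continuous_real[OF cont] unfolding integrable_on_def by blast
  then have "smooth_piece a b \<gamma> l"
    unfolding smooth_piece_def using h assms(1,2) by blast
  then show ?thesis by (rule that)
qed

lemma partition_mono:
  fixes \<tau> :: "nat \<Rightarrow> real"
  assumes "\<And>i. i < m \<Longrightarrow> \<tau> i < \<tau> (Suc i)" "i \<le> j" "j \<le> m"
  shows "\<tau> i \<le> \<tau> j"
  using assms(2,3)
proof (induction j rule: dec_induct)
  case (step n)
  then show ?case using assms(1)[of n] by simp
qed simp

lemma metric_path_piecewise: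
  assumes "metric_path A \<gamma>"
  obtains L where "piecewise \<gamma> 0 1 L"
proof -
  obtain m :: nat and \<tau> :: "nat \<Rightarrow> real" where \<tau>: "\<tau> 0 = 0" "\<tau> m = 1"
    "\<And>i. i < m \<Longrightarrow> \<tau> i < \<tau> (Suc i)" "\<And>i. i < m \<Longrightarrow> smooth_curve_on A {\<tau> i..\<tau> (Suc i)} \<gamma>"
    using assms unfolding metric_path_def by blast
  have riem: "\<gamma> t \<in> riem_metrics A" if "t \<in> {\<tau> i..\<tau> (Suc i)}" "i < m" for t i
  proof -
    have "\<tau> 0 \<le> \<tau> i" "\<tau> (Suc i) \<le> \<tau> m"
      using that(2) by (intro partition_mono[of m \<tau>] \<tau>(3); simp)+
    then show ?thesis using assms that(1) \<tau>(1,2) by (simp add: metric_path_def)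
  qed
  have "\<exists>L. piecewise \<gamma> (\<tau> 0) (\<tau> i) L" if "i \<le> m" for i
    using that
  proof (induction i)
    case 0
    then show ?case using piecewise.empty by blast
  next
    case (Suc i)
    then obtain L where L: "piecewise \<gamma> (\<tau> 0) (\<tau> i) L" by auto
    obtain l where "smooth_piece (\<tau> i) (\<tau> (Suc i)) \<gamma> l"
      using Suc.prems smooth_curve_is_piece[OF \<tau>(3)[of i] \<tau>(4)[of i] riem[of _ i]] by auto
    from piecewise_join[OF L piecewise_single[OF this]] show ?case by blast
  qed
  from this[of m] \<tau>(1,2) that show ?thesis by auto
qed

lemma piecewise_partition:
  assumes "piecewise \<gamma> a b L"
  shows "\<exists>(m::nat) \<tau> :: nat \<Rightarrow> real. \<tau> 0 = a \<and> \<tau> m = b \<and>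
    (\<forall>i<m. \<tau> i < \<tau> (Suc i) \<and> smooth_curve_on A {\<tau> i..\<tau> (Suc i)} \<gamma>)"
  using assms
proof (induction rule: piecewise.induct)
  case (empty a)
  show ?case by (intro exI[of _ 0] exI[of _ "\<lambda>_. a"]) simp
next
  case (cons a b l c L)
  then obtain m :: nat and \<tau> :: "nat \<Rightarrow> real" where \<tau>: "\<tau> 0 = b" "\<tau> m = c"
    "\<forall>i<m. \<tau> i < \<tau> (Suc i) \<and> smooth_curve_on A {\<tau> i..\<tau> (Suc i)} \<gamma>" by blast
  let ?\<tau> = "case_nat a \<tau>"
  have "?\<tau> i < ?\<tau> (Suc i) \<and> smooth_curve_on A {?\<tau> i..?\<tau> (Suc i)} \<gamma>" if "i < Suc m" for i
    using that \<tau> cons.hyps(1) by (cases i) (auto simp: smooth_piece_def)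
  then show ?case using \<tau>(2) by (intro exI[of _ "Suc m"] exI[of _ ?\<tau>]) simp
qed

lemma piecewise_speed_integral:
  assumes "piecewise \<gamma> a b L" "0 \<le> a" "b \<le> 1"
  shows "((\<lambda>t. L2_norm X A (\<gamma> t) (velocity A \<gamma> t)) has_integral L) {a..b}"
  using assms
proof (induction rule: piecewise.induct)
  case (empty a)
  show ?case by (simp add: has_integral_refl)
next
  case (cons a b l c L)
  have le: "a < b" "b \<le> c" using cons.hyps piecewise_le by (auto simp: smooth_piece_def)
  from cons.hyps(1) obtain h where h: "\<And>t. t \<in> {a..b} \<Longrightarrow> has_velocity A \<gamma> (h t) t {a..b}"
    and l: "((\<lambda>t. L2_norm X A (\<gamma> t) (h t)) has_integral l) {a..b}"
    unfolding smooth_piece_def by blast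
  have "velocity A \<gamma> t = h t" if t: "t \<in> {a<..<b}" for t
  proof -
    have "at t within {0..1} = at t" "at t within {a..b} = at t"
      using t le cons.prems by (auto intro!: at_within_interior)
    then have iff: "has_velocity A \<gamma> k t {0..1} \<longleftrightarrow> has_velocity A \<gamma> k t {a..b}" for k
      by (simp add: has_velocity_def)
    have ht: "has_velocity A \<gamma> (h t) t {a..b}" using h t by auto
    have "at t within {a..b} \<noteq> bot" using \<open>at t within {a..b} = at t\<close> by simp
    then have "k = h t" if "has_velocity A \<gamma> k t {a..b}" for k
      using limitin_smooth_unique[OF atlas] that ht unfolding has_velocity_def by blast
    with ht show ?thesis unfolding velocity_def iff by (intro the_equality)
  qed
  then have "((\<lambda>t. L2_norm X A (\<gamma> t) (velocity A \<gamma> t)) has_integral l) {a..b}"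
    using has_integral_spike_interior[OF l[folded cbox_interval]] by (simp add: box_real)
  moreover have "((\<lambda>t. L2_norm X A (\<gamma> t) (velocity A \<gamma> t)) has_integral L) {b..c}"
    using cons.IH cons.prems le by simp
  ultimately show ?case
    using le has_integral_combine[of a b c] by simp
qed

lemma path_len_piecewise: "piecewise \<gamma> 0 1 L \<Longrightarrow> path_len X A \<gamma> = L"
  unfolding path_len_def by (intro integral_unique piecewise_speed_integral) auto

definition joined_by :: "('a, 'n) tensor_field \<Rightarrow> ('a, 'n) tensor_field \<Rightarrow> real \<Rightarrow> bool" where
  "joined_by g\<^sub>0 g\<^sub>1 L \<longleftrightarrow>
     (\<exists>\<gamma>. (\<forall>t\<in>{0..1}. \<gamma> t \<in> riem_metrics A) \<and> piecewise \<gamma> 0 1 L \<and> \<gamma> 0 = g\<^sub>0 \<and> \<gamma> 1 = g\<^sub>1)"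

lemma path_lengths_eq:
  "{path_len X A \<gamma> | \<gamma>. metric_path A \<gamma> \<and> \<gamma> 0 = g\<^sub>0 \<and> \<gamma> 1 = g\<^sub>1} = {L. joined_by g\<^sub>0 g\<^sub>1 L}"
proof (intro set_eqI iffI)
  fix L assume "L \<in> {path_len X A \<gamma> | \<gamma>. metric_path A \<gamma> \<and> \<gamma> 0 = g\<^sub>0 \<and> \<gamma> 1 = g\<^sub>1}"
  then obtain \<gamma> where \<gamma>: "L = path_len X A \<gamma>" "metric_path A \<gamma>" "\<gamma> 0 = g\<^sub>0" "\<gamma> 1 = g\<^sub>1" by blast
  obtain L' where "piecewise \<gamma> 0 1 L'" using metric_path_piecewise[OF \<gamma>(2)] by blast
  then show "L \<in> {L. joined_by g\<^sub>0 g\<^sub>1 L}"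
    using \<gamma> path_len_piecewise unfolding joined_by_def metric_path_def by auto
next
  fix L assume "L \<in> {L. joined_by g\<^sub>0 g\<^sub>1 L}"
  then obtain \<gamma> where \<gamma>: "\<forall>t\<in>{0..1}. \<gamma> t \<in> riem_metrics A" "piecewise \<gamma> 0 1 L" "\<gamma> 0 = g\<^sub>0" "\<gamma> 1 = g\<^sub>1"
    unfolding joined_by_def by blast
  then have "metric_path A \<gamma>"
    unfolding metric_path_def using piecewise_partition by blast
  then show "L \<in> {path_len X A \<gamma> | \<gamma>. metric_path A \<gamma> \<and> \<gamma> 0 = g\<^sub>0 \<and> \<gamma> 1 = g\<^sub>1}"
    using \<gamma> path_len_piecewise by blast
qed

lemma joined_by_nonneg: "joined_by g\<^sub>0 g\<^sub>1 L \<Longrightarrow> L \<ge> 0"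
  unfolding joined_by_def using piecewise_length_nonneg by blast

lemma joined_by_sym:
  assumes "joined_by g\<^sub>0 g\<^sub>1 L"
  shows "joined_by g\<^sub>1 g\<^sub>0 L"
proof -
  obtain \<gamma> where \<gamma>: "\<forall>t\<in>{0..1}. \<gamma> t \<in> riem_metrics A" "piecewise \<gamma> 0 1 L" "\<gamma> 0 = g\<^sub>0" "\<gamma> 1 = g\<^sub>1"
    using assms unfolding joined_by_def by blast
  have "piecewise (\<lambda>t. \<gamma> (1 - t)) 0 1 L"
    using piecewise_affine[OF piecewise_reverse[OF \<gamma>(2)], of 1 "- 1"] by simp
  then show ?thesis
    unfolding joined_by_def using \<gamma> by (intro exI[of _ "\<lambda>t. \<gamma> (1 - t)"]) auto
qed

lemma joined_by_trans:
  assumes "joined_by g\<^sub>0 g\<^sub>1 L" "joined_by g\<^sub>1 g\<^sub>2 L'"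
  shows "joined_by g\<^sub>0 g\<^sub>2 (L + L')"
proof -
  obtain \<gamma> where \<gamma>: "\<forall>t\<in>{0..1}. \<gamma> t \<in> riem_metrics A" "piecewise \<gamma> 0 1 L" "\<gamma> 0 = g\<^sub>0" "\<gamma> 1 = g\<^sub>1"
    using assms(1) unfolding joined_by_def by blast
  obtain \<delta> where \<delta>: "\<forall>t\<in>{0..1}. \<delta> t \<in> riem_metrics A" "piecewise \<delta> 0 1 L'" "\<delta> 0 = g\<^sub>1" "\<delta> 1 = g\<^sub>2"
    using assms(2) unfolding joined_by_def by blast
  define \<epsilon> where "\<epsilon> t = (if t \<le> 1 / 2 then \<gamma> (2 * t) else \<delta> (2 * t - 1))" for t
  have "piecewise (\<lambda>t. \<gamma> (2 * t + 0)) ((0 - 0) / 2) ((1 - 0) / 2) L"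
    by (rule piecewise_affine[OF \<gamma>(2)]) simp
  then have "piecewise (\<lambda>t. \<gamma> (2 * t)) 0 (1 / 2) L" by simp
  then have 1: "piecewise \<epsilon> 0 (1 / 2) L"
    by (rule piecewise_cong) (auto simp: \<epsilon>_def)
  have "piecewise (\<lambda>t. \<delta> (2 * t + - 1)) ((0 - - 1) / 2) ((1 - - 1) / 2) L'"
    by (rule piecewise_affine[OF \<delta>(2)]) simp
  then have *: "piecewise (\<lambda>t. \<delta> (2 * t - 1)) (1 / 2) 1 L'" by simp
  have 2: "piecewise \<epsilon> (1 / 2) 1 L'"
  proof (rule piecewise_cong[OF *])
    fix t :: real assume "t \<in> {1 / 2..1}"
    then show "\<delta> (2 * t - 1) = \<epsilon> t"
    proof (cases "t = 1 / 2")
      case True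
      show ?thesis unfolding True using \<gamma>(4) \<delta>(3) by (simp add: \<epsilon>_def)
    qed (simp add: \<epsilon>_def)
  qed
  have "\<epsilon> t \<in> riem_metrics A" if "t \<in> {0..1}" for t
    using \<gamma>(1) \<delta>(1) that by (auto simp: \<epsilon>_def)
  then show ?thesis
    unfolding joined_by_def using piecewise_join[OF 1 2] \<gamma> \<delta> by (intro exI[of _ \<epsilon>]) (auto simp: \<epsilon>_def)
qed

lemma riem_metrics_convex:
  assumes "g\<^sub>0 \<in> riem_metrics A" "g\<^sub>1 \<in> riem_metrics A" "0 \<le> t" "t \<le> 1"
  shows "(\<lambda>c p. (1 - t) *\<^sub>R g\<^sub>0 c p + t *\<^sub>R g\<^sub>1 c p) \<in> riem_metrics A"
proof -
  have "v \<bullet> (((1 - t) *\<^sub>R g\<^sub>0 c p + t *\<^sub>R g\<^sub>1 c p) *v v) > 0"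
    if "c \<in> A" "p \<in> fst c" "v \<noteq> 0" for c p v
  proof -
    have pos: "v \<bullet> (g\<^sub>0 c p *v v) > 0" "v \<bullet> (g\<^sub>1 c p *v v) > 0"
      using assms(1,2) that by (auto simp: riem_metrics_def)
    have "v \<bullet> (((1 - t) *\<^sub>R g\<^sub>0 c p + t *\<^sub>R g\<^sub>1 c p) *v v) =
        (1 - t) * (v \<bullet> (g\<^sub>0 c p *v v)) + t * (v \<bullet> (g\<^sub>1 c p *v v))"
      by (simp add: matrix_vector_mult_add_rdistrib scaleR_matrix_vector_assoc[symmetric] inner_add_right)
    also have "\<dots> > 0"
      using pos assms(3,4) by (cases "t = 1") (auto intro: add_pos_nonneg)
    finally show ?thesis .
  qed
  then show ?thesis
    using sym_tensors_lincomb[OF atlas metric_sym[OF assms(1)] metric_sym[OF assms(2)]]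
    by (simp add: riem_metrics_def)
qed

lemma joined_by_exists:
  assumes "g\<^sub>0 \<in> riem_metrics A" "g\<^sub>1 \<in> riem_metrics A"
  obtains L where "joined_by g\<^sub>0 g\<^sub>1 L"
proof -
  define \<gamma> where "\<gamma> t = (\<lambda>c p. (1 - t) *\<^sub>R g\<^sub>0 c p + t *\<^sub>R g\<^sub>1 c p)" for t :: real
  define k where "k = (\<lambda>c p. (- 1) *\<^sub>R g\<^sub>0 c p + 1 *\<^sub>R g\<^sub>1 c p)"
  define z :: "('a, 'n) tensor_field" where "z = (\<lambda>c p. 0)"
  have k: "k \<in> sym_tensors A"
    unfolding k_def by (rule sym_tensors_lincomb[OF atlas metric_sym[OF assms(1)] metric_sym[OF assms(2)]])
  have z: "z \<in> sym_tensors A"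
    using sym_tensors_scaleR[OF atlas k, of 0] by (simp add: z_def)
  have const: "has_velocity A (\<lambda>_. h) z t T" for h t T
    unfolding has_velocity_def limitin_smooth_topology using z by (auto simp: z_def)
  have vel: "has_velocity A \<gamma> k t T" for t T
    unfolding has_velocity_def
  proof (rule limitin_transform_eventually)
    show "\<forall>\<^sub>F s in at t within T. k = (\<lambda>c p. (\<gamma> s c p - \<gamma> t c p) /\<^sub>R (s - t))"
      unfolding eventually_at_filter
    proof (intro always_eventually allI impI ext)
      fix s c p assume "s \<noteq> t"
      have "\<gamma> s c p - \<gamma> t c p = (s - t) *\<^sub>R k c p"
        by (simp add: \<gamma>_def k_def algebra_simps)
      then show "k c p = (\<gamma> s c p - \<gamma> t c p) /\<^sub>R (s - t)" using \<open>s \<noteq> t\<close> by simp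
    qed
    show "limitin (smooth_topology A) (\<lambda>_. k) k (at t within T)"
      unfolding limitin_smooth_topology using k by auto
  qed
  define D where "D n = (if n = 0 then \<gamma> else if n = 1 then (\<lambda>_. k) else (\<lambda>_. z))" for n :: nat
  have "smooth_curve_on A {0..1} \<gamma>"
    unfolding smooth_curve_on_def
    by (rule exI[of _ D]) (auto simp: D_def vel const)
  moreover have riem: "\<gamma> t \<in> riem_metrics A" if "t \<in> {0..1}" for t
    unfolding \<gamma>_def using riem_metrics_convex[OF assms] that by simp
  ultimately obtain l where "smooth_piece 0 1 \<gamma> l"
    using smooth_curve_is_piece[of 0 1 \<gamma>] by auto
  then have "joined_by g\<^sub>0 g\<^sub>1 l"
    unfolding joined_by_def using riem piecewise_single by (intro exI[of _ \<gamma>]) (auto simp: \<gamma>_def)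
  then show ?thesis by (rule that)
qed

lemma joined_by_refl:
  assumes "g \<in> riem_metrics A"
  shows "joined_by g g 0"
proof -
  define z :: "('a, 'n) tensor_field" where "z = (\<lambda>c p. 0)"
  have z: "z \<in> sym_tensors A"
    using sym_tensors_scaleR[OF atlas metric_sym[OF assms], of 0] by (simp add: z_def)
  have const: "has_velocity A (\<lambda>_. h) z t T" for h t T
    unfolding has_velocity_def limitin_smooth_topology using z by (auto simp: z_def)
  have "smooth_curve_on A {0..1} (\<lambda>_. g)"
    unfolding smooth_curve_on_def
    by (rule exI[of _ "\<lambda>n t. if n = 0 then g else z"]) (auto simp: const)
  moreover have "L2_norm X A g z = 0"
    using L2_norm_scaleR[of g 0 g] by (simp add: z_def)
  ultimately have "smooth_piece 0 1 (\<lambda>_. g) 0"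
    unfolding smooth_piece_def using const by (auto intro!: exI[of _ "\<lambda>_. z"])
  then show ?thesis
    unfolding joined_by_def using assms piecewise_single by (intro exI[of _ "\<lambda>_. g"]) auto
qed

end

section \<open>Separation of points\<close>

lemma has_real_derivative_pos_part_square:
  "((\<lambda>s. (max 0 s)\<^sup>2) has_real_derivative 2 * max 0 s) (at (s :: real))"
proof -
  consider "s > 0" | "s < 0" | "s = 0" by linarith
  then show ?thesis
  proof cases
    case 1
    have "((\<lambda>s. s\<^sup>2) has_real_derivative 2 * max 0 s) (at s)"
      using 1 by (auto intro!: derivative_eq_intros)
    then show ?thesis
      by (rule has_field_derivative_transform_within_open[where S = "{0<..}"]) (use 1 in auto)
  next
    case 2
    have "((\<lambda>s. 0) has_real_derivative 2 * max 0 s) (at s)"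
      using 2 by (auto intro!: derivative_eq_intros)
    then show ?thesis
      by (rule has_field_derivative_transform_within_open[where S = "{..<0}"]) (use 2 in auto)
  next
    case 3
    have "(\<lambda>h. ((max 0 (0 + h))\<^sup>2 - (max 0 0)\<^sup>2) / h) \<midarrow>0\<rightarrow> (0 :: real)"
    proof (rule Lim_null_comparison)
      show "\<forall>\<^sub>F h in at 0. norm (((max 0 (0 + h))\<^sup>2 - (max 0 0)\<^sup>2) / h) \<le> \<bar>h\<bar>"
        by (rule always_eventually) (auto simp: max_def power2_eq_square)
      show "(\<lambda>h :: real. \<bar>h\<bar>) \<midarrow>0\<rightarrow> 0" by (rule tendsto_rabs_zero) (rule tendsto_ident_at)
    qed
    then show ?thesis using 3 by (simp add: DERIV_def)
  qed
qed

lemma Cauchy_Schwarz_integral_sqrt: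
  fixes w :: "'b::euclidean_space \<Rightarrow> real"
  assumes "continuous_on (cbox a b) w" "\<And>x. x \<in> cbox a b \<Longrightarrow> 0 \<le> w x" "measure lborel (cbox a b) > 0"
  shows "integral (cbox a b) (\<lambda>x. sqrt (w x)) \<le> sqrt (measure lborel (cbox a b)) * sqrt (integral (cbox a b) w)"
proof -
  define V J where "V = measure lborel (cbox a b)" and "J = integral (cbox a b) (\<lambda>x. sqrt (w x))"
  have cs: "continuous_on (cbox a b) (\<lambda>x. sqrt (w x))"
    using assms(1) by (rule continuous_on_real_sqrt)
  have iw: "w integrable_on cbox a b" and isq: "(\<lambda>x. sqrt (w x)) integrable_on cbox a b"
    using assms(1) cs by (auto intro: integrable_continuous)
  have V: "V > 0" using assms(3) by (simp add: V_def)
  define k where "k = J / V"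
  have "0 \<le> integral (cbox a b) (\<lambda>x. (sqrt (w x) - k)\<^sup>2)"
    by (rule integral_nonneg) (auto intro!: integrable_continuous continuous_intros cs)
  also have "\<dots> = integral (cbox a b) (\<lambda>x. w x - 2 * k * sqrt (w x) + k\<^sup>2)"
    using assms(2) by (intro integral_cong) (simp add: power2_diff)
  also have "\<dots> = integral (cbox a b) w - 2 * k * J + k\<^sup>2 * V"
  proof -
    have "((\<lambda>x. w x - 2 * k * sqrt (w x) + k\<^sup>2) has_integral
        (integral (cbox a b) w - 2 * k * J + V *\<^sub>R k\<^sup>2)) (cbox a b)"
      unfolding J_def V_def
      by (intro has_integral_add has_integral_diff has_integral_mult_right has_integral_const
          integrable_integral iw isq)
    then show ?thesis by (simp add: integral_unique mult.commute)
  qed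
  also have "\<dots> = integral (cbox a b) w - J\<^sup>2 / V"
    using V by (simp add: k_def power2_eq_square field_simps)
  finally have "J\<^sup>2 \<le> V * integral (cbox a b) w"
    using V by (simp add: field_simps)
  then have "J \<le> sqrt (V * integral (cbox a b) w)" by (rule real_le_rsqrt)
  then show ?thesis by (simp add: V_def J_def real_sqrt_mult)
qed

definition bump :: "real \<Rightarrow> 'b::real_inner \<Rightarrow> 'b \<Rightarrow> real" where
  "bump r z y = (max 0 (r\<^sup>2 - (y - z) \<bullet> (y - z)))\<^sup>2"

definition bump_deriv :: "real \<Rightarrow> 'b::real_inner \<Rightarrow> 'b \<Rightarrow> 'b \<Rightarrow> real" where
  "bump_deriv r z y v = 2 * max 0 (r\<^sup>2 - (y - z) \<bullet> (y - z)) * (- 2 * ((y - z) \<bullet> v))"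

lemma bump_has_derivative:
  assumes "(m has_vector_derivative v) (at t within T)"
  shows "((\<lambda>s. bump r z (m s)) has_real_derivative bump_deriv r z (m t) v) (at t within T)"
proof -
  have d: "((\<lambda>s. m s - z) has_derivative (\<lambda>s. s *\<^sub>R v)) (at t within T)"
    using assms unfolding has_vector_derivative_def by (auto intro!: derivative_eq_intros)
  have "((\<lambda>s. (m s - z) \<bullet> (m s - z)) has_derivative
      (\<lambda>s. (m t - z) \<bullet> (s *\<^sub>R v) + (s *\<^sub>R v) \<bullet> (m t - z))) (at t within T)"
    by (rule has_derivative_inner[OF d d])
  moreover have "(\<lambda>s. (m t - z) \<bullet> (s *\<^sub>R v) + (s *\<^sub>R v) \<bullet> (m t - z)) = (*) (2 * ((m t - z) \<bullet> v))"
    by (auto simp: inner_commute)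
  ultimately have "((\<lambda>s. (m s - z) \<bullet> (m s - z)) has_real_derivative 2 * ((m t - z) \<bullet> v)) (at t within T)"
    by (simp add: has_field_derivative_def)
  from DERIV_diff[OF DERIV_const this, of "r\<^sup>2"]
  have "((\<lambda>s. r\<^sup>2 - (m s - z) \<bullet> (m s - z)) has_real_derivative - 2 * ((m t - z) \<bullet> v)) (at t within T)"
    by simp
  from DERIV_chain2[OF has_real_derivative_pos_part_square this] show ?thesis
    unfolding bump_def bump_deriv_def .
qed

lemma bump_deriv_bound:
  assumes "r > 0" "norm (y - z) \<le> r \<Longrightarrow> norm v \<le> B" "0 \<le> B"
  shows "\<bar>bump_deriv r z y v\<bar> \<le> 4 * r ^ 3 * B"
proof (cases "norm (y - z) \<le> r")
  case True
  have q: "(y - z) \<bullet> (y - z) = (norm (y - z))\<^sup>2" by (simp add: power2_norm_eq_inner)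
  have "\<bar>(y - z) \<bullet> v\<bar> \<le> norm (y - z) * norm v" by (rule Cauchy_Schwarz_ineq2)
  also have "\<dots> \<le> r * B" using True assms by (intro mult_mono) auto
  finally have 1: "\<bar>(y - z) \<bullet> v\<bar> \<le> r * B" .
  have 2: "max 0 (r\<^sup>2 - (y - z) \<bullet> (y - z)) \<le> r\<^sup>2" by simp
  have "\<bar>bump_deriv r z y v\<bar> = 4 * (max 0 (r\<^sup>2 - (y - z) \<bullet> (y - z)) * \<bar>(y - z) \<bullet> v\<bar>)"
    by (simp add: bump_deriv_def abs_mult)
  also have "\<dots> \<le> 4 * (r\<^sup>2 * (r * B))"
    using 1 2 by (intro mult_left_mono mult_mono) auto
  also have "\<dots> = 4 * r ^ 3 * B" by (simp add: power2_eq_square power3_eq_cube)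
  finally show ?thesis .
next
  case False
  then have "r\<^sup>2 \<le> (norm (y - z))\<^sup>2" using assms(1) by (intro power_mono) auto
  then have "bump_deriv r z y v = 0" by (simp add: bump_deriv_def power2_norm_eq_inner max_def)
  then show ?thesis using assms by simp
qed

lemma continuous_on_bump [continuous_intros]:
  "continuous_on S m \<Longrightarrow> continuous_on S (\<lambda>x. bump r z (m x))"
  unfolding bump_def by (intro continuous_intros)

lemma continuous_on_bump_deriv [continuous_intros]:
  "continuous_on S m \<Longrightarrow> continuous_on S v \<Longrightarrow> continuous_on S (\<lambda>x. bump_deriv r z (m x) (v x))"
  unfolding bump_deriv_def by (intro continuous_intros)

context closed_smooth_manifold
begin

definition bump_integral ::
    "('a, 'n) chart \<Rightarrow> real ^ 'n \<Rightarrow> real ^ 'n \<Rightarrow> real \<Rightarrow> real ^ 'n ^ 'n \<Rightarrow> ('a, 'n) tensor_field \<Rightarrow> real" where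
  "bump_integral c a b r z g = integral (cbox a b) (\<lambda>x. bump r z (local_rep g c x))"

lemma bump_integral_piece:
  assumes c: "c \<in> A" and box: "cbox a b \<subseteq> snd c ` fst c" "measure lborel (cbox a b) > 0"
    and r: "r > 0" and C: "C \<ge> 0"
      "\<And>G H. transpose G = G \<Longrightarrow> norm (G - z) \<le> r \<Longrightarrow> transpose H = H \<Longrightarrow> norm H \<le> C * sqrt (energy G H)"
    and piece: "smooth_piece s e \<gamma> l" and riem: "\<And>t. t \<in> {s..e} \<Longrightarrow> \<gamma> t \<in> riem_metrics A"
  shows "\<bar>bump_integral c a b r z (\<gamma> e) - bump_integral c a b r z (\<gamma> s)\<bar>
    \<le> 4 * r ^ 3 * C * sqrt (measure lborel (cbox a b)) * l"
proof -
  from piece obtain k where se: "s < e" and sm: "smooth_curve_on A {s..e} \<gamma>"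
    and k: "\<And>t. t \<in> {s..e} \<Longrightarrow> has_velocity A \<gamma> (k t) t {s..e}"
    and l: "((\<lambda>t. L2_norm X A (\<gamma> t) (k t)) has_integral l) {s..e}"
    unfolding smooth_piece_def by blast
  obtain h where h: "\<And>t. t \<in> {s..e} \<Longrightarrow> has_velocity A \<gamma> (h t) t {s..e}"
    and cg: "continuous_on ({s..e} \<times> cbox a b) (\<lambda>z. local_rep (\<gamma> (fst z)) c (snd z))"
    and ch: "continuous_on ({s..e} \<times> cbox a b) (\<lambda>z. local_rep (h (fst z)) c (snd z))"
  proof -
    obtain h where 1: "\<forall>t\<in>{s..e}. has_velocity A \<gamma> (h t) t {s..e}"
      and 2: "\<forall>c\<in>A. \<forall>K. compact K \<longrightarrow> K \<subseteq> snd c ` fst c \<longrightarrow>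
        continuous_on ({s..e} \<times> K) (\<lambda>z. local_rep (\<gamma> (fst z)) c (snd z)) \<and>
        continuous_on ({s..e} \<times> K) (\<lambda>z. local_rep (h (fst z)) c (snd z))"
      using smooth_curve_velocity[OF sm riem] by blast
    show ?thesis
      by (rule that[of h]) (simp_all only: 1[rule_format] 2[rule_format, OF c compact_cbox box(1)])
  qed
  have "h t = k t" if t: "t \<in> {s<..<e}" for t
  proof -
    have "t \<in> {s..e}" using t by simp
    moreover have "at t within {s..e} \<noteq> bot" using t by (subst at_within_interior) auto
    ultimately show ?thesis
      using h k unfolding has_velocity_def by (intro limitin_smooth_unique[OF atlas])
  qed
  then have lh: "((\<lambda>t. L2_norm X A (\<gamma> t) (h t)) has_integral l) {s..e}"
    using has_integral_spike_interior[OF l[folded cbox_interval]] by (simp add: box_real)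
  have hs: "h t \<in> sym_tensors A" if "t \<in> {s..e}" for t by (rule has_velocity_sym[OF h[OF that]])
  let ?f = "\<lambda>t x. bump r z (local_rep (\<gamma> t) c x)"
  let ?f' = "\<lambda>t x. bump_deriv r z (local_rep (\<gamma> t) c x) (local_rep (h t) c x)"
  have contg: "continuous_on (cbox a b) (local_rep (\<gamma> t) c)" "continuous_on (cbox a b) (local_rep (h t) c)"
    if "t \<in> {s..e}" for t
    using continuous_on_subset[OF sym_tensors_continuous[OF metric_sym[OF riem[OF that]] c] box(1)]
      continuous_on_subset[OF sym_tensors_continuous[OF hs[OF that] c] box(1)] by auto
  have deriv: "((\<lambda>t. bump_integral c a b r z (\<gamma> t)) has_vector_derivative integral (cbox a b) (?f' t)) (at t within {s..e})"
    if t: "t \<in> {s..e}" for t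
    unfolding bump_integral_def has_real_derivative_iff_has_vector_derivative[symmetric]
  proof (rule leibniz_rule_field_derivative[OF _ _ _ t])
    show "((\<lambda>t. ?f t x) has_real_derivative ?f' t x) (at t within {s..e})"
      if "t \<in> {s..e}" "x \<in> cbox a b" for t x
      by (rule bump_has_derivative[OF has_velocity_vector_derivative[OF h c]]) (use that box in auto)
    show "?f t integrable_on cbox a b" if "t \<in> {s..e}" for t
      by (intro integrable_continuous continuous_intros contg that)
    show "continuous_on ({s..e} \<times> cbox a b) (\<lambda>(t, x). ?f' t x)"
      unfolding case_prod_beta by (intro continuous_intros cg ch)
  qed simp
  have bound: "norm (integral (cbox a b) (?f' t)) \<le> 4 * r ^ 3 * C * sqrt (measure lborel (cbox a b)) * L2_norm X A (\<gamma> t) (h t)"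
    if t: "t \<in> {s..e}" for t
  proof -
    let ?E = "energy_rep (\<gamma> t) (h t) c"
    have E: "continuous_on (cbox a b) ?E" "\<And>x. x \<in> cbox a b \<Longrightarrow> 0 \<le> ?E x"
      using continuous_on_subset[OF continuous_energy_rep[OF riem[OF t] hs[OF t] c] box(1)]
        energy_rep_nonneg[OF riem[OF t] hs[OF t] c] box(1) by auto
    have "norm (integral (cbox a b) (?f' t)) \<le> integral (cbox a b) (\<lambda>x. 4 * r ^ 3 * C * sqrt (?E x))"
    proof (rule integral_norm_bound_integral)
      show "?f' t integrable_on cbox a b"
        by (intro integrable_continuous continuous_intros contg t)
      show "(\<lambda>x. 4 * r ^ 3 * C * sqrt (?E x)) integrable_on cbox a b"
        by (intro integrable_continuous continuous_intros E)
      fix x assume x: "x \<in> cbox a b"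
      have "norm (?f' t x) \<le> 4 * r ^ 3 * (C * sqrt (?E x))"
        unfolding real_norm_def
      proof (rule bump_deriv_bound[OF r])
        assume "norm (local_rep (\<gamma> t) c x - z) \<le> r"
        then show "norm (local_rep (h t) c x) \<le> C * sqrt (?E x)"
          unfolding energy_rep_def using x box(1) t
          by (intro C(2) local_rep_symmetric metric_sym riem hs c) auto
      qed (use C(1) E(2)[OF x] in simp)
      then show "norm (?f' t x) \<le> 4 * r ^ 3 * C * sqrt (?E x)" by (simp add: mult.assoc)
    qed
    also have "\<dots> = 4 * r ^ 3 * C * integral (cbox a b) (\<lambda>x. sqrt (?E x))"
      by simp
    also have "\<dots> \<le> 4 * r ^ 3 * C * (sqrt (measure lborel (cbox a b)) * sqrt (integral (cbox a b) ?E))"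
      using r C(1) by (intro mult_left_mono Cauchy_Schwarz_integral_sqrt E box) auto
    also have "\<dots> \<le> 4 * r ^ 3 * C * (sqrt (measure lborel (cbox a b)) * L2_norm X A (\<gamma> t) (h t))"
      unfolding L2_norm_def using r C(1)
      by (intro mult_left_mono real_sqrt_le_mono integral_energy_le_L2_inner riem hs t c box) auto
    finally show ?thesis by (simp add: mult.assoc)
  qed
  have ftc: "((\<lambda>t. integral (cbox a b) (?f' t)) has_integral
      (bump_integral c a b r z (\<gamma> e) - bump_integral c a b r z (\<gamma> s))) {s..e}"
    using se deriv by (intro fundamental_theorem_of_calculus) auto
  have bi: "((\<lambda>t. 4 * r ^ 3 * C * sqrt (measure lborel (cbox a b)) * L2_norm X A (\<gamma> t) (h t)) has_integral
      (4 * r ^ 3 * C * sqrt (measure lborel (cbox a b)) * l)) {s..e}"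
    by (rule has_integral_mult_right[OF lh])
  have "norm (integral {s..e} (\<lambda>t. integral (cbox a b) (?f' t))) \<le>
      integral {s..e} (\<lambda>t. 4 * r ^ 3 * C * sqrt (measure lborel (cbox a b)) * L2_norm X A (\<gamma> t) (h t))"
    using has_integral_integrable[OF ftc] has_integral_integrable[OF bi] bound
    by (rule integral_norm_bound_integral)
  then show ?thesis
    by (simp only: integral_unique[OF ftc] integral_unique[OF bi] real_norm_def)
qed

lemma bump_integral_piecewise:
  assumes c: "c \<in> A" and box: "cbox a b \<subseteq> snd c ` fst c" "measure lborel (cbox a b) > 0"
    and r: "r > 0" and C: "C \<ge> 0"
      "\<And>G H. transpose G = G \<Longrightarrow> norm (G - z) \<le> r \<Longrightarrow> transpose H = H \<Longrightarrow> norm H \<le> C * sqrt (energy G H)"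
    and pw: "piecewise \<gamma> s e L" and riem: "\<And>t. t \<in> {s..e} \<Longrightarrow> \<gamma> t \<in> riem_metrics A"
  shows "\<bar>bump_integral c a b r z (\<gamma> e) - bump_integral c a b r z (\<gamma> s)\<bar>
    \<le> 4 * r ^ 3 * C * sqrt (measure lborel (cbox a b)) * L"
  using pw riem
proof (induction rule: piecewise.induct)
  case (cons s u l e L)
  have le: "s < u" "u \<le> e" using cons.hyps piecewise_le by (auto simp: smooth_piece_def)
  have "\<bar>bump_integral c a b r z (\<gamma> u) - bump_integral c a b r z (\<gamma> s)\<bar>
      \<le> 4 * r ^ 3 * C * sqrt (measure lborel (cbox a b)) * l"
    by (rule bump_integral_piece[OF c box r C cons.hyps(1)]) (use le cons.prems in auto)
  moreover have "\<bar>bump_integral c a b r z (\<gamma> e) - bump_integral c a b r z (\<gamma> u)\<bar>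
      \<le> 4 * r ^ 3 * C * sqrt (measure lborel (cbox a b)) * L"
    by (rule cons.IH) (use le cons.prems in auto)
  ultimately show ?case by (simp add: distrib_left)
qed simp

lemma joined_by_lower_bound:
  assumes g: "g\<^sub>0 \<in> riem_metrics A" "g\<^sub>1 \<in> riem_metrics A" and ne: "g\<^sub>0 \<noteq> g\<^sub>1"
  obtains e where "e > 0" "\<And>L. joined_by g\<^sub>0 g\<^sub>1 L \<Longrightarrow> e \<le> L"
proof -
  obtain c x0 where c: "c \<in> A" and x0: "x0 \<in> snd c ` fst c"
    and diff: "local_rep g\<^sub>0 c x0 \<noteq> local_rep g\<^sub>1 c x0"
    using sym_tensors_eqI[OF atlas metric_sym[OF g(1)] metric_sym[OF g(2)]] ne by blast
  define z where "z = local_rep g\<^sub>0 c x0"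
  define d where "d = norm (local_rep g\<^sub>1 c x0 - z)"
  have d: "d > 0" using diff by (simp add: d_def z_def)
  have "spd z" unfolding z_def by (rule metric_spd(2)[OF g(1) c x0])
  then obtain r C where r: "r > 0" "r \<le> d / 2" and C: "C > 0"
    "\<And>G H. transpose G = G \<Longrightarrow> norm (G - z) \<le> r \<Longrightarrow> transpose H = H \<Longrightarrow> norm H \<le> C * sqrt (energy G H)"
    using energy_lower_bound[of z "d / 2"] d by (metis half_gt_zero)
  define W where "W = snd c ` fst c \<inter> local_rep g\<^sub>0 c -` ball z (r / 2) \<inter>
    (snd c ` fst c \<inter> local_rep g\<^sub>1 c -` ball (local_rep g\<^sub>1 c x0) (d / 2))"
  have op: "open (snd c ` fst c \<inter> local_rep g c -` ball y s)" if "g \<in> riem_metrics A" for g y s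
    using sym_tensors_continuous[OF metric_sym[OF that] c] chart_open_image[OF c] open_ball
    by (rule continuous_open_preimage)
  have "open W" unfolding W_def by (rule open_Int[OF op[OF g(1)] op[OF g(2)]])
  moreover have "x0 \<in> W" using x0 r d by (simp add: W_def z_def)
  ultimately obtain a b where ab: "cbox a b \<subseteq> W" "\<forall>i\<in>Basis. a \<bullet> i < b \<bullet> i"
    using open_contains_cbox by metis
  define V where "V = measure lborel (cbox a b)"
  have V: "V > 0" using ab(2) by (simp add: V_def content_pos_lt_eq)
  have box: "cbox a b \<subseteq> snd c ` fst c" using ab(1) by (auto simp: W_def)
  have cont: "continuous_on (cbox a b) (local_rep g c)" if "g \<in> riem_metrics A" for g
    using continuous_on_subset[OF sym_tensors_continuous[OF metric_sym[OF that] c] box] .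
  have "bump r z (local_rep g\<^sub>1 c x) = 0" if "x \<in> cbox a b" for x
  proof -
    have "norm (local_rep g\<^sub>1 c x - local_rep g\<^sub>1 c x0) < d / 2"
      using that ab(1) by (auto simp: W_def dist_norm norm_minus_commute)
    moreover have "d \<le> norm (local_rep g\<^sub>1 c x0 - local_rep g\<^sub>1 c x) + norm (local_rep g\<^sub>1 c x - z)"
      unfolding d_def using norm_triangle_ineq[of "local_rep g\<^sub>1 c x0 - local_rep g\<^sub>1 c x" "local_rep g\<^sub>1 c x - z"] by simp
    ultimately have "r \<le> norm (local_rep g\<^sub>1 c x - z)"
      using r by (simp add: norm_minus_commute)
    then have "r\<^sup>2 \<le> (norm (local_rep g\<^sub>1 c x - z))\<^sup>2" using r by (intro power_mono) auto
    then show ?thesis by (simp add: bump_def power2_norm_eq_inner max_def)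
  qed
  then have far: "bump_integral c a b r z g\<^sub>1 = 0"
    unfolding bump_integral_def by (simp cong: integral_cong)
  have near: "(r\<^sup>2 / 2)\<^sup>2 * V \<le> bump_integral c a b r z g\<^sub>0"
  proof -
    have "(r\<^sup>2 / 2)\<^sup>2 \<le> bump r z (local_rep g\<^sub>0 c x)" if "x \<in> cbox a b" for x
    proof -
      have "norm (local_rep g\<^sub>0 c x - z) \<le> r / 2"
        using that ab(1) by (auto simp: W_def dist_norm norm_minus_commute)
      then have "(norm (local_rep g\<^sub>0 c x - z))\<^sup>2 \<le> (r / 2)\<^sup>2" by (intro power_mono) auto
      then have "(local_rep g\<^sub>0 c x - z) \<bullet> (local_rep g\<^sub>0 c x - z) \<le> r\<^sup>2 / 4"
        by (simp add: power2_norm_eq_inner power_divide)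
      moreover have "r\<^sup>2 \<ge> 0" by simp
      ultimately have "r\<^sup>2 / 2 \<le> max 0 (r\<^sup>2 - (local_rep g\<^sub>0 c x - z) \<bullet> (local_rep g\<^sub>0 c x - z))"
        by linarith
      then show ?thesis unfolding bump_def by (intro power_mono) auto
    qed
    then have "integral (cbox a b) (\<lambda>x. (r\<^sup>2 / 2)\<^sup>2) \<le> bump_integral c a b r z g\<^sub>0"
      unfolding bump_integral_def
      by (intro integral_le integrable_continuous continuous_intros cont g)
    then show ?thesis by (simp add: V_def mult.commute)
  qed
  define M where "M = 4 * r ^ 3 * C * sqrt V"
  have M: "M > 0" using r C V by (simp add: M_def)
  have "(r\<^sup>2 / 2)\<^sup>2 * V / M \<le> L" if "joined_by g\<^sub>0 g\<^sub>1 L" for L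
  proof -
    obtain \<gamma> where \<gamma>: "\<forall>t\<in>{0..1}. \<gamma> t \<in> riem_metrics A" "piecewise \<gamma> 0 1 L" "\<gamma> 0 = g\<^sub>0" "\<gamma> 1 = g\<^sub>1"
      using \<open>joined_by g\<^sub>0 g\<^sub>1 L\<close> unfolding joined_by_def by blast
    have "\<bar>bump_integral c a b r z (\<gamma> 1) - bump_integral c a b r z (\<gamma> 0)\<bar> \<le> M * L"
      unfolding M_def V_def
      by (rule bump_integral_piecewise[OF c box _ r(1) _ C(2) \<gamma>(2)])
         (use \<gamma>(1) C(1) V in \<open>auto simp: V_def\<close>)
    then have "(r\<^sup>2 / 2)\<^sup>2 * V \<le> M * L" using far near \<gamma>(3,4) by simp
    then show ?thesis using M by (simp add: divide_le_eq mult.commute)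
  qed
  moreover have "(r\<^sup>2 / 2)\<^sup>2 * V / M > 0" using r V M by simp
  ultimately show ?thesis using that by blast
qed

lemma L2_dist_eq:
  assumes "g\<^sub>0 \<in> riem_metrics A" "g\<^sub>1 \<in> riem_metrics A"
  shows "L2_dist X A g\<^sub>0 g\<^sub>1 = Inf {L. joined_by g\<^sub>0 g\<^sub>1 L}"
  unfolding L2_dist_def path_lengths_eq using assms by simp

lemma joined_by_bdd_below: "bdd_below {L. joined_by g\<^sub>0 g\<^sub>1 L}"
  using joined_by_nonneg by (intro bdd_belowI[of _ 0]) auto

lemma joined_by_nonempty:
  "g\<^sub>0 \<in> riem_metrics A \<Longrightarrow> g\<^sub>1 \<in> riem_metrics A \<Longrightarrow> {L. joined_by g\<^sub>0 g\<^sub>1 L} \<noteq> {}"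
  using joined_by_exists by blast

lemma L2_dist_Metric_space: "Metric_space (riem_metrics A) (L2_dist X A)"
proof
  fix x y
  show "0 \<le> L2_dist X A x y"
  proof (cases "x \<in> riem_metrics A \<and> y \<in> riem_metrics A")
    case True
    then show ?thesis
      by (simp only: L2_dist_eq) (intro cInf_greatest joined_by_nonempty, auto intro: joined_by_nonneg)
  qed (simp only: L2_dist_def if_False order_refl)
  show "L2_dist X A x y = L2_dist X A y x"
  proof (cases "x \<in> riem_metrics A \<and> y \<in> riem_metrics A")
    case True
    have "{L. joined_by x y L} = {L. joined_by y x L}" using joined_by_sym by blast
    then show ?thesis using True by (simp add: L2_dist_eq)
  next
    case False
    then show ?thesis unfolding L2_dist_def by (simp only: if_False) (metis conj_commute)
  qed
next
  fix x y assume xy: "x \<in> riem_metrics A" "y \<in> riem_metrics A"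
  show "L2_dist X A x y = 0 \<longleftrightarrow> x = y"
  proof
    assume eq: "L2_dist X A x y = 0"
    show "x = y"
    proof (rule ccontr)
      assume "x \<noteq> y"
      then obtain e where e: "e > 0" "\<And>L. joined_by x y L \<Longrightarrow> e \<le> L"
        using joined_by_lower_bound[OF xy] by blast
      then have "e \<le> Inf {L. joined_by x y L}"
        by (intro cInf_greatest joined_by_nonempty xy) auto
      then show False using e(1) eq xy by (simp add: L2_dist_eq)
    qed
  next
    assume "x = y"
    then have "joined_by x y 0" using joined_by_refl xy by blast
    then have "Inf {L. joined_by x y L} \<le> 0"
      by (intro cInf_lower joined_by_bdd_below) simp
    moreover have "0 \<le> Inf {L. joined_by x y L}"
      by (intro cInf_greatest joined_by_nonempty xy) (auto intro: joined_by_nonneg)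
    ultimately show "L2_dist X A x y = 0" using xy by (simp add: L2_dist_eq)
  qed
next
  fix x y z assume xyz: "x \<in> riem_metrics A" "y \<in> riem_metrics A" "z \<in> riem_metrics A"
  have *: "Inf {L. joined_by x z L} \<le> L + L'" if "joined_by x y L" "joined_by y z L'" for L L'
    by (intro cInf_lower joined_by_bdd_below) (use joined_by_trans[OF that] in simp)
  have "Inf {L. joined_by x z L} - L \<le> Inf {L. joined_by y z L}" if "joined_by x y L" for L
    by (intro cInf_greatest joined_by_nonempty xyz) (use *[OF that] in force)
  then have "Inf {L. joined_by x z L} - Inf {L. joined_by y z L} \<le> Inf {L. joined_by x y L}"
    by (intro cInf_greatest joined_by_nonempty xyz) force
  then show "L2_dist X A x z \<le> L2_dist X A x y + L2_dist X A y z"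
    using xyz by (simp add: L2_dist_eq)
qed

end

theorem theorem18:
  fixes X :: "'a topology" and A :: "('a, 'n::finite) chart set"
  assumes "closed_manifold X A" and "orientable_manifold X A"
  shows "Metric_space (riem_metrics A) (L2_dist X A)"
proof -
  interpret closed_smooth_manifold X A
    using assms(1) by unfold_locales
  show ?thesis by (rule L2_dist_Metric_space)
qed

end
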